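(* There exists a constant $C_{\rm dec}>0$, depending only on $V$, such that for every $0<\varepsilon\le1$ and every solution $u_\varepsilon:\mathbb D^2\to\mathbb R^k$ of $-\Delta u_\varepsilon=-\varepsilon^{-2}\nabla V(u_\varepsilon)$ on $\mathbb D^2$, $$\int_{\mathbb D^2(\frac9{16})}e_\varepsilon(u_\varepsilon)\,dx\le C_{\rm dec}\left[\left(\int_{\mathbb D^2}e_\varepsilon(u_\varepsilon)\,dx\right)^{\frac32}+\varepsilon\int_{\mathbb D^2}e_\varepsilon(u_\varepsilon)\,dx\right].$$
   Context: Let $k\ge 1$ and let $V:\mathbb R^k\to\mathbb R$ be smooth with $\inf V=0$ and satisfying: (1) $\Sigma:=\{y\in\mathbb R^k: V(y)=0\}=\{\sigma_1,\dots,\sigma_q\}$ is finite with $q\ge2$; (2) the Hessian $\nabla^2V(\sigma_i)$ is positive definite for every $i$; (3) there are constants $\alpha_\infty>0$, $R_\infty>0$ such that $y\cdot\nabla V(y)\ge\alpha_\infty|y|^2$ if $|y|>R_\infty$, and $V(y)\to+\infty$ as $|y|\to+\infty$. $\mathbb D^2(r)$ is the open disc of $\mathbb R^2$ centered at $0$ with radius $r$, $\mathbb D^2=\mathbb D^2(1)$; $e_\varepsilon(u)=\varepsilon\frac{|\nabla u|^2}{2}+\frac1\varepsilon V(u)$. Solutions are smooth maps satisfying the equation pointwise. *)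

theory Defs
  imports "HOL-Analysis.Analysis"
begin

text \<open>
  All derivatives below are full (two-sided) derivatives \<open>at x\<close>, so the following notions are
  meant for open sets \<open>S\<close>. For open \<open>S\<close>, \<open>Ck_on n S f\<close> is the usual class of \<open>n\<close> times
  continuously differentiable functions.
\<close>

primrec Ck_on ::
  "nat \<Rightarrow> 'a::real_normed_vector set \<Rightarrow> ('a \<Rightarrow> 'b::real_normed_vector) \<Rightarrow> bool" where
  "Ck_on 0 S f \<longleftrightarrow> continuous_on S f"
| "Ck_on (Suc n) S f \<longleftrightarrow>
     (\<forall>x\<in>S. f differentiable (at x)) \<and>
     (\<forall>v. Ck_on n S (\<lambda>x. frechet_derivative f (at x) v))"

definition smooth_on ::
  "'a::real_normed_vector set \<Rightarrow> ('a \<Rightarrow> 'b::real_normed_vector) \<Rightarrow> bool" where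
  "smooth_on S f \<longleftrightarrow> (\<forall>n. Ck_on n S f)"

definition gradient :: "('a::real_inner \<Rightarrow> real) \<Rightarrow> 'a \<Rightarrow> 'a" where
  "gradient f x = (THE D. GDERIV f x :> D)"

definition hessian :: "(real ^ 'n \<Rightarrow> real) \<Rightarrow> real ^ 'n \<Rightarrow> real ^ 'n ^ 'n" where
  "hessian f x = jacobian (gradient f) (at x)"

definition pos_def_matrix :: "real ^ 'n ^ 'n \<Rightarrow> bool" where
  "pos_def_matrix A \<longleftrightarrow> transpose A = A \<and> (\<forall>v. v \<noteq> 0 \<longrightarrow> 0 < v \<bullet> (A *v v))"

definition partial_deriv :: "'n \<Rightarrow> (real ^ 'n \<Rightarrow> 'b::real_normed_vector) \<Rightarrow> real ^ 'n \<Rightarrow> 'b" where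
  "partial_deriv i f x = frechet_derivative f (at x) (axis i 1)"

definition laplacian :: "(real ^ 'n \<Rightarrow> 'b::real_normed_vector) \<Rightarrow> real ^ 'n \<Rightarrow> 'b" where
  "laplacian f x = (\<Sum>i\<in>UNIV. partial_deriv i (partial_deriv i f) x)"

definition energy_density ::
  "(real ^ 'k \<Rightarrow> real) \<Rightarrow> real \<Rightarrow> (real ^ 2 \<Rightarrow> real ^ 'k) \<Rightarrow> real ^ 2 \<Rightarrow> real" where
  "energy_density V \<epsilon> u x =
     \<epsilon> * ((\<Sum>i\<in>UNIV. (norm (partial_deriv i u x))\<^sup>2) / 2) + (1 / \<epsilon>) * V (u x)"

text \<open>
  The energy is a Lebesgue integral with values in \<open>[0, \<infinity>]\<close>, since a solution on the open disc
  need not have finite energy on the whole disc. The density is nonnegative whenever \<open>V \<ge> 0\<close>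
  and \<open>\<epsilon> > 0\<close>, so the truncation in \<^const>\<open>ennreal\<close> is then inactive.
\<close>

definition energy ::
  "(real ^ 'k \<Rightarrow> real) \<Rightarrow> real \<Rightarrow> (real ^ 2 \<Rightarrow> real ^ 'k) \<Rightarrow> (real ^ 2) set \<Rightarrow> ennreal" where
  "energy V \<epsilon> u S = (\<integral>\<^sup>+x\<in>S. ennreal (energy_density V \<epsilon> u x) \<partial>lborel)"

text \<open>Real powers on \<open>[0, \<infinity>]\<close>, intended for positive exponents.\<close>

definition ennreal_powr :: "ennreal \<Rightarrow> real \<Rightarrow> ennreal" where
  "ennreal_powr x a = (if x = \<infinity> then \<infinity> else ennreal (enn2real x powr a))"

definition allen_cahn_solution ::
  "(real ^ 'k \<Rightarrow> real) \<Rightarrow> real \<Rightarrow> (real ^ 2 \<Rightarrow> real ^ 'k) \<Rightarrow> (real ^ 2) set \<Rightarrow> bool" where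
  "allen_cahn_solution V \<epsilon> u S \<longleftrightarrow>
     smooth_on S u \<and> (\<forall>x\<in>S. - laplacian u x = - ((1 / \<epsilon>\<^sup>2) *\<^sub>R gradient V (u x)))"

end

theory Submission
  imports Defs
begin

text \<open>
  Discs are replaced by axis-parallel squares, so that only Fubini and the fundamental theorem of
  calculus are needed; no sup bound on the solution and no elliptic regularity enters.

  Let \<open>E\<close> be the energy on \<open>[-7/10, 7/10]\<^sup>2\<close>, which lies in the unit disc; one may assume that \<open>E\<close> and
  \<open>\<epsilon>\<close> are small. (1) Testing the equation with the gradient of \<open>s sqrt (s\<^sup>2 + |u - \<sigma>|\<^sup>2)\<close>, cut off
  away from the well \<open>\<sigma>\<close>, bounds the energy of the set where \<open>u\<close> is \<open>s\<close>-close to a well by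
  \<open>C (s + \<epsilon>) E\<close>. (2) On the boundary of a square chosen by averaging the energy is at most \<open>C E\<close>; since
  the variation of \<open>|u - \<sigma>|\<^sup>2\<close> is controlled by the energy, \<open>u\<close> is there \<open>s\<close>-close to a well with
  \<open>s\<close> of order \<open>sqrt E\<close>. By (1) one can even choose the square so that its boundary carries energy at
  most \<open>C (s + \<epsilon>) E\<close>, and the Pohozaev identity then bounds the potential energy inside by the same
  quantity. (3) The gradient is controlled by the potential at scale \<open>\<epsilon>\<close>: if a rescaled solution on a
  square has small potential energy, an isoperimetric argument shows that it is close to a single well
  up to a set of small measure, and a Caccioppoli inequality centred at this well applies.
\<close>

section \<open>Calculus on squares\<close>

text \<open>The exponent 3/2 is E times a closeness s of order sqrt E. The obstacle is a circle:
  closeness to a well on a boundary comes from the energy there, and the improved bound for that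
  energy comes from closeness. It is broken by fixing s in terms of E before a square is chosen and
  by a continuous nonnegative majorant N that dominates the energy density wherever u is s-close to
  some well; one average then controls both the energy and N on the same four segments. In (3), a
  bound linear in the potential asks for a test field of size sqrt V. A field vanishing at one well
  is of order 1 near the others, so the area on which u is near the others must itself be linear in
  the potential; it is bounded by a product of row and column variations, each of the order of the
  square root. At infinity only the radial part of the gradient of V has a sign, so the test fields
  must be radial or zero there. If E or \<epsilon> is not small, sqrt E + \<epsilon> is bounded
  below, and monotonicity of the energy in the domain is enough. The half-sides 9/16 < 3/5 < 13/20 <
  7/10 leave room for averaging over centres, for choosing a boundary and for a cutoff.\<close>

definition sq :: "real \<Rightarrow> (real \<times> real) set" where
  "sq r = cbox (-r, -r) (r, r)"

lemma mem_sq: "(x, y) \<in> sq r \<longleftrightarrow> x \<in> {-r..r} \<and> y \<in> {-r..r}"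
  by (auto simp: sq_def)

lemma mem_sq_abs: "z \<in> sq r \<longleftrightarrow> \<bar>fst z\<bar> \<le> r \<and> \<bar>snd z\<bar> \<le> r"
  by (cases z) (auto simp: mem_sq)

lemma sq_mono: "r \<le> r' \<Longrightarrow> sq r \<subseteq> sq r'"
  by (auto simp: mem_sq_abs)

section \<open>Continuity, Fubini and monotonicity for integrals over squares\<close>

lemma integrable_sq:
  fixes f :: "real \<times> real \<Rightarrow> 'a::banach"
  shows "continuous_on (sq r) f \<Longrightarrow> f integrable_on sq r"
  unfolding sq_def by (rule integrable_continuous)

lemma continuous_on_row:
  "continuous_on (sq r) f \<Longrightarrow> y \<in> {-r..r} \<Longrightarrow> continuous_on {-r..r} (\<lambda>x. f (x, y))"
  by (rule continuous_on_compose2[where g = f and t = "sq r"])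
    (auto intro!: continuous_intros simp: mem_sq)

lemma continuous_on_column:
  "continuous_on (sq r) f \<Longrightarrow> x \<in> {-r..r} \<Longrightarrow> continuous_on {-r..r} (\<lambda>y. f (x, y))"
  by (rule continuous_on_compose2[where g = f and t = "sq r"])
    (auto intro!: continuous_intros simp: mem_sq)

lemma continuous_on_integral_column:
  fixes f :: "real \<times> real \<Rightarrow> 'a::banach"
  assumes "continuous_on (sq r) f"
  shows "continuous_on {-r..r} (\<lambda>x. integral {-r..r} (\<lambda>y. f (x, y)))"
  using integral_continuous_on_param[of "{-r..r}" "-r" r "\<lambda>x y. f (x, y)"] assms
  by (simp add: sq_def cbox_Pair_eq)

lemma continuous_on_swap_sq:
  "continuous_on (sq r) f \<Longrightarrow> continuous_on (sq r) (\<lambda>(y, x). f (x, y))"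
  unfolding case_prod_unfold
  by (rule continuous_on_compose2[where g = f and t = "sq r"])
    (auto intro!: continuous_intros simp: mem_sq)

lemma continuous_on_integral_row:
  fixes f :: "real \<times> real \<Rightarrow> 'a::banach"
  assumes "continuous_on (sq r) f"
  shows "continuous_on {-r..r} (\<lambda>y. integral {-r..r} (\<lambda>x. f (x, y)))"
  using continuous_on_integral_column[OF continuous_on_swap_sq[OF assms]] by simp

lemma integral_sq_columns:
  fixes f :: "real \<times> real \<Rightarrow> 'a::banach"
  assumes "continuous_on (sq r) f"
  shows "integral (sq r) f = integral {-r..r} (\<lambda>x. integral {-r..r} (\<lambda>y. f (x, y)))"
  using integral_prod_continuous[of "-r" "-r" r r f] assms by (simp add: sq_def)

lemma integral_sq_rows:
  fixes f :: "real \<times> real \<Rightarrow> 'a::banach"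
  assumes "continuous_on (sq r) f"
  shows "integral (sq r) f = integral {-r..r} (\<lambda>y. integral {-r..r} (\<lambda>x. f (x, y)))"
  using integral_sq_columns[OF assms] integral_swap_continuous[of "-r" "-r" r r "\<lambda>x y. f (x, y)"] assms
  by (simp add: sq_def)

lemma integral_sq_const: "0 \<le> r \<Longrightarrow> integral (sq r) (\<lambda>_. c::real) = (2 * r)\<^sup>2 * c"
  by (subst integral_sq_columns) (auto simp: power2_eq_square)

lemma integral_sq_product:
  fixes h k :: "real \<Rightarrow> real"
  assumes "continuous_on {-r..r} h" "continuous_on {-r..r} k"
  shows "integral (sq r) (\<lambda>(x, y). h y * k x) = integral {-r..r} h * integral {-r..r} k"
proof -
  have "continuous_on (sq r) (\<lambda>(x, y). h y * k x)"
    unfolding case_prod_unfold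
    by (intro continuous_intros continuous_on_compose2[OF assms(1)] continuous_on_compose2[OF assms(2)])
      (auto simp: mem_sq)
  from integral_sq_columns[OF this] show ?thesis by simp
qed

lemma integral_sq_mono:
  fixes f :: "real \<times> real \<Rightarrow> real"
  assumes "continuous_on (sq r) f" "continuous_on (sq r) g" "\<And>z. z \<in> sq r \<Longrightarrow> f z \<le> g z"
  shows "integral (sq r) f \<le> integral (sq r) g"
  using assms by (intro integral_le integrable_sq)

lemma integral_sq_nonneg:
  fixes f :: "real \<times> real \<Rightarrow> real"
  assumes "continuous_on (sq r) f" "\<And>z. z \<in> sq r \<Longrightarrow> 0 \<le> f z"
  shows "0 \<le> integral (sq r) f"
  using assms by (intro integral_nonneg integrable_sq)

lemma integral_sq_subset:
  fixes f :: "real \<times> real \<Rightarrow> real"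
  assumes "r' \<le> r" "continuous_on (sq r) f" "\<And>z. z \<in> sq r \<Longrightarrow> 0 \<le> f z"
  shows "integral (sq r') f \<le> integral (sq r) f"
  using assms sq_mono[OF assms(1)]
  by (intro integral_subset_le integrable_sq continuous_on_subset[OF assms(2)]) auto

text \<open>Derivatives are taken along coordinate lines only, and two-sided even at boundary points
  of \<open>S\<close>. The fundamental theorem of calculus then applies on closed squares, and
  product and chain rules reduce to one variable. The continuity clauses make the integrands below
  integrable.\<close>

definition has_partials ::
  "(real \<times> real) set \<Rightarrow> (real \<times> real \<Rightarrow> 'a::real_normed_vector) \<Rightarrow>
    (real \<times> real \<Rightarrow> 'a) \<Rightarrow> (real \<times> real \<Rightarrow> 'a) \<Rightarrow> bool" where
  "has_partials S f f1 f2 \<longleftrightarrow>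
     continuous_on S f \<and> continuous_on S f1 \<and> continuous_on S f2 \<and>
     (\<forall>x y. (x, y) \<in> S \<longrightarrow> ((\<lambda>t. f (t, y)) has_vector_derivative f1 (x, y)) (at x) \<and>
                       ((\<lambda>t. f (x, t)) has_vector_derivative f2 (x, y)) (at y))"

lemma has_partialsD:
  assumes "has_partials S f f1 f2"
  shows "continuous_on S f" "continuous_on S f1" "continuous_on S f2"
    "\<And>x y. (x, y) \<in> S \<Longrightarrow> ((\<lambda>t. f (t, y)) has_vector_derivative f1 (x, y)) (at x)"
    "\<And>x y. (x, y) \<in> S \<Longrightarrow> ((\<lambda>t. f (x, t)) has_vector_derivative f2 (x, y)) (at y)"
  using assms unfolding has_partials_def by auto

lemma has_partials_subset:
  "has_partials S f f1 f2 \<Longrightarrow> T \<subseteq> S \<Longrightarrow> has_partials T f f1 f2"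
  unfolding has_partials_def by (blast intro: continuous_on_subset)

lemma has_partials_cong:
  assumes "has_partials S f f1 f2" "\<And>z. z \<in> S \<Longrightarrow> g1 z = f1 z"
  shows "has_partials S f g1 f2"
  using assms continuous_on_cong[OF refl assms(2), of S] unfolding has_partials_def by simp

lemma has_partials_bilinear:
  assumes "bounded_bilinear B" "has_partials S f f1 f2" "has_partials S g g1 g2"
  shows "has_partials S (\<lambda>z. B (f z) (g z)) (\<lambda>z. B (f z) (g1 z) + B (f1 z) (g z))
     (\<lambda>z. B (f z) (g2 z) + B (f2 z) (g z))"
  unfolding has_partials_def
  by (intro conjI allI impI continuous_on_add bounded_bilinear.continuous_on[OF assms(1)]
      bounded_bilinear.has_vector_derivative[OF assms(1)] has_partialsD[OF assms(2)] has_partialsD[OF assms(3)])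

lemmas has_partials_inner = has_partials_bilinear[OF bounded_bilinear_inner]
lemmas has_partials_scaleR = has_partials_bilinear[OF bounded_bilinear_scaleR]
lemmas has_partials_mult = has_partials_bilinear[OF bounded_bilinear_mult]

lemma has_partials_add:
  assumes "has_partials S f f1 f2" "has_partials S g g1 g2"
  shows "has_partials S (\<lambda>z. f z + g z) (\<lambda>z. f1 z + g1 z) (\<lambda>z. f2 z + g2 z)"
  unfolding has_partials_def
  by (intro conjI allI impI continuous_on_add has_vector_derivative_add
     has_partialsD[OF assms(1)] has_partialsD[OF assms(2)])

lemma has_partials_diff:
  assumes "has_partials S f f1 f2" "has_partials S g g1 g2"
  shows "has_partials S (\<lambda>z. f z - g z) (\<lambda>z. f1 z - g1 z) (\<lambda>z. f2 z - g2 z)"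
  unfolding has_partials_def
  by (intro conjI allI impI continuous_on_diff has_vector_derivative_diff
     has_partialsD[OF assms(1)] has_partialsD[OF assms(2)])

lemma has_partials_const: "has_partials S (\<lambda>z. c) (\<lambda>z. 0) (\<lambda>z. 0)"
  unfolding has_partials_def by (auto intro!: derivative_eq_intros)

lemma has_partials_fst: "has_partials S fst (\<lambda>z. 1) (\<lambda>z. 0)"
  unfolding has_partials_def by (auto intro!: continuous_intros derivative_eq_intros)

lemma has_partials_snd: "has_partials S snd (\<lambda>z. 0) (\<lambda>z. 1)"
  unfolding has_partials_def by (auto intro!: continuous_intros derivative_eq_intros)

lemma has_partials_compose_real:
  fixes f :: "real \<times> real \<Rightarrow> real"
  assumes f: "has_partials S f f1 f2"
    and phi: "\<And>t. t \<in> f ` S \<Longrightarrow> (\<phi> has_vector_derivative \<phi>' t) (at t)" "continuous_on (f ` S) \<phi>'"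
  shows "has_partials S (\<lambda>z. \<phi> (f z)) (\<lambda>z. f1 z *\<^sub>R \<phi>' (f z)) (\<lambda>z. f2 z *\<^sub>R \<phi>' (f z))"
proof -
  note d = has_partialsD[OF f]
  have "continuous_on (f ` S) \<phi>"
    by (meson continuous_at_imp_continuous_on has_vector_derivative_continuous phi(1))
  then have "continuous_on S (\<lambda>z. \<phi> (f z))" "continuous_on S (\<lambda>z. \<phi>' (f z))"
    using continuous_on_compose2[OF _ d(1)] phi(2) by blast+
  moreover have "((\<lambda>t. \<phi> (f (t, y))) has_vector_derivative f1 (x, y) *\<^sub>R \<phi>' (f (x, y))) (at x)"
     "((\<lambda>t. \<phi> (f (x, t))) has_vector_derivative f2 (x, y) *\<^sub>R \<phi>' (f (x, y))) (at y)"
    if "(x, y) \<in> S" for x y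
    using vector_diff_chain_at[of "\<lambda>t. f (t, y)" "f1 (x, y)" x \<phi> "\<phi>' (f (x, y))"]
      vector_diff_chain_at[of "\<lambda>t. f (x, t)" "f2 (x, y)" y \<phi> "\<phi>' (f (x, y))"] d(4,5)[OF that] phi(1) that
    by (auto simp: o_def)
  ultimately show ?thesis using d unfolding has_partials_def by (auto intro!: continuous_intros)
qed

lemma has_partials_compose_gderiv:
  fixes w :: "real \<times> real \<Rightarrow> 'a::euclidean_space"
  assumes w: "has_partials S w p q"
    and V: "\<And>y. (V has_derivative (\<lambda>h. g y \<bullet> h)) (at y)" "continuous_on UNIV g"
  shows "has_partials S (\<lambda>z. V (w z)) (\<lambda>z. g (w z) \<bullet> p z) (\<lambda>z. g (w z) \<bullet> q z)"
proof -
  note d = has_partialsD[OF w]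
  have "continuous_on UNIV V"
    using V(1) by (meson has_derivative_continuous_on has_derivative_at_withinI)
  then have "continuous_on S (\<lambda>z. V (w z))" "continuous_on S (\<lambda>z. g (w z))"
    using continuous_on_compose2[OF _ d(1)] V(2) by blast+
  moreover have "((\<lambda>t. V (w (t, y))) has_vector_derivative g (w (x, y)) \<bullet> p (x, y)) (at x)"
     "((\<lambda>t. V (w (x, t))) has_vector_derivative g (w (x, y)) \<bullet> q (x, y)) (at y)"
    if "(x, y) \<in> S" for x y
    using has_derivative_compose[OF d(4)[OF that, unfolded has_vector_derivative_def] V(1)]
      has_derivative_compose[OF d(5)[OF that, unfolded has_vector_derivative_def] V(1)]
    by (simp_all add: has_vector_derivative_def)
  ultimately show ?thesis using d unfolding has_partials_def by (auto intro!: continuous_intros)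
qed

text \<open>The fundamental theorem of calculus on each row for \<open>F1\<close> and on each column
  for \<open>G2\<close>, combined by Fubini.\<close>

lemma divergence_sq:
  fixes F G :: "real \<times> real \<Rightarrow> real"
  assumes F: "has_partials (sq r) F F1 F2" and G: "has_partials (sq r) G G1 G2" and r: "0 \<le> r"
  shows "integral (sq r) (\<lambda>z. F1 z + G2 z) =
    integral {-r..r} (\<lambda>y. F (r, y) - F (-r, y)) + integral {-r..r} (\<lambda>x. G (x, r) - G (x, -r))"
proof -
  note F = has_partialsD[OF F] and G = has_partialsD[OF G]
  have 1: "integral {-r..r} (\<lambda>x. F1 (x, y)) = F (r, y) - F (-r, y)" if "y \<in> {-r..r}" for y
    using F(4)[of _ y] that r
    by (intro integral_unique fundamental_theorem_of_calculus)
      (auto simp: mem_sq intro: has_vector_derivative_at_within)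
  have 2: "integral {-r..r} (\<lambda>y. G2 (x, y)) = G (x, r) - G (x, -r)" if "x \<in> {-r..r}" for x
    using G(5)[of x] that r
    by (intro integral_unique fundamental_theorem_of_calculus)
      (auto simp: mem_sq intro: has_vector_derivative_at_within)
  have "integral (sq r) F1 = integral {-r..r} (\<lambda>y. F (r, y) - F (-r, y))"
    unfolding integral_sq_rows[OF F(2)] by (rule integral_cong) (rule 1)
  moreover have "integral (sq r) G2 = integral {-r..r} (\<lambda>x. G (x, r) - G (x, -r))"
    unfolding integral_sq_columns[OF G(3)] by (rule integral_cong) (rule 2)
  ultimately show ?thesis
    by (simp add: integral_add integrable_sq F G)
qed

section \<open>Cutoff functions\<close>

definition psq :: "real \<Rightarrow> real" where "psq x = (max 0 x)\<^sup>2"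

lemma psq_nonneg: "0 \<le> psq t" by (simp add: psq_def)

lemma psq_le_1: "t \<le> 1 \<Longrightarrow> psq t \<le> 1"
  by (auto simp: psq_def max_def power_le_one)

lemma one_minus_psq_le: "1 - psq (1 - t) \<le> 2 * t"
  by (auto simp: psq_def max_def power2_eq_square algebra_simps)

text \<open>Squaring the positive part removes the corner at 0. The derivative is twice the square
  root of \<open>psq\<close>; the cutoffs built from it inherit a derivative bound by their own
  square root, which is what Young's inequality can absorb.\<close>

lemma DERIV_psq: "(psq has_real_derivative 2 * max 0 x) (at x)"
proof -
  consider "x < 0" | "x = 0" | "0 < x" by linarith
  then show ?thesis
  proof cases
    case 1
    show ?thesis
      by (rule has_field_derivative_transform_within[where f = "\<lambda>_. 0" and d = "-x"])
        (use 1 in \<open>auto simp: psq_def dist_real_def max_def\<close>)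
  next
    case 3
    show ?thesis
      by (rule has_field_derivative_transform_within[where f = "\<lambda>x. x\<^sup>2" and d = x])
        (use 3 in \<open>auto intro!: derivative_eq_intros simp: psq_def dist_real_def max_def\<close>)
  next
    case 2
    have "((\<lambda>h. psq h / h) \<longlongrightarrow> 0) (at 0)"
    proof (rule Lim_null_comparison)
      show "\<forall>\<^sub>F h in at 0. norm (psq h / h) \<le> \<bar>h\<bar>"
        by (auto simp: psq_def max_def power2_eq_square)
      show "((\<lambda>h::real. \<bar>h\<bar>) \<longlongrightarrow> 0) (at 0)"
        by (intro tendsto_rabs_zero tendsto_ident_at)
    qed
    then show ?thesis using 2 by (simp add: has_field_derivative_iff psq_def)
  qed
qed

text \<open>The truncated squared distance to a well occurs at two scales: with \<open>T = m\<close>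
  it detects the well and localises a test field around it, with large \<open>T\<close> it is the
  slow cutoff inside \<open>centred\<close>.\<close>

lemma has_partials_psq_dist:
  fixes w :: "real \<times> real \<Rightarrow> 'a::real_inner"
  assumes "has_partials S w p q"
  shows "has_partials S (\<lambda>z. psq (1 - (w z - \<sigma>) \<bullet> (w z - \<sigma>) / T))
     (\<lambda>z. - (4 / T) * max 0 (1 - (w z - \<sigma>) \<bullet> (w z - \<sigma>) / T) * ((w z - \<sigma>) \<bullet> p z))
     (\<lambda>z. - (4 / T) * max 0 (1 - (w z - \<sigma>) \<bullet> (w z - \<sigma>) / T) * ((w z - \<sigma>) \<bullet> q z))"
proof -
  have a: "has_partials S (\<lambda>z. w z - \<sigma>) p q"
    using has_partials_diff[OF assms has_partials_const[of S \<sigma>]] by simp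
  have b: "has_partials S (\<lambda>z. (w z - \<sigma>) \<bullet> (w z - \<sigma>))
      (\<lambda>z. 2 * ((w z - \<sigma>) \<bullet> p z)) (\<lambda>z. 2 * ((w z - \<sigma>) \<bullet> q z))"
    using has_partials_inner[OF a a] by (simp add: inner_commute)
  have c: "((\<lambda>t. psq (1 - t / T)) has_vector_derivative - (2 / T) * max 0 (1 - t / T)) (at t)" for t
    unfolding has_real_derivative_iff_has_vector_derivative[symmetric]
    unfolding divide_inverse
    by (rule DERIV_cong[OF DERIV_chain2[OF DERIV_psq]], (rule derivative_eq_intros refl)+) simp
  have "has_partials S (\<lambda>z. psq (1 - (w z - \<sigma>) \<bullet> (w z - \<sigma>) / T))
     (\<lambda>z. (2 * ((w z - \<sigma>) \<bullet> p z)) *\<^sub>R (- (2 / T) * max 0 (1 - (w z - \<sigma>) \<bullet> (w z - \<sigma>) / T)))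
     (\<lambda>z. (2 * ((w z - \<sigma>) \<bullet> q z)) *\<^sub>R (- (2 / T) * max 0 (1 - (w z - \<sigma>) \<bullet> (w z - \<sigma>) / T)))"
    by (rule has_partials_compose_real[OF b c]) (auto intro!: continuous_intros simp: divide_inverse)
  then show ?thesis by (simp add: algebra_simps)
qed

definition bump :: "real \<Rightarrow> real \<Rightarrow> real" where "bump r x = psq (1 - (x / r)\<^sup>2)"
definition bump' :: "real \<Rightarrow> real \<Rightarrow> real" where "bump' r x = - (4 * x / r\<^sup>2) * max 0 (1 - (x / r)\<^sup>2)"

lemma DERIV_bump: "(bump r has_real_derivative bump' r x) (at x)"
  unfolding bump_def[abs_def] bump'_def
  unfolding divide_inverse
  by (rule DERIV_cong[OF DERIV_chain2[OF DERIV_psq]], (rule derivative_eq_intros refl)+)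
    (simp add: power2_eq_square)

definition cutoff :: "real \<Rightarrow> real \<times> real \<Rightarrow> real" where
  "cutoff r z = bump r (fst z) * bump r (snd z)"

definition cutoff_x :: "real \<Rightarrow> real \<times> real \<Rightarrow> real" where
  "cutoff_x r z = bump' r (fst z) * bump r (snd z)"

definition cutoff_y :: "real \<Rightarrow> real \<times> real \<Rightarrow> real" where
  "cutoff_y r z = bump r (fst z) * bump' r (snd z)"

lemma continuous_on_bump' [continuous_intros]:
  "continuous_on S f \<Longrightarrow> continuous_on S (\<lambda>x. bump' r (f x))"
  unfolding bump'_def divide_inverse by (intro continuous_intros)

lemma has_partials_cutoff:
  "has_partials S (cutoff r) (cutoff_x r) (cutoff_y r)"
proof -
  have "has_partials S (\<lambda>z. bump r (fst z)) (\<lambda>z. bump' r (fst z)) (\<lambda>z. 0)"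
    using has_partials_compose_real[OF has_partials_fst, of S "bump r" "bump' r"] DERIV_bump[of r]
    by (simp add: has_real_derivative_iff_has_vector_derivative continuous_on_bump')
  moreover have "has_partials S (\<lambda>z. bump r (snd z)) (\<lambda>z. 0) (\<lambda>z. bump' r (snd z))"
    using has_partials_compose_real[OF has_partials_snd, of S "bump r" "bump' r"] DERIV_bump[of r]
    by (simp add: has_real_derivative_iff_has_vector_derivative continuous_on_bump')
  ultimately show ?thesis
    using has_partials_mult[of S "\<lambda>z. bump r (fst z)" "\<lambda>z. bump' r (fst z)" "\<lambda>z. 0"
        "\<lambda>z. bump r (snd z)" "\<lambda>z. 0" "\<lambda>z. bump' r (snd z)"]
    by (simp add: cutoff_def[abs_def] cutoff_x_def[abs_def] cutoff_y_def[abs_def])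
qed

lemma bump_nonneg: "0 \<le> bump r x" and bump_le_1: "bump r x \<le> 1"
  by (auto simp: bump_def psq_def max_def power_le_one)

lemma bump_boundary: "r \<noteq> 0 \<Longrightarrow> bump r r = 0" "r \<noteq> 0 \<Longrightarrow> bump r (-r) = 0"
  by (auto simp: bump_def psq_def)

lemma cutoff_nonneg: "0 \<le> cutoff r z" and cutoff_le_1: "cutoff r z \<le> 1"
  using bump_nonneg bump_le_1 mult_le_one[of "bump r (fst z)" "bump r (snd z)"] by (auto simp: cutoff_def)

lemma bump'_bound:
  assumes "0 < r" "\<bar>x\<bar> \<le> r"
  shows "\<bar>bump' r x\<bar> \<le> 4 / r * sqrt (bump r x)"
proof -
  have "sqrt (bump r x) = max 0 (1 - (x / r)\<^sup>2)"
    by (simp add: bump_def psq_def)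
  moreover have "\<bar>4 * x / r\<^sup>2\<bar> \<le> 4 / r"
    using assms by (simp add: field_simps power2_eq_square abs_mult)
  ultimately show ?thesis
    unfolding bump'_def abs_mult[of "- _"] abs_minus_cancel
    by (simp only: abs_of_nonneg[of "max 0 _"] max.cobounded1 mult_right_mono)
qed

text \<open>The factor that is not differentiated lies in [0, 1], hence is at most its square root;
  together with \<open>bump'_bound\<close> this yields the square root of the whole product.\<close>

lemma cutoff_partials_bound:
  assumes "0 < r" "z \<in> sq r"
  shows "\<bar>cutoff_x r z\<bar> \<le> 4 / r * sqrt (cutoff r z)"
    "\<bar>cutoff_y r z\<bar> \<le> 4 / r * sqrt (cutoff r z)"
proof -
  have s: "b \<le> sqrt b" if "0 \<le> b" "b \<le> 1" for b :: real
    using that by (intro real_le_rsqrt) (simp add: power2_eq_square mult_left_le)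
  note s = s[OF bump_nonneg bump_le_1]
  have z: "\<bar>fst z\<bar> \<le> r" "\<bar>snd z\<bar> \<le> r" using assms(2) by (auto simp: mem_sq_abs)
  show "\<bar>cutoff_x r z\<bar> \<le> 4 / r * sqrt (cutoff r z)"
    using mult_mono[OF bump'_bound[OF assms(1) z(1)] s[of r "snd z"]] assms(1)
    by (simp add: cutoff_def cutoff_x_def real_sqrt_mult abs_mult bump_nonneg mult.assoc)
  show "\<bar>cutoff_y r z\<bar> \<le> 4 / r * sqrt (cutoff r z)"
    using mult_mono[OF s[of r "fst z"] bump'_bound[OF assms(1) z(2)]] assms(1)
    by (simp add: cutoff_def cutoff_y_def real_sqrt_mult abs_mult bump_nonneg ac_simps)
qed

lemma cutoff_lower:
  assumes "0 \<le> r'" "r' < r" "z \<in> sq r'"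
  shows "(1 - (r' / r)\<^sup>2) ^ 4 \<le> cutoff r z" "0 < (1 - (r' / r)\<^sup>2) ^ 4"
proof -
  have q: "(r' / r)\<^sup>2 < 1"
    using assms by (auto simp: power_less_one_iff abs_square_less_1)
  have b: "(1 - (r' / r)\<^sup>2)\<^sup>2 \<le> bump r x" if "\<bar>x\<bar> \<le> r'" for x
  proof -
    have "\<bar>x / r\<bar> \<le> \<bar>r' / r\<bar>" using assms that by (auto simp: divide_right_mono)
    then have "(x / r)\<^sup>2 \<le> (r' / r)\<^sup>2" by (simp only: abs_le_square_iff)
    then show ?thesis using q unfolding bump_def psq_def by (intro power_mono) auto
  qed
  have "(1 - (r' / r)\<^sup>2)\<^sup>2 * (1 - (r' / r)\<^sup>2)\<^sup>2 \<le> cutoff r z"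
    using b assms(3) unfolding cutoff_def by (intro mult_mono) (auto simp: mem_sq_abs bump_nonneg)
  then show "(1 - (r' / r)\<^sup>2) ^ 4 \<le> cutoff r z" by (simp flip: power_add)
  show "0 < (1 - (r' / r)\<^sup>2) ^ 4" using q by simp
qed

text \<open>The divergence theorem for the field with components
  \<open>cutoff r z * (Z z \<bullet> p z)\<close> and
  \<open>cutoff r z * (Z z \<bullet> q z)\<close>, which vanishes on the boundary. When
  \<open>p\<close> and \<open>q\<close> are the first derivatives of a solution,
  \<open>p1 + q2\<close> is its Laplacian and this is the equation tested with the cutoff times
  \<open>Z\<close>.\<close>

lemma integration_by_parts_cutoff:
  fixes Z p q :: "real \<times> real \<Rightarrow> 'a::real_inner"
  assumes Z: "has_partials (sq r) Z Z1 Z2" and p: "has_partials (sq r) p p1 p2"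
    and q: "has_partials (sq r) q q1 q2" and r: "0 < r"
  shows "integral (sq r) (\<lambda>z. cutoff r z * (Z1 z \<bullet> p z + Z2 z \<bullet> q z + Z z \<bullet> (p1 z + q2 z))
      + cutoff_x r z * (Z z \<bullet> p z) + cutoff_y r z * (Z z \<bullet> q z)) = 0"
    (is "integral _ ?J = 0")
proof -
  define F where "F z = cutoff r z * (Z z \<bullet> p z)" for z
  define G where "G z = cutoff r z * (Z z \<bullet> q z)" for z
  have hF: "has_partials (sq r) F
       (\<lambda>z. cutoff r z * (Z z \<bullet> p1 z + Z1 z \<bullet> p z) + cutoff_x r z * (Z z \<bullet> p z))
       (\<lambda>z. cutoff r z * (Z z \<bullet> p2 z + Z2 z \<bullet> p z) + cutoff_y r z * (Z z \<bullet> p z))"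
    unfolding F_def[abs_def]
    by (rule has_partials_mult[OF has_partials_cutoff has_partials_inner[OF Z p]])
  have hG: "has_partials (sq r) G
       (\<lambda>z. cutoff r z * (Z z \<bullet> q1 z + Z1 z \<bullet> q z) + cutoff_x r z * (Z z \<bullet> q z))
       (\<lambda>z. cutoff r z * (Z z \<bullet> q2 z + Z2 z \<bullet> q z) + cutoff_y r z * (Z z \<bullet> q z))"
    unfolding G_def[abs_def]
    by (rule has_partials_mult[OF has_partials_cutoff has_partials_inner[OF Z q]])
  have "?J = (\<lambda>z. (cutoff r z * (Z z \<bullet> p1 z + Z1 z \<bullet> p z) + cutoff_x r z * (Z z \<bullet> p z))
     + (cutoff r z * (Z z \<bullet> q2 z + Z2 z \<bullet> q z) + cutoff_y r z * (Z z \<bullet> q z)))"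
    by (simp add: fun_eq_iff algebra_simps inner_add_right)
  with divergence_sq[OF hF hG] r show ?thesis
    by (simp add: F_def G_def cutoff_def bump_boundary)
qed

section \<open>Multiwell potentials and a Caccioppoli inequality\<close>

text \<open>The functions \<open>p\<close>, \<open>q\<close> are the first and \<open>p1\<close>,
  \<open>p2\<close>, \<open>q2\<close> the second partial derivatives of \<open>u\<close>. Having
  \<open>p2\<close> in both roles builds in the symmetry of the mixed derivatives, on which the
  Pohozaev computation rests. Naming the derivatives makes restriction and rescaling
  immediate.\<close>

definition solves ::
  "('a::real_inner \<Rightarrow> 'a) \<Rightarrow> real \<Rightarrow> real \<Rightarrow> (real \<times> real \<Rightarrow> 'a) \<Rightarrow> (real \<times> real \<Rightarrow> 'a) \<Rightarrow> (real \<times> real \<Rightarrow> 'a)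
    \<Rightarrow> (real \<times> real \<Rightarrow> 'a) \<Rightarrow> (real \<times> real \<Rightarrow> 'a) \<Rightarrow> (real \<times> real \<Rightarrow> 'a) \<Rightarrow> bool" where
  "solves g \<epsilon> r u p q p1 p2 q2 \<longleftrightarrow>
     has_partials (sq r) u p q \<and> has_partials (sq r) p p1 p2 \<and> has_partials (sq r) q p2 q2 \<and>
     (\<forall>z\<in>sq r. \<epsilon>\<^sup>2 *\<^sub>R (p1 z + q2 z) = g (u z))"

lemma solves_mono: "solves g \<epsilon> r u p q p1 p2 q2 \<Longrightarrow> r' \<le> r \<Longrightarrow> solves g \<epsilon> r' u p q p1 p2 q2"
  unfolding solves_def by (meson has_partials_subset sq_mono subsetD)

text \<open>\<open>m\<close> is the square of a radius: within it every well is quadratic, with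
  constants \<open>lam\<close> and \<open>Lam\<close>, and the open neighbourhoods of distinct wells
  are disjoint. Outside the balls of a quarter of that radius, whence \<open>m / 16\<close>,
  \<open>V\<close> is at least \<open>c0\<close>. \<open>K\<close> and \<open>R\<close> describe
  infinity, where \<open>g\<close> is controlled in the radial direction only. Squared distances
  keep square roots out of the chain rule.\<close>

locale multiwell =
  fixes V :: "'a::euclidean_space \<Rightarrow> real" and g :: "'a \<Rightarrow> 'a" and S :: "'a set"
    and m lam Lam c0 K R :: real
  assumes finite_S: "finite S" and S_nonempty: "S \<noteq> {}"
    and V_nonneg: "0 \<le> V y"
    and V_deriv: "(V has_derivative (\<lambda>h. g y \<bullet> h)) (at y)"
    and g_cont: "continuous_on UNIV g"
    and pos: "0 < m" "0 < lam" "0 < Lam" "0 < c0" "0 < K" "0 < R"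
    and near_lower: "\<sigma> \<in> S \<Longrightarrow> (y - \<sigma>) \<bullet> (y - \<sigma>) \<le> m \<Longrightarrow> lam * ((y - \<sigma>) \<bullet> (y - \<sigma>)) \<le> V y"
    and near_upper: "\<sigma> \<in> S \<Longrightarrow> (y - \<sigma>) \<bullet> (y - \<sigma>) \<le> m \<Longrightarrow> V y \<le> Lam * ((y - \<sigma>) \<bullet> (y - \<sigma>))"
    and near_radial: "\<sigma> \<in> S \<Longrightarrow> (y - \<sigma>) \<bullet> (y - \<sigma>) \<le> m \<Longrightarrow> lam * ((y - \<sigma>) \<bullet> (y - \<sigma>)) \<le> (y - \<sigma>) \<bullet> g y"
    and near_grad: "\<sigma> \<in> S \<Longrightarrow> (y - \<sigma>) \<bullet> (y - \<sigma>) \<le> m \<Longrightarrow> norm (g y) \<le> Lam * norm (y - \<sigma>)"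
    and disj: "\<sigma> \<in> S \<Longrightarrow> \<tau> \<in> S \<Longrightarrow> \<sigma> \<noteq> \<tau> \<Longrightarrow> (y - \<sigma>) \<bullet> (y - \<sigma>) < m \<Longrightarrow> m \<le> (y - \<tau>) \<bullet> (y - \<tau>)"
    and away: "(\<And>\<sigma>. \<sigma> \<in> S \<Longrightarrow> m / 16 < (y - \<sigma>) \<bullet> (y - \<sigma>)) \<Longrightarrow> c0 \<le> V y"
    and growth: "y \<bullet> y \<le> K * (1 + V y)"
    and outer: "R < norm y \<Longrightarrow> 0 \<le> y \<bullet> g y"
begin

lemma V_cont: "continuous_on UNIV V"
  using V_deriv by (meson has_derivative_continuous_on has_derivative_at_withinI)

lemma V_comp_cont: "continuous_on A w \<Longrightarrow> continuous_on A (\<lambda>z. V (w z))"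
  by (rule continuous_on_compose2[OF V_cont]) auto

definition centred :: "real \<Rightarrow> 'a \<Rightarrow> 'a \<Rightarrow> 'a" where
  "centred T \<sigma> y = y - psq (1 - (y - \<sigma>) \<bullet> (y - \<sigma>) / T) *\<^sub>R \<sigma>"

text \<open>The test field for the local Caccioppoli inequality: it vanishes at the well \<open>\<sigma>\<close>, is strictly
  monotone because the cutoff is slow, and is radial at infinity, where only the radial component
  of the gradient of \<open>V\<close> is controlled.\<close>

lemma centred_bounds_at:
  assumes \<sigma>: "\<sigma> \<in> S" and M: "norm \<sigma> \<le> M" and T: "T = (8 * M + R + 1)\<^sup>2"
  shows "\<exists>C>0. \<forall>y. centred T \<sigma> y \<bullet> centred T \<sigma> y \<le> C * (1 + V y) \<and> - C * (1 + V y) \<le> centred T \<sigma> y \<bullet> g y \<and>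
     ((\<forall>\<tau>\<in>S - {\<sigma>}. m / 16 < (y - \<tau>) \<bullet> (y - \<tau>)) \<longrightarrow>
       centred T \<sigma> y \<bullet> centred T \<sigma> y \<le> C * V y \<and> - C * V y \<le> centred T \<sigma> y \<bullet> g y)"
proof -
  let ?X = "centred T \<sigma>"
  \<comment> \<open>\<open>8 * M \<le> B\<close> makes the cutoff slow compared with the size of the
    wells; \<open>R < B - M\<close> makes \<open>outer\<close> applicable wherever the cutoff has
    vanished.\<close>
  define B where "B = 8 * M + R + 1"
  have M0: "0 \<le> M" using M norm_ge_zero[of \<sigma>] by linarith
  have B: "0 < B" "T = B\<^sup>2" "8 * M \<le> B" "R < B - M" using M0 pos T by (auto simp: B_def)
  have T0: "0 < T" using B by simp
  have ps: "0 \<le> psq (1 - (y - \<sigma>) \<bullet> (y - \<sigma>) / T)" "psq (1 - (y - \<sigma>) \<bullet> (y - \<sigma>) / T) \<le> 1" for y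
    using T0 by (auto intro!: psq_nonneg psq_le_1)
  have X1: "norm (?X y) \<le> norm y + M" for y
  proof -
    have "norm (psq (1 - (y - \<sigma>) \<bullet> (y - \<sigma>) / T) *\<^sub>R \<sigma>) \<le> 1 * M"
      unfolding norm_scaleR using ps[of y] M by (intro mult_mono) auto
    then show ?thesis unfolding centred_def using norm_triangle_ineq4 order_trans
      by (metis add_left_mono mult_1)
  qed
  have a: "?X y \<bullet> ?X y \<le> (2 * K + 2 * M\<^sup>2) * (1 + V y)" for y
  proof -
    have "?X y \<bullet> ?X y = (norm (?X y))\<^sup>2" by (simp add: dot_square_norm)
    also have "\<dots> \<le> (norm y + M)\<^sup>2" using X1 by (intro power_mono) auto
    also have "\<dots> \<le> 2 * (norm y)\<^sup>2 + 2 * M\<^sup>2"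
      using sum_squares_bound[of "norm y" M] by (simp add: power2_sum)
    also have "\<dots> \<le> 2 * K * (1 + V y) + 2 * M\<^sup>2 * (1 + V y)"
      using growth[of y] mult_left_mono[of 1 "1 + V y" "2 * M\<^sup>2"] V_nonneg[of y]
      by (simp add: dot_square_norm)
    finally show ?thesis by (simp add: algebra_simps)
  qed
  have "compact (g ` cball 0 (B + M))"
    by (intro compact_continuous_image continuous_on_subset[OF g_cont]) auto
  then obtain G where G: "\<And>y. norm y \<le> B + M \<Longrightarrow> norm (g y) \<le> G" "0 < G"
    using compact_imp_bounded bounded_pos by (metis (no_types, lifting) imageI mem_cball_0)
  have b: "- ((B + 2 * M) * G) * (1 + V y) \<le> ?X y \<bullet> g y" for y
  proof (cases "T \<le> (y - \<sigma>) \<bullet> (y - \<sigma>)")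
    case True
    then have "?X y = y" using T0 by (simp add: centred_def psq_def max_def)
    moreover have "B \<le> norm (y - \<sigma>)"
      using True B by (simp add: dot_square_norm power2_le_iff_abs_le)
    then have "R < norm y" using B M norm_triangle_ineq4[of y \<sigma>] by linarith
    moreover have "0 \<le> ((B + 2 * M) * G) * (1 + V y)" using B M0 G V_nonneg[of y] by simp
    ultimately show ?thesis using outer[of y] by simp
  next
    case False
    then have "norm (y - \<sigma>) \<le> B"
      using B by (simp add: dot_square_norm power2_le_iff_abs_le power_less_imp_less_base less_imp_le not_le)
    then have n: "norm y \<le> B + M" using M norm_triangle_sub[of y \<sigma>] by linarith
    have "\<bar>?X y \<bullet> g y\<bar> \<le> norm (?X y) * norm (g y)" by (rule Cauchy_Schwarz_ineq2)
    also have "\<dots> \<le> (B + 2 * M) * G" using X1[of y] n G(1)[OF n] G(2) B M0 by (intro mult_mono) auto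
    also have "\<dots> \<le> (B + 2 * M) * G * (1 + V y)"
      using mult_left_mono[of 1 "1 + V y" "(B + 2 * M) * G"] V_nonneg[of y] B M0 G(2) by simp
    finally show ?thesis by simp
  qed
  define C1 where "C1 = max (2 * K + 2 * M\<^sup>2) ((B + 2 * M) * G)"
  have C1: "0 < C1" using B M0 G pos by (simp add: C1_def less_max_iff_disj)
  have ab: "?X y \<bullet> ?X y \<le> C1 * (1 + V y)" "- C1 * (1 + V y) \<le> ?X y \<bullet> g y" for y
  proof -
    show "?X y \<bullet> ?X y \<le> C1 * (1 + V y)"
      using V_nonneg[of y] by (intro order_trans[OF a] mult_right_mono) (auto simp: C1_def)
    have "((B + 2 * M) * G) * (1 + V y) \<le> C1 * (1 + V y)"
      using V_nonneg[of y] by (intro mult_right_mono) (auto simp: C1_def)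
    then show "- C1 * (1 + V y) \<le> ?X y \<bullet> g y" using b[of y] by simp
  qed
  \<comment> \<open>Near \<sigma> the field is y - \<sigma> plus a multiple of \<sigma> whose
    coefficient is at most 2 / T times the squared distance. Hence its norm is at most
    \<open>D\<close> times the distance.\<close>
  define D where "D = 1 + 2 * sqrt m * M / T"
  have D: "0 < D" using M0 T0 pos by (simp add: D_def add_pos_nonneg)
  define C where "C = C1 * (1 + 1 / c0) + D\<^sup>2 / lam + D * Lam / lam"
  have C: "C1 \<le> C" "C1 * (1 + 1 / c0) \<le> C" "D\<^sup>2 / lam \<le> C" "D * Lam / lam \<le> C" "0 < C"
    using C1 pos D by (auto simp: C_def distrib_left add_pos_nonneg intro!: add_increasing2 add_increasing)
  have far: "?X y \<bullet> ?X y \<le> C * V y \<and> - C * V y \<le> ?X y \<bullet> g y"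
    if "\<forall>\<tau>\<in>S - {\<sigma>}. m / 16 < (y - \<tau>) \<bullet> (y - \<tau>)" for y
  proof (cases "(y - \<sigma>) \<bullet> (y - \<sigma>) \<le> m / 16")
    case True
    define t where "t = (y - \<sigma>) \<bullet> (y - \<sigma>)"
    have t: "0 \<le> t" "t \<le> m" "t = (norm (y - \<sigma>))\<^sup>2"
      using True pos by (auto simp: t_def dot_square_norm)
    have ny: "norm (y - \<sigma>) \<le> sqrt m" using t by (simp add: real_le_rsqrt)
    have X: "?X y = (y - \<sigma>) + (1 - psq (1 - t / T)) *\<^sub>R \<sigma>"
      by (simp add: centred_def t_def algebra_simps)
    have "norm ((1 - psq (1 - t / T)) *\<^sub>R \<sigma>) \<le> (2 * (t / T)) * M"
      unfolding norm_scaleR using ps(2)[of y] one_minus_psq_le[of "t / T"] M t T0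
      by (intro mult_mono) (auto simp: t_def)
    also have "\<dots> = 2 * M / T * (norm (y - \<sigma>) * norm (y - \<sigma>))" by (simp add: t power2_eq_square)
    also have "\<dots> \<le> 2 * M / T * (sqrt m * norm (y - \<sigma>))"
      using ny M0 T0 by (intro mult_left_mono mult_right_mono) auto
    finally have nX: "norm (?X y) \<le> D * norm (y - \<sigma>)"
      unfolding X D_def using norm_triangle_ineq[of "y - \<sigma>" "(1 - psq (1 - t / T)) *\<^sub>R \<sigma>"]
      by (simp add: algebra_simps)
    have low: "t \<le> V y / lam" using near_lower[OF \<sigma>, of y] t pos by (simp add: t_def field_simps)
    have "?X y \<bullet> ?X y \<le> (D * norm (y - \<sigma>))\<^sup>2" using nX by (simp add: dot_square_norm power_mono)
    also have "\<dots> = D\<^sup>2 * t" by (simp add: t power_mult_distrib)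
    also have "\<dots> \<le> D\<^sup>2 * (V y / lam)" using low by (intro mult_left_mono) auto
    also have "\<dots> = D\<^sup>2 / lam * V y" by simp
    also have "\<dots> \<le> C * V y" using C V_nonneg by (intro mult_right_mono) auto
    finally have 1: "?X y \<bullet> ?X y \<le> C * V y" .
    have "\<bar>?X y \<bullet> g y\<bar> \<le> norm (?X y) * norm (g y)" by (rule Cauchy_Schwarz_ineq2)
    also have "\<dots> \<le> (D * norm (y - \<sigma>)) * (Lam * norm (y - \<sigma>))"
      using nX near_grad[OF \<sigma>, of y] t D by (intro mult_mono) (auto simp: t_def)
    also have "\<dots> = D * Lam * t" by (simp add: t power2_eq_square)
    also have "\<dots> \<le> D * Lam * (V y / lam)" using low D pos by (intro mult_left_mono) auto
    also have "\<dots> = D * Lam / lam * V y" by simp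
    also have "\<dots> \<le> C * V y" using C V_nonneg by (intro mult_right_mono) auto
    finally show ?thesis using 1 by simp
  next
    case False
    \<comment> \<open>Far from all wells a constant is at most a multiple of \<open>V\<close>, so
      the bounds by \<open>1 + V y\<close> become bounds by \<open>V y\<close>.\<close>
    then have "c0 \<le> V y" using that away[of y] by force
    then have "1 + V y \<le> (1 + 1 / c0) * V y" using pos by (simp add: field_simps)
    then have "C1 * (1 + V y) \<le> C1 * ((1 + 1 / c0) * V y)" using C1 by (intro mult_left_mono) auto
    also have "\<dots> = C1 * (1 + 1 / c0) * V y" by simp
    also have "\<dots> \<le> C * V y" using C V_nonneg by (intro mult_right_mono) auto
    finally show ?thesis using ab[of y] by simp
  qed
  have "C1 * (1 + V y) \<le> C * (1 + V y)" for y
    using C V_nonneg[of y] by (intro mult_right_mono) auto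
  then show ?thesis using ab far C
    by (intro exI[of _ C]) (smt (verit, ccfv_threshold) minus_mult_left)
qed

text \<open>Finiteness of \<open>S\<close> gives one \<open>T\<close> and one \<open>C\<close> for
  all wells. The bounds by \<open>1 + V y\<close> hold everywhere; those by \<open>V y\<close>
  exclude only the neighbourhoods of the other wells, and it is the area of this exceptional set
  that has to be estimated later.\<close>

lemma centred_bounds:
  obtains T C where "0 < T" "0 < C" "\<And>\<sigma>. \<sigma> \<in> S \<Longrightarrow> 8 * norm \<sigma> \<le> sqrt T"
    "\<And>\<sigma> y. \<sigma> \<in> S \<Longrightarrow> centred T \<sigma> y \<bullet> centred T \<sigma> y \<le> C * (1 + V y)"
    "\<And>\<sigma> y. \<sigma> \<in> S \<Longrightarrow> - C * (1 + V y) \<le> centred T \<sigma> y \<bullet> g y"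
    "\<And>\<sigma> y. \<sigma> \<in> S \<Longrightarrow> (\<And>\<tau>. \<tau> \<in> S \<Longrightarrow> \<tau> \<noteq> \<sigma> \<Longrightarrow> m / 16 < (y - \<tau>) \<bullet> (y - \<tau>)) \<Longrightarrow>
       centred T \<sigma> y \<bullet> centred T \<sigma> y \<le> C * V y"
    "\<And>\<sigma> y. \<sigma> \<in> S \<Longrightarrow> (\<And>\<tau>. \<tau> \<in> S \<Longrightarrow> \<tau> \<noteq> \<sigma> \<Longrightarrow> m / 16 < (y - \<tau>) \<bullet> (y - \<tau>)) \<Longrightarrow>
       - C * V y \<le> centred T \<sigma> y \<bullet> g y"
proof -
  obtain M where M: "0 < M" "\<And>\<sigma>. \<sigma> \<in> S \<Longrightarrow> norm \<sigma> \<le> M"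
    using finite_imp_bounded[OF finite_S] bounded_pos by metis
  define T where "T = (8 * M + R + 1)\<^sup>2"
  have sT: "8 * M \<le> sqrt T" "0 < T" using M(1) pos by (auto simp: T_def)
  define P where "P \<sigma> C \<longleftrightarrow> (\<forall>y. centred T \<sigma> y \<bullet> centred T \<sigma> y \<le> C * (1 + V y) \<and> - C * (1 + V y) \<le> centred T \<sigma> y \<bullet> g y \<and>
     ((\<forall>\<tau>\<in>S - {\<sigma>}. m / 16 < (y - \<tau>) \<bullet> (y - \<tau>)) \<longrightarrow>
       centred T \<sigma> y \<bullet> centred T \<sigma> y \<le> C * V y \<and> - C * V y \<le> centred T \<sigma> y \<bullet> g y))" for \<sigma> C
  have "\<forall>\<sigma>\<in>S. \<exists>C>0. P \<sigma> C"
    unfolding P_def using centred_bounds_at[OF _ M(2) T_def] by blast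
  then obtain c where c: "\<And>\<sigma>. \<sigma> \<in> S \<Longrightarrow> 0 < c \<sigma>" "\<And>\<sigma>. \<sigma> \<in> S \<Longrightarrow> P \<sigma> (c \<sigma>)" by metis
  define C where "C = sum c S"
  have C: "c \<sigma> \<le> C" if "\<sigma> \<in> S" for \<sigma>
    unfolding C_def using that c finite_S by (intro member_le_sum) (auto intro: less_imp_le)
  have C0: "0 < C" using C c S_nonempty by (meson all_not_in_conv less_le_trans)
  have PC: "P \<sigma> C" if "\<sigma> \<in> S" for \<sigma>
  proof -
    have "c \<sigma> * V y \<le> C * V y" "c \<sigma> * (1 + V y) \<le> C * (1 + V y)" for y
      using C[OF that] V_nonneg[of y] by (auto intro!: mult_right_mono)
    then show ?thesis
      using c(2)[OF that] unfolding P_def by (smt (verit, ccfv_threshold) minus_mult_left)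
  qed
  show ?thesis
    by (rule that[of T C]) (use sT C0 M(2) PC in \<open>force simp: P_def\<close>)+
qed

text \<open>The equation is tested with the cutoff times \<open>centred T \<sigma> (w z)\<close>.
  Truncating \<sigma> perturbs the derivative of the field by at most 4 / T times sqrt T times sqrt
  T / 8, which is 1/2, so half of the gradient survives. The majorant \<open>f\<close> is left open
  since it is chosen twice: once as a multiple of \<open>1 + V\<close>, and once with the constant 1
  replaced by a function of small integral.\<close>

lemma caccioppoli:
  assumes sol: "solves g 1 r w p q p1 p2 q2" and T: "0 < T" "8 * norm \<sigma> \<le> sqrt T"
    and f: "continuous_on (sq r) f"
    and X2: "\<And>z. z \<in> sq r \<Longrightarrow> centred T \<sigma> (w z) \<bullet> centred T \<sigma> (w z) \<le> f z"
    and Xg: "\<And>z. z \<in> sq r \<Longrightarrow> - f z \<le> centred T \<sigma> (w z) \<bullet> g (w z)"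
    and r: "0 \<le> r'" "r' < r"
  shows "(1 - (r' / r)\<^sup>2) ^ 4 * integral (sq r') (\<lambda>z. p z \<bullet> p z + q z \<bullet> q z)
     \<le> 4 * (1 + 32 / r\<^sup>2) * integral (sq r) f"
proof -
  have w: "has_partials (sq r) w p q" and p: "has_partials (sq r) p p1 p2"
    and q: "has_partials (sq r) q p2 q2" and eq: "\<And>z. z \<in> sq r \<Longrightarrow> p1 z + q2 z = g (w z)"
    using sol by (auto simp: solves_def)
  note [continuous_intros] = has_partialsD(1-3)[OF w] f
  have r0: "0 < r" using r by simp
  define om where "om z = max 0 (1 - (w z - \<sigma>) \<bullet> (w z - \<sigma>) / T)" for z
  define Z where "Z z = centred T \<sigma> (w z)" for z
  define Z1 where "Z1 z = p z - (- (4 / T) * om z * ((w z - \<sigma>) \<bullet> p z)) *\<^sub>R \<sigma>" for z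
  define Z2 where "Z2 z = q z - (- (4 / T) * om z * ((w z - \<sigma>) \<bullet> q z)) *\<^sub>R \<sigma>" for z
  have Z: "has_partials (sq r) Z Z1 Z2"
    unfolding Z_def Z1_def Z2_def centred_def[abs_def] om_def
    using has_partials_diff[OF w has_partials_scaleR[OF has_partials_psq_dist[OF w] has_partials_const]]
    by simp
  have mono: "(v \<bullet> v) / 2 \<le> (v - (- (4 / T) * om z * ((w z - \<sigma>) \<bullet> v)) *\<^sub>R \<sigma>) \<bullet> v" for v z
  proof -
    have "om z * norm (w z - \<sigma>) \<le> sqrt T"
    proof (cases "(w z - \<sigma>) \<bullet> (w z - \<sigma>) \<le> T")
      case True
      then have "norm (w z - \<sigma>) \<le> sqrt T" by (simp add: dot_square_norm real_le_rsqrt)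
      moreover have "0 \<le> om z" "om z \<le> 1" using T by (auto simp: om_def)
      ultimately show ?thesis using mult_mono[of "om z" 1 "norm (w z - \<sigma>)" "sqrt T"] by simp
    next
      case False
      then show ?thesis using T by (auto simp: om_def max_def field_simps)
    qed
    moreover have "0 \<le> om z" by (simp add: om_def)
    ultimately have "\<bar>om z * ((w z - \<sigma>) \<bullet> v)\<bar> \<le> sqrt T * norm v"
      using mult_left_mono[OF Cauchy_Schwarz_ineq2[of "w z - \<sigma>" v], of "om z"]
        mult_right_mono[of "om z * norm (w z - \<sigma>)" "sqrt T" "norm v"]
      by (simp add: abs_mult)
    then have "\<bar>om z * ((w z - \<sigma>) \<bullet> v)\<bar> * \<bar>\<sigma> \<bullet> v\<bar> \<le> (sqrt T * norm v) * (sqrt T / 8 * norm v)"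
      using Cauchy_Schwarz_ineq2[of \<sigma> v] mult_right_mono[of "norm \<sigma>" "sqrt T / 8" "norm v"] T
      by (intro mult_mono) auto
    also have "\<dots> = T / 8 * (v \<bullet> v)" using T by (simp add: dot_square_norm power2_eq_square)
    finally have "\<bar>(om z * ((w z - \<sigma>) \<bullet> v)) * (\<sigma> \<bullet> v)\<bar> \<le> T / 8 * (v \<bullet> v)" by (simp add: abs_mult)
    then have "\<bar>4 / T * ((om z * ((w z - \<sigma>) \<bullet> v)) * (\<sigma> \<bullet> v))\<bar> \<le> (v \<bullet> v) / 2"
      using T by (simp add: abs_mult field_simps)
    moreover have "(v - (- (4 / T) * om z * ((w z - \<sigma>) \<bullet> v)) *\<^sub>R \<sigma>) \<bullet> v
        = v \<bullet> v + 4 / T * ((om z * ((w z - \<sigma>) \<bullet> v)) * (\<sigma> \<bullet> v))"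
      by (simp add: inner_diff_left inner_add_left)
    ultimately show ?thesis by linarith
  qed
  define J where "J z = cutoff r z * (Z1 z \<bullet> p z + Z2 z \<bullet> q z + Z z \<bullet> (p1 z + q2 z))
      + cutoff_x r z * (Z z \<bullet> p z) + cutoff_y r z * (Z z \<bullet> q z)" for z
  have J0: "integral (sq r) J = 0"
    unfolding J_def by (rule integration_by_parts_cutoff[OF Z p q r0])
  note [continuous_intros] = has_partialsD(1-3)[OF Z] has_partialsD(2)[OF p] has_partialsD(3)[OF q]
     has_partialsD(1)[OF has_partials_cutoff] has_partialsD(2,3)[OF has_partials_cutoff]
  have cJ: "continuous_on (sq r) J"
    unfolding J_def by (intro continuous_intros)
  have low: "cutoff r z * (p z \<bullet> p z + q z \<bullet> q z) \<le> 4 * J z + 4 * (1 + 32 / r\<^sup>2) * f z" if z: "z \<in> sq r" for z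
  proof -
    \<comment> \<open>Each cutoff term costs a quarter of the weighted square of its component, out
      of the half supplied by \<open>mono\<close>. The quarter left over is the origin of the factor
      4, and two terms \<open>16 / r\<^sup>2\<close> make \<open>32 / r\<^sup>2\<close>.\<close>
    have cr: "\<bar>b * (Z z \<bullet> v)\<bar> \<le> cutoff r z * (v \<bullet> v) / 4 + 16 / r\<^sup>2 * f z"
      if b: "\<bar>b\<bar> \<le> 4 / r * sqrt (cutoff r z)" for b v
    proof -
      have "\<bar>b * (Z z \<bullet> v)\<bar> \<le> (4 / r * sqrt (cutoff r z)) * (norm (Z z) * norm v)"
        unfolding abs_mult using b Cauchy_Schwarz_ineq2[of "Z z" v] r0 cutoff_nonneg[of r z]
        by (intro mult_mono) auto
      also have "\<dots> = 2 * (sqrt (cutoff r z) * norm v / 2) * (4 / r * norm (Z z))" by simp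
      also have "\<dots> \<le> (sqrt (cutoff r z) * norm v / 2)\<^sup>2 + (4 / r * norm (Z z))\<^sup>2"
        by (rule sum_squares_bound)
      also have "\<dots> = cutoff r z * (v \<bullet> v) / 4 + 16 / r\<^sup>2 * (Z z \<bullet> Z z)"
        using cutoff_nonneg[of r z] by (simp add: power_mult_distrib power_divide dot_square_norm)
      also have "\<dots> \<le> cutoff r z * (v \<bullet> v) / 4 + 16 / r\<^sup>2 * f z"
        using X2[OF z] by (intro add_left_mono mult_left_mono) (auto simp: Z_def)
      finally show ?thesis .
    qed
    have f0: "0 \<le> f z" using X2[OF z] inner_ge_zero order_trans by blast
    have "cutoff r z * f z \<le> f z" using f0 cutoff_le_1 cutoff_nonneg by (simp add: mult_left_le_one_le)
    moreover have "cutoff r z * ((p z \<bullet> p z) / 2 + (q z \<bullet> q z) / 2 - f z)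
       \<le> cutoff r z * (Z1 z \<bullet> p z + Z2 z \<bullet> q z + Z z \<bullet> (p1 z + q2 z))"
      using mono[of "p z" z] mono[of "q z" z] Xg[OF z] unfolding eq[OF z] Z1_def Z2_def Z_def
      by (intro mult_left_mono cutoff_nonneg) linarith
    moreover have "4 * (1 + 32 / r\<^sup>2) * f z = 4 * f z + 8 * (16 / r\<^sup>2 * f z)"
      by (simp add: algebra_simps)
    ultimately show ?thesis
      using cr[OF cutoff_partials_bound(1)[OF r0 z], of "p z"] cr[OF cutoff_partials_bound(2)[OF r0 z], of "q z"]
      unfolding J_def by (simp only: right_diff_distrib distrib_left abs_le_iff) linarith
  qed
  have c1: "continuous_on (sq r) (\<lambda>z. p z \<bullet> p z + q z \<bullet> q z)"
    by (intro continuous_intros)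
  have c2: "continuous_on (sq r) (\<lambda>z. cutoff r z * (p z \<bullet> p z + q z \<bullet> q z))"
    by (intro continuous_intros)
  have "integral (sq r') (\<lambda>z. (1 - (r' / r)\<^sup>2) ^ 4 * (p z \<bullet> p z + q z \<bullet> q z))
      \<le> integral (sq r') (\<lambda>z. cutoff r z * (p z \<bullet> p z + q z \<bullet> q z))"
    using r cutoff_lower[OF r]
    by (intro integral_sq_mono mult_right_mono continuous_intros continuous_on_subset[OF c1] continuous_on_subset[OF c2] sq_mono) auto
  also have "\<dots> \<le> integral (sq r) (\<lambda>z. cutoff r z * (p z \<bullet> p z + q z \<bullet> q z))"
    using r by (intro integral_sq_subset c2) (auto simp: cutoff_nonneg)
  also have "\<dots> \<le> integral (sq r) (\<lambda>z. 4 * J z + 4 * (1 + 32 / r\<^sup>2) * f z)"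
    by (intro integral_sq_mono c2 continuous_intros cJ low)
  also have "\<dots> = integral (sq r) (\<lambda>z. 4 * J z) + integral (sq r) (\<lambda>z. 4 * (1 + 32 / r\<^sup>2) * f z)"
    by (intro integral_add integrable_sq continuous_intros cJ)
  also have "\<dots> = 4 * (1 + 32 / r\<^sup>2) * integral (sq r) f"
    using J0 by simp
  finally show ?thesis by simp
qed

end

section \<open>Local control of the gradient by the potential\<close>

lemma oscillation_le:
  fixes f :: "real \<Rightarrow> real"
  assumes d: "\<And>x. x \<in> {-r..r} \<Longrightarrow> (f has_vector_derivative f' x) (at x)" and c: "continuous_on {-r..r} f'"
    and ab: "a \<in> {-r..r}" "b \<in> {-r..r}"
  shows "\<bar>f b - f a\<bar> \<le> integral {-r..r} (\<lambda>x. \<bar>f' x\<bar>)"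
proof -
  have *: "\<bar>f b - f a\<bar> \<le> integral {-r..r} (\<lambda>x. \<bar>f' x\<bar>)" if "a \<le> b" "a \<in> {-r..r}" "b \<in> {-r..r}" for a b
  proof -
    have sub: "{a..b} \<subseteq> {-r..r}" using that by auto
    note c' = continuous_on_subset[OF c sub]
    have "(f' has_integral (f b - f a)) {a..b}"
      using that sub
      by (intro fundamental_theorem_of_calculus has_vector_derivative_at_within[OF d]) auto
    then have "\<bar>f b - f a\<bar> = norm (integral {a..b} f')" by (simp add: integral_unique)
    also have "\<dots> \<le> integral {a..b} (\<lambda>x. \<bar>f' x\<bar>)"
      by (intro integral_norm_bound_integral integrable_continuous_interval continuous_intros c') auto
    also have "\<dots> \<le> integral {-r..r} (\<lambda>x. \<bar>f' x\<bar>)"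
      using sub by (intro integral_subset_le integrable_continuous_interval continuous_intros c c') auto
    finally show ?thesis .
  qed
  show ?thesis using *[of a b] *[of b a] ab by (cases "a \<le> b") (auto simp: abs_minus_commute)
qed

text \<open>A planar isoperimetric dichotomy: one of the two level sets is confined to the bad rows times
  the bad columns, whose area is quadratically small.\<close>

lemma rows_columns_dichotomy:
  fixes f :: "real \<times> real \<Rightarrow> real"
  assumes f: "has_partials (sq r) f f1 f2"
    and h: "\<And>y. h y = integral {-r..r} (\<lambda>x. \<bar>f1 (x, y)\<bar>)"
    and k: "\<And>x. k x = integral {-r..r} (\<lambda>y. \<bar>f2 (x, y)\<bar>)"
    and y0: "y0 \<in> {-r..r}" "h y0 < 1 / 4" and x0: "x0 \<in> {-r..r}" "k x0 < 1 / 4"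
  shows "(\<forall>x y. (x, y) \<in> sq r \<longrightarrow> 3 / 4 \<le> f (x, y) \<longrightarrow> 1 \<le> 16 * (h y * k x)) \<or>
    (\<forall>x y. (x, y) \<in> sq r \<longrightarrow> f (x, y) \<le> 0 \<longrightarrow> 1 \<le> 16 * (h y * k x))"
proof (rule ccontr)
  note f = has_partialsD[OF f]
  have h0: "0 \<le> h y" for y
    unfolding h
    by (metis (no_types, lifting) Henstock_Kurzweil_Integration.integral_nonneg abs_ge_zero not_integrable_integral order_refl)
  have row: "\<bar>f (b, y) - f (a, y)\<bar> \<le> h y" if "a \<in> {-r..r}" "b \<in> {-r..r}" "y \<in> {-r..r}" for a b y
    unfolding h using that by (intro oscillation_le[of r "\<lambda>x. f (x, y)"] continuous_on_row f) (auto simp: mem_sq)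
  have col: "\<bar>f (x, b) - f (x, a)\<bar> \<le> k x" if "a \<in> {-r..r}" "b \<in> {-r..r}" "x \<in> {-r..r}" for a b x
    unfolding k using that by (intro oscillation_le[of r "\<lambda>y. f (x, y)"] continuous_on_column f) (auto simp: mem_sq)
  assume "\<not> ?thesis"
  then obtain x y x' y' where P: "(x, y) \<in> sq r" "3 / 4 \<le> f (x, y)" "16 * (h y * k x) < 1"
    and Q: "(x', y') \<in> sq r" "f (x', y') \<le> 0" "16 * (h y' * k x') < 1"
    by (auto simp: not_le)
  \<comment> \<open>A product below 1/16 has a factor below 1/4: the point lies on a row or on a
    column of small variation.\<close>
  have good: "h y < 1 / 4 \<or> k x < 1 / 4" if "16 * (h y * k x) < 1" for x y
    using that mult_mono[of "1 / 4" "h y" "1 / 4" "k x"] h0[of y] by linarith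
  have I: "x \<in> {-r..r}" "y \<in> {-r..r}" "x' \<in> {-r..r}" "y' \<in> {-r..r}"
    using P(1) Q(1) by (auto simp: mem_sq)
  \<comment> \<open>The two points are joined along at most three good lines, with \<open>x0\<close>
    or \<open>y0\<close> as the connecting one when both points lie on parallel lines. The total
    variation is below 3/4, contrary to the gap between the two levels.\<close>
  consider "h y < 1 / 4" "h y' < 1 / 4" | "h y < 1 / 4" "k x' < 1 / 4"
    | "k x < 1 / 4" "h y' < 1 / 4" | "k x < 1 / 4" "k x' < 1 / 4"
    using good[OF P(3)] good[OF Q(3)] by blast
  then show False
  proof cases
    case 1
    then show False using row[of x x0 y] col[of y y' x0] row[of x0 x' y'] I x0 P Q by linarith
  next
    case 2
    then show False using row[of x x' y] col[of y y' x'] I P Q by linarith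
  next
    case 3
    then show False using row[of x x' y'] col[of y y' x] I P Q by linarith
  next
    case 4
    then show False using col[of y y0 x] row[of x x' y0] col[of y0 y' x'] I y0 P Q by linarith
  qed
qed

lemma ex_less_of_integral_less:
  fixes h :: "real \<Rightarrow> real"
  assumes "continuous_on {-r..r} h" "integral {-r..r} h < 2 * r * c" "0 \<le> r"
  shows "\<exists>y\<in>{-r..r}. h y < c"
proof (rule ccontr)
  assume "\<not> ?thesis"
  then have "integral {-r..r} (\<lambda>_. c) \<le> integral {-r..r} h"
    by (intro integral_le integrable_continuous_interval assms) (auto simp: not_less)
  then show False using assms by simp
qed

context multiwell
begin

text \<open>A C^1 substitute for the indicator of a well: 1 at \<sigma>, at least 3/4 up to squared
  distance \<open>m / 16\<close>, and 0 from \<open>m\<close> on. These are the two levels of the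
  dichotomy.\<close>

definition "well_bump \<sigma> y = psq (1 - (y - \<sigma>) \<bullet> (y - \<sigma>) / m)"

text \<open>On the support the distance to \<sigma> is at most sqrt (V y / lam), so the derivative
  is bounded by a multiple of sqrt (V y) times |v|, and Young's inequality splits this product. The
  weight \<theta> is free: \<epsilon> reproduces the energy density, while the local estimate takes
  the square root of the potential bound.\<close>

lemma well_bump_partial_bound:
  assumes "\<sigma> \<in> S" "0 < \<theta>"
  shows "\<bar>- (4 / m) * max 0 (1 - (y - \<sigma>) \<bullet> (y - \<sigma>) / m) * ((y - \<sigma>) \<bullet> v)\<bar>
     \<le> 2 / (m * sqrt lam) * (V y / \<theta> + \<theta> * (v \<bullet> v))"
proof (cases "(y - \<sigma>) \<bullet> (y - \<sigma>) \<le> m")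
  case False
  have "1 - (y - \<sigma>) \<bullet> (y - \<sigma>) / m \<le> 0" using False pos by (simp add: field_simps)
  then show ?thesis using assms pos V_nonneg[of y] by (simp add: max_def)
next
  case True
  let ?o = "max 0 (1 - (y - \<sigma>) \<bullet> (y - \<sigma>) / m)"
  have "(y - \<sigma>) \<bullet> (y - \<sigma>) \<le> V y / lam"
    using near_lower[OF assms(1) True] pos by (simp add: field_simps)
  then have n: "norm (y - \<sigma>) \<le> sqrt (V y) / sqrt lam"
    by (simp add: dot_square_norm real_le_rsqrt flip: real_sqrt_divide)
  have o: "0 \<le> ?o" "?o \<le> 1" using pos by auto
  have "\<bar>?o * ((y - \<sigma>) \<bullet> v)\<bar> \<le> 1 * (norm (y - \<sigma>) * norm v)"
    unfolding abs_mult using o Cauchy_Schwarz_ineq2 by (intro mult_mono) auto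
  also have "\<dots> \<le> sqrt (V y) / sqrt lam * norm v"
    using mult_right_mono[OF n norm_ge_zero[of v]] by simp
  finally have a: "\<bar>?o * ((y - \<sigma>) \<bullet> v)\<bar> \<le> (sqrt (V y) * norm v) / sqrt lam" by simp
  have "2 * (sqrt (V y) / sqrt \<theta>) * (sqrt \<theta> * norm v) \<le> (sqrt (V y) / sqrt \<theta>)\<^sup>2 + (sqrt \<theta> * norm v)\<^sup>2"
    by (rule sum_squares_bound)
  then have b: "sqrt (V y) * norm v \<le> (V y / \<theta> + \<theta> * (v \<bullet> v)) / 2"
    using assms(2) V_nonneg[of y] by (simp add: power_mult_distrib power_divide dot_square_norm)
  have "\<bar>- (4 / m) * ?o * ((y - \<sigma>) \<bullet> v)\<bar> = 4 / m * \<bar>?o * ((y - \<sigma>) \<bullet> v)\<bar>"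
    using pos by (simp add: abs_mult)
  also have "\<dots> \<le> 4 / m * (((V y / \<theta> + \<theta> * (v \<bullet> v)) / 2) / sqrt lam)"
    using a b pos by (intro mult_left_mono order_trans[OF a] divide_right_mono) auto
  also have "\<dots> = 2 / (m * sqrt lam) * (V y / \<theta> + \<theta> * (v \<bullet> v))"
    using pos by (simp add: field_simps)
  finally show ?thesis .
qed

text \<open>A crude Caccioppoli inequality bounds the gradient on the intermediate square. If the
  potential is small, the variation of each \<open>well_bump\<close> is then of order sqrt of the
  potential, so by the dichotomy all wells but one are approached only on a set of area linear in
  the potential. A second Caccioppoli inequality, centred at the remaining well, has a right-hand
  side linear in the potential.\<close>

lemma local_gradient_bound:
  "\<exists>C>0. \<forall>w p q p1 p2 q2. solves g 1 2 w p q p1 p2 q2 \<longrightarrow>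
     integral (sq 1) (\<lambda>z. p z \<bullet> p z + q z \<bullet> q z) \<le> C * integral (sq 2) (\<lambda>z. V (w z))"
proof -
  obtain T C1 where T: "0 < T" and C1: "0 < C1" and T8: "\<And>\<sigma>. \<sigma> \<in> S \<Longrightarrow> 8 * norm \<sigma> \<le> sqrt T"
    and b1: "\<And>\<sigma> y. \<sigma> \<in> S \<Longrightarrow> centred T \<sigma> y \<bullet> centred T \<sigma> y \<le> C1 * (1 + V y)"
    and b2: "\<And>\<sigma> y. \<sigma> \<in> S \<Longrightarrow> - C1 * (1 + V y) \<le> centred T \<sigma> y \<bullet> g y"
    and b3: "\<And>\<sigma> y. \<sigma> \<in> S \<Longrightarrow> (\<And>\<tau>. \<tau> \<in> S \<Longrightarrow> \<tau> \<noteq> \<sigma> \<Longrightarrow> m / 16 < (y - \<tau>) \<bullet> (y - \<tau>)) \<Longrightarrow>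
       centred T \<sigma> y \<bullet> centred T \<sigma> y \<le> C1 * V y"
    and b4: "\<And>\<sigma> y. \<sigma> \<in> S \<Longrightarrow> (\<And>\<tau>. \<tau> \<in> S \<Longrightarrow> \<tau> \<noteq> \<sigma> \<Longrightarrow> m / 16 < (y - \<tau>) \<bullet> (y - \<tau>)) \<Longrightarrow>
       - C1 * V y \<le> centred T \<sigma> y \<bullet> g y"
    using centred_bounds by blast
  \<comment> \<open>1008 = 36 * 28 and, in \<open>A2\<close>, 671 = 61 * 11 round up the Caccioppoli
    constants for the half-sides 2 to 3/2 and 3/2 to 1. The 17 in \<open>A3\<close> is the area 16
    of \<open>sq 2\<close> plus a potential of at most 1.\<close>
  define A1 where "A1 = 1008 * C1"
  define A3 where "A3 = 2 / (m * sqrt lam) * (1 + 17 * A1)"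
  \<comment> \<open>Chosen so that \<open>A3 * \<theta> \<le> 1 / 2\<close>: this is below 3 *
    (1/4), so some row and some column of the square of side 3 have variation below 1/4. It also
    makes two exceptional sets too small to cover that square.\<close>
  define d0 where "d0 = min 1 (1 / (4 * A3\<^sup>2))"
  define A2 where "A2 = 671 * (C1 * (1 + real (card S) * (16 * A3\<^sup>2)))"
  define C where "C = A1 * (16 / d0 + 1) + A2"
  have A1: "0 < A1" using C1 by (simp add: A1_def)
  have A3: "0 < A3" using A1 pos by (simp add: A3_def)
  have d0: "0 < d0" "d0 \<le> 1" using A3 by (auto simp: d0_def)
  have d0A: "A3\<^sup>2 * d0 \<le> 1 / 4"
    using A3 mult_left_mono[of d0 "1 / (4 * A3\<^sup>2)" "A3\<^sup>2"] by (simp add: d0_def)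
  have A2: "0 < A2" using C1 by (simp add: A2_def add_pos_nonneg)
  have C: "0 < C" using A1 A2 d0 by (simp add: C_def add_pos_pos)
  have main: "integral (sq 1) (\<lambda>z. p z \<bullet> p z + q z \<bullet> q z) \<le> C * integral (sq 2) (\<lambda>z. V (w z))"
    if sol: "solves g 1 2 w p q p1 p2 q2" for w p q p1 p2 q2
  proof -
    define \<delta> where "\<delta> = integral (sq 2) (\<lambda>z. V (w z))"
    have sol': "solves g 1 (3 / 2) w p q p1 p2 q2" using solves_mono[OF sol] by simp
    have w2: "has_partials (sq 2) w p q" and w: "has_partials (sq (3 / 2)) w p q"
      using sol sol' by (auto simp: solves_def)
    note [continuous_intros] = has_partialsD(1-3)[OF w2] has_partialsD(1-3)[OF w]
      V_comp_cont[OF has_partialsD(1)[OF w2]] V_comp_cont[OF has_partialsD(1)[OF w]]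
    have \<delta>0: "0 \<le> \<delta>" unfolding \<delta>_def by (intro integral_sq_nonneg continuous_intros V_nonneg)
    have V32: "integral (sq (3 / 2)) (\<lambda>z. V (w z)) \<le> \<delta>"
      unfolding \<delta>_def by (intro integral_sq_subset continuous_intros V_nonneg) auto
    obtain \<sigma>0 where \<sigma>0: "\<sigma>0 \<in> S" using S_nonempty by blast
    have first: "integral (sq (3 / 2)) (\<lambda>z. p z \<bullet> p z + q z \<bullet> q z) \<le> A1 * (16 + \<delta>)"
    proof -
      have "(1 - ((3 / 2) / 2)\<^sup>2) ^ 4 * integral (sq (3 / 2)) (\<lambda>z. p z \<bullet> p z + q z \<bullet> q z)
        \<le> 4 * (1 + 32 / 2\<^sup>2) * integral (sq 2) (\<lambda>z. C1 * (1 + V (w z)))"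
        using b1[OF \<sigma>0] b2[OF \<sigma>0]
        by (intro caccioppoli[OF sol T T8[OF \<sigma>0]] continuous_intros) simp_all
      also have "integral (sq 2) (\<lambda>z. C1 * (1 + V (w z))) = C1 * (16 + \<delta>)"
      proof -
        have "integral (sq 2) (\<lambda>z. 1 + V (w z)) = integral (sq 2) (\<lambda>z. 1) + \<delta>"
          unfolding \<delta>_def by (intro integral_add integrable_sq continuous_intros)
        then show ?thesis by (simp add: integral_sq_const)
      qed
      finally have *: "2401 / 65536 * integral (sq (3 / 2)) (\<lambda>z. p z \<bullet> p z + q z \<bullet> q z) \<le> 36 * (C1 * (16 + \<delta>))"
        by (simp add: power2_eq_square power4_eq_xxxx)
      have "0 \<le> C1 * (16 + \<delta>)" using C1 \<delta>0 by simp
      then show ?thesis using * by (simp add: A1_def)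
    qed
    have first1: "integral (sq 1) (\<lambda>z. p z \<bullet> p z + q z \<bullet> q z) \<le> A1 * (16 + \<delta>)"
      by (rule order_trans[OF integral_sq_subset first]) (intro continuous_intros | simp add: add_nonneg_nonneg)+
    \<comment> \<open>Stated for every positive \<open>d\<close> above the potential, since \<theta>
      = sqrt d must be positive; vanishing potential is reached by letting \<open>d\<close> tend to
      0.\<close>
    have small: "integral (sq 1) (\<lambda>z. p z \<bullet> p z + q z \<bullet> q z) \<le> A2 * d" if d: "0 < d" "\<delta> \<le> d" "d \<le> d0" for d
    proof -
      define \<theta> where "\<theta> = sqrt d"
      have \<theta>: "0 < \<theta>" "\<theta> * \<theta> = d" "d / \<theta> = \<theta>" using d by (auto simp: \<theta>_def real_div_sqrt)
      define G1 where "G1 \<sigma> z = - (4 / m) * max 0 (1 - (w z - \<sigma>) \<bullet> (w z - \<sigma>) / m) * ((w z - \<sigma>) \<bullet> p z)" for \<sigma> z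
      define G2 where "G2 \<sigma> z = - (4 / m) * max 0 (1 - (w z - \<sigma>) \<bullet> (w z - \<sigma>) / m) * ((w z - \<sigma>) \<bullet> q z)" for \<sigma> z
      have G: "has_partials (sq (3 / 2)) (\<lambda>z. well_bump \<sigma> (w z)) (G1 \<sigma>) (G2 \<sigma>)" for \<sigma>
        unfolding well_bump_def G1_def G2_def by (rule has_partials_psq_dist[OF w])
      have cG: "continuous_on (sq (3 / 2)) (\<lambda>z. \<bar>G1 \<sigma> z\<bar>)" "continuous_on (sq (3 / 2)) (\<lambda>z. \<bar>G2 \<sigma> z\<bar>)" for \<sigma>
        by (intro continuous_intros has_partialsD(2)[OF G] has_partialsD(3)[OF G])+
      define h where "h \<sigma> y = integral {-(3/2)..3/2} (\<lambda>x. \<bar>G1 \<sigma> (x, y)\<bar>)" for \<sigma> y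
      define k where "k \<sigma> x = integral {-(3/2)..3/2} (\<lambda>y. \<bar>G2 \<sigma> (x, y)\<bar>)" for \<sigma> x
      have ch: "continuous_on {-(3/2)..3/2} (h \<sigma>)" and ck: "continuous_on {-(3/2)..3/2} (k \<sigma>)" for \<sigma>
        unfolding h_def k_def
        using continuous_on_integral_row[OF cG(1)] continuous_on_integral_column[OF cG(2)] by auto
      have ih: "integral {-(3/2)..3/2} (h \<sigma>) = integral (sq (3 / 2)) (\<lambda>z. \<bar>G1 \<sigma> z\<bar>)" for \<sigma>
        unfolding h_def using integral_sq_rows[OF cG(1)] by simp
      have ik: "integral {-(3/2)..3/2} (k \<sigma>) = integral (sq (3 / 2)) (\<lambda>z. \<bar>G2 \<sigma> z\<bar>)" for \<sigma>
        unfolding k_def using integral_sq_columns[OF cG(2)] by simp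
      define W where "W z = 2 / (m * sqrt lam) * (V (w z) / \<theta> + \<theta> * (p z \<bullet> p z + q z \<bullet> q z))" for z
      have cW: "continuous_on (sq (3 / 2)) W" unfolding W_def using \<theta> by (intro continuous_intros) auto
      have "integral (sq (3 / 2)) W
         = 2 / (m * sqrt lam) * (integral (sq (3 / 2)) (\<lambda>z. V (w z)) / \<theta> + \<theta> * integral (sq (3 / 2)) (\<lambda>z. p z \<bullet> p z + q z \<bullet> q z))"
      proof -
        have "continuous_on (sq (3 / 2)) (\<lambda>z. V (w z) / \<theta>)"
          using \<theta> by (intro continuous_intros) auto
        from integrable_sq[OF this] have "integral (sq (3 / 2)) (\<lambda>z. V (w z) / \<theta> + \<theta> * (p z \<bullet> p z + q z \<bullet> q z))
          = integral (sq (3 / 2)) (\<lambda>z. V (w z) / \<theta>) + integral (sq (3 / 2)) (\<lambda>z. \<theta> * (p z \<bullet> p z + q z \<bullet> q z))"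
          by (rule integral_add) (intro integrable_sq continuous_intros)
        then show ?thesis unfolding W_def integral_mult_right by simp
      qed
      moreover have "2 / (m * sqrt lam) * (integral (sq (3 / 2)) (\<lambda>z. V (w z)) / \<theta> + \<theta> * integral (sq (3 / 2)) (\<lambda>z. p z \<bullet> p z + q z \<bullet> q z))
         \<le> 2 / (m * sqrt lam) * (d / \<theta> + \<theta> * (A1 * 17))"
      proof -
        have "A1 * (16 + \<delta>) \<le> A1 * 17" using A1 d d0 by (intro mult_left_mono) auto
        with first have "integral (sq (3 / 2)) (\<lambda>z. p z \<bullet> p z + q z \<bullet> q z) \<le> A1 * 17" by linarith
        moreover have "integral (sq (3 / 2)) (\<lambda>z. V (w z)) \<le> d" using V32 d by linarith
        moreover have "0 \<le> 2 / (m * sqrt lam)" using pos by simp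
        ultimately show ?thesis using \<theta>(1)
          by (intro mult_left_mono[OF add_mono[OF divide_right_mono mult_left_mono]] less_imp_le[OF \<theta>(1)])
      qed
      moreover have "2 / (m * sqrt lam) * (d / \<theta> + \<theta> * (A1 * 17)) = A3 * \<theta>"
        unfolding \<theta>(3) A3_def by (simp add: algebra_simps)
      ultimately have iW: "integral (sq (3 / 2)) W \<le> A3 * \<theta>" by linarith
      have GW: "\<bar>G1 \<sigma> z\<bar> \<le> W z" "\<bar>G2 \<sigma> z\<bar> \<le> W z" if "\<sigma> \<in> S" for \<sigma> z
      proof -
        have "2 / (m * sqrt lam) * (V (w z) / \<theta> + \<theta> * (v \<bullet> v)) \<le> W z" if "v = p z \<or> v = q z" for v
          unfolding W_def using that \<theta> pos by (intro mult_left_mono add_left_mono) auto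
        then show "\<bar>G1 \<sigma> z\<bar> \<le> W z" "\<bar>G2 \<sigma> z\<bar> \<le> W z"
          unfolding G1_def G2_def using well_bump_partial_bound[OF that \<theta>(1)] order_trans by blast+
      qed
      have ihk: "integral {-(3/2)..3/2} (h \<sigma>) \<le> A3 * \<theta>" "integral {-(3/2)..3/2} (k \<sigma>) \<le> A3 * \<theta>" if "\<sigma> \<in> S" for \<sigma>
        unfolding ih ik using GW[OF that] integral_sq_mono[OF cG(1) cW] integral_sq_mono[OF cG(2) cW] iW
        by (meson order_trans)+
      have A3\<theta>: "(A3 * \<theta>)\<^sup>2 \<le> 1 / 4"
      proof -
        have "(A3 * \<theta>)\<^sup>2 = A3\<^sup>2 * d"
          unfolding \<theta>(2)[symmetric] by (simp add: power2_eq_square)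
        then show ?thesis using d0A mult_left_mono[OF d(3), of "A3\<^sup>2"] by simp
      qed
      have "A3 * \<theta> \<le> 1 / 2"
        by (rule power2_le_imp_le) (use A3\<theta> in \<open>simp_all add: power_divide\<close>)
      then have ex: "\<exists>y\<in>{-(3/2)..3/2}. h \<sigma> y < 1 / 4" "\<exists>y\<in>{-(3/2)..3/2}. k \<sigma> y < 1 / 4" if "\<sigma> \<in> S" for \<sigma>
        using ihk[OF that] ex_less_of_integral_less[OF ch, of \<sigma> "1 / 4"] ex_less_of_integral_less[OF ck, of \<sigma> "1 / 4"]
        by simp_all
      \<comment> \<open>\<open>H\<close> is at least 1 on the exceptional set, so it serves as a
        continuous majorant of its indicator. The product structure factors its integral into two
        integrals of order sqrt d, which gives the linear bound in \<open>d\<close>.\<close>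
      define H where "H \<sigma> z = 16 * (h \<sigma> (snd z) * k \<sigma> (fst z))" for \<sigma> z
      have h0: "0 \<le> h \<sigma> y" "0 \<le> k \<sigma> y" if "y \<in> {-(3/2)..3/2}" for \<sigma> y
        unfolding h_def k_def using that cG
        by (intro Henstock_Kurzweil_Integration.integral_nonneg integrable_continuous_interval
            continuous_on_row[where f = "\<lambda>z. \<bar>G1 \<sigma> z\<bar>"] continuous_on_column[where f = "\<lambda>z. \<bar>G2 \<sigma> z\<bar>"]; simp)+
      have H0: "0 \<le> H \<sigma> z" if "z \<in> sq (3 / 2)" for \<sigma> z
        using that h0 by (cases z) (auto simp: H_def mem_sq)
      have cH: "continuous_on (sq (3 / 2)) (H \<sigma>)" for \<sigma>
        unfolding H_def by (intro continuous_intros continuous_on_compose2[OF ch] continuous_on_compose2[OF ck])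
          (auto simp: mem_sq)
      have iH: "integral (sq (3 / 2)) (H \<sigma>) \<le> 16 * A3\<^sup>2 * d" if "\<sigma> \<in> S" for \<sigma>
      proof -
        have "integral (sq (3 / 2)) (H \<sigma>) = 16 * (integral {-(3/2)..3/2} (h \<sigma>) * integral {-(3/2)..3/2} (k \<sigma>))"
          using integral_sq_product[OF ch[of \<sigma>] ck[of \<sigma>]] by (simp add: H_def[abs_def] case_prod_unfold)
        also have "\<dots> \<le> 16 * ((A3 * \<theta>) * (A3 * \<theta>))"
          using ihk[OF that] A3 \<theta> h0
          by (intro mult_left_mono mult_mono Henstock_Kurzweil_Integration.integral_nonneg integrable_continuous_interval ck) auto
        also have "\<dots> = 16 * A3\<^sup>2 * d" using \<theta>(2) by (simp add: power2_eq_square)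
        finally show ?thesis .
      qed
      define Near where "Near \<sigma> \<longleftrightarrow> (\<forall>z\<in>sq (3/2). (w z - \<sigma>) \<bullet> (w z - \<sigma>) \<le> m / 16 \<longrightarrow> 1 \<le> H \<sigma> z)" for \<sigma>
      define Far where "Far \<sigma> \<longleftrightarrow> (\<forall>z\<in>sq (3/2). m \<le> (w z - \<sigma>) \<bullet> (w z - \<sigma>) \<longrightarrow> 1 \<le> H \<sigma> z)" for \<sigma>
      have NF: "Near \<sigma> \<or> Far \<sigma>" if \<sigma>: "\<sigma> \<in> S" for \<sigma>
      proof -
        obtain x0 y0 where xy: "y0 \<in> {-(3/2)..3/2}" "h \<sigma> y0 < 1 / 4" "x0 \<in> {-(3/2)..3/2}" "k \<sigma> x0 < 1 / 4"
          using ex[OF \<sigma>] by blast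
        have "3 / 4 \<le> well_bump \<sigma> y" if "(y - \<sigma>) \<bullet> (y - \<sigma>) \<le> m / 16" for y
        proof -
          have "15 / 16 \<le> 1 - (y - \<sigma>) \<bullet> (y - \<sigma>) / m" using that pos by (simp add: field_simps)
          then have "(15 / 16)\<^sup>2 \<le> well_bump \<sigma> y" unfolding well_bump_def psq_def by (intro power_mono) linarith+
          then show ?thesis by (simp add: power2_eq_square)
        qed
        moreover have "well_bump \<sigma> y \<le> 0" if "m \<le> (y - \<sigma>) \<bullet> (y - \<sigma>)" for y
          using that pos by (simp add: well_bump_def psq_def max_def)
        ultimately show ?thesis
          using rows_columns_dichotomy[OF G h_def k_def xy] unfolding Near_def Far_def H_def
          by (auto simp: split_paired_all)
      qed
      \<comment> \<open>At most one well can fail \<open>Near\<close>. Two failures would be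
        \<open>Far\<close> for both, and no point is within squared distance \<open>m\<close> of
        both wells, so the two functions \<open>H\<close> would add up to at least 1 on a square of
        area 9, while their integrals add up to at most 8.\<close>
      obtain \<sigma> where \<sigma>: "\<sigma> \<in> S" "\<And>\<tau>. \<tau> \<in> S \<Longrightarrow> \<tau> \<noteq> \<sigma> \<Longrightarrow> Near \<tau>"
      proof (cases "\<forall>\<tau>\<in>S. Near \<tau>")
        case True
        then show ?thesis using that[OF \<sigma>0] by blast
      next
        case False
        then obtain \<sigma> where \<sigma>: "\<sigma> \<in> S" "\<not> Near \<sigma>" by blast
        then have far: "Far \<sigma>" using NF by blast
        have "Near \<tau>" if \<tau>: "\<tau> \<in> S" "\<tau> \<noteq> \<sigma>" for \<tau>
        proof (rule ccontr)
          assume "\<not> Near \<tau>"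
          then have far': "Far \<tau>" using NF \<tau> by blast
          have "1 \<le> H \<sigma> z + H \<tau> z" if z: "z \<in> sq (3 / 2)" for z
          proof (cases "m \<le> (w z - \<sigma>) \<bullet> (w z - \<sigma>)")
            case True
            then show ?thesis using far z H0[OF z, of \<tau>] by (auto simp: Far_def)
          next
            case False
            then have "m \<le> (w z - \<tau>) \<bullet> (w z - \<tau>)" using disj[OF \<sigma>(1) \<tau>(1)] \<tau> by auto
            then show ?thesis using far' z H0[OF z, of \<sigma>] by (auto simp: Far_def)
          qed
          then have "integral (sq (3 / 2)) (\<lambda>_. 1) \<le> integral (sq (3 / 2)) (\<lambda>z. H \<sigma> z + H \<tau> z)"
            by (intro integral_sq_mono continuous_intros cH)
          also have "\<dots> = integral (sq (3 / 2)) (H \<sigma>) + integral (sq (3 / 2)) (H \<tau>)"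
            by (intro integral_add integrable_sq cH)
          also have "\<dots> \<le> 32 * (A3\<^sup>2 * d)" using iH[OF \<sigma>(1)] iH[OF \<tau>(1)] by simp
          also have "\<dots> \<le> 8" using d0A mult_left_mono[OF d(3) zero_le_power2, of A3] by linarith
          finally show False by (simp add: integral_sq_const)
        qed
        then show ?thesis using that \<sigma> by blast
      qed
      \<comment> \<open>Near another well the sum of the \<open>H \<tau>\<close> replaces the
        constant 1 in the crude bounds; elsewhere \<open>V\<close> alone suffices.\<close>
      define f where "f z = C1 * (V (w z) + (\<Sum>\<tau>\<in>S - {\<sigma>}. H \<tau> z))" for z
      have cf: "continuous_on (sq (3 / 2)) f" unfolding f_def by (intro continuous_intros cH)
      have fb: "centred T \<sigma> (w z) \<bullet> centred T \<sigma> (w z) \<le> f z \<and> - f z \<le> centred T \<sigma> (w z) \<bullet> g (w z)"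
        if z: "z \<in> sq (3 / 2)" for z
      proof (cases "\<exists>\<tau>\<in>S - {\<sigma>}. (w z - \<tau>) \<bullet> (w z - \<tau>) \<le> m / 16")
        case True
        then obtain \<tau> where \<tau>: "\<tau> \<in> S - {\<sigma>}" "(w z - \<tau>) \<bullet> (w z - \<tau>) \<le> m / 16" by blast
        then have "1 \<le> H \<tau> z" using \<sigma>(2) z by (auto simp: Near_def)
        also have "\<dots> \<le> (\<Sum>\<tau>\<in>S - {\<sigma>}. H \<tau> z)"
          using \<tau>(1) finite_S H0[OF z] by (intro member_le_sum) auto
        finally have "C1 * (1 + V (w z)) \<le> f z" unfolding f_def using C1 by (intro mult_left_mono) auto
        then show ?thesis using b1[OF \<sigma>(1), of "w z"] b2[OF \<sigma>(1), of "w z"] by auto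
      next
        case False
        have "0 \<le> (\<Sum>\<tau>\<in>S - {\<sigma>}. H \<tau> z)" by (intro sum_nonneg H0 z)
        then have "C1 * V (w z) \<le> f z" unfolding f_def using C1 by (intro mult_left_mono) auto
        moreover have "\<And>\<tau>. \<tau> \<in> S \<Longrightarrow> \<tau> \<noteq> \<sigma> \<Longrightarrow> m / 16 < (w z - \<tau>) \<bullet> (w z - \<tau>)"
          using False by (auto simp: not_le)
        from b3[OF \<sigma>(1), of "w z", OF this] b4[OF \<sigma>(1), of "w z", OF this]
        have "centred T \<sigma> (w z) \<bullet> centred T \<sigma> (w z) \<le> C1 * V (w z)" "- C1 * V (w z) \<le> centred T \<sigma> (w z) \<bullet> g (w z)"
          by auto
        ultimately show ?thesis by simp
      qed
      have "integral (sq (3 / 2)) f = C1 * (integral (sq (3 / 2)) (\<lambda>z. V (w z)) + (\<Sum>\<tau>\<in>S - {\<sigma>}. integral (sq (3 / 2)) (H \<tau>)))"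
      proof -
        have "integral (sq (3 / 2)) (\<lambda>z. V (w z) + (\<Sum>\<tau>\<in>S - {\<sigma>}. H \<tau> z))
          = integral (sq (3 / 2)) (\<lambda>z. V (w z)) + integral (sq (3 / 2)) (\<lambda>z. \<Sum>\<tau>\<in>S - {\<sigma>}. H \<tau> z)"
          by (intro integral_add integrable_sq continuous_intros cH)
        also have "integral (sq (3 / 2)) (\<lambda>z. \<Sum>\<tau>\<in>S - {\<sigma>}. H \<tau> z) = (\<Sum>\<tau>\<in>S - {\<sigma>}. integral (sq (3 / 2)) (H \<tau>))"
          using finite_S by (intro integral_sum integrable_sq cH) auto
        finally show ?thesis unfolding f_def by simp
      qed
      also have "\<dots> \<le> C1 * (d + real (card S) * (16 * A3\<^sup>2 * d))"
      proof (intro mult_left_mono add_mono)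
        have "(\<Sum>\<tau>\<in>S - {\<sigma>}. integral (sq (3 / 2)) (H \<tau>)) \<le> real (card (S - {\<sigma>})) * (16 * A3\<^sup>2 * d)"
          using iH by (intro sum_bounded_above) auto
        also have "\<dots> \<le> real (card S) * (16 * A3\<^sup>2 * d)"
          using d finite_S by (intro mult_right_mono) (auto simp: card_Diff1_le)
        finally show "(\<Sum>\<tau>\<in>S - {\<sigma>}. integral (sq (3 / 2)) (H \<tau>)) \<le> real (card S) * (16 * A3\<^sup>2 * d)" .
      qed (use V32 d C1 in auto)
      finally have i_f: "integral (sq (3 / 2)) f \<le> C1 * (1 + real (card S) * (16 * A3\<^sup>2)) * d"
        by (simp add: algebra_simps)
      have "(1 - (1 / (3 / 2))\<^sup>2) ^ 4 * integral (sq 1) (\<lambda>z. p z \<bullet> p z + q z \<bullet> q z)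
          \<le> 4 * (1 + 32 / (3 / 2)\<^sup>2) * integral (sq (3 / 2)) f"
        using fb by (intro caccioppoli[OF sol' T T8[OF \<sigma>(1)] cf]) auto
      then have "625 / 6561 * integral (sq 1) (\<lambda>z. p z \<bullet> p z + q z \<bullet> q z) \<le> 548 / 9 * integral (sq (3 / 2)) f"
        by (simp add: power2_eq_square power4_eq_xxxx)
      moreover have "0 \<le> C1 * (1 + real (card S) * (16 * A3\<^sup>2)) * d" using C1 d by simp
      ultimately show ?thesis unfolding A2_def using i_f by (simp add: mult.assoc)
    qed
    consider "d0 \<le> \<delta>" | "0 < \<delta>" "\<delta> \<le> d0" | "\<delta> = 0" using \<delta>0 by linarith
    then have "integral (sq 1) (\<lambda>z. p z \<bullet> p z + q z \<bullet> q z) \<le> C * \<delta>"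
    proof cases
      case 1
      then have "A1 * (16 + \<delta>) \<le> A1 * ((16 / d0 + 1) * \<delta>)"
        using A1 d0 by (intro mult_left_mono) (auto simp: field_simps)
      also have "\<dots> \<le> C * \<delta>" unfolding C_def using A2 \<delta>0 by (simp add: algebra_simps)
      finally show ?thesis using first1 by linarith
    next
      case 2
      have "A2 * \<delta> \<le> C * \<delta>" unfolding C_def using A1 d0 \<delta>0 by (simp add: algebra_simps)
      then show ?thesis using small[OF 2(1) order_refl 2(2)] by linarith
    next
      case 3
      have "integral (sq 1) (\<lambda>z. p z \<bullet> p z + q z \<bullet> q z) \<le> 0 + e" if "0 < e" for e
      proof -
        define d where "d = min d0 (e / A2)"
        have d: "0 < d" "\<delta> \<le> d" "d \<le> d0" "d \<le> e / A2" using 3 d0 A2 that by (auto simp: d_def)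
        then have "A2 * d \<le> e" using A2 by (simp add: field_simps)
        then show ?thesis using small[OF d(1-3)] by linarith
      qed
      then have "integral (sq 1) (\<lambda>z. p z \<bullet> p z + q z \<bullet> q z) \<le> 0" by (rule field_le_epsilon)
      then show ?thesis using 3 by simp
    qed
    then show ?thesis by (simp add: \<delta>_def)
  qed
  with C show ?thesis by blast
qed

end

section \<open>Energy near the wells\<close>

text \<open>The field \<open>d / sqrt (s\<^sup>2 + |d|\<^sup>2)\<close> is the gradient of a convex function; only the cutoff spoils
  monotonicity, by an amount proportional to \<open>s\<close>.\<close>

lemma truncated_radial_field_monotone:
  fixes d v :: "'a::real_inner"
  assumes s: "0 < s" "s\<^sup>2 \<le> m / 4"
  defines "t \<equiv> d \<bullet> d" and "\<omega> \<equiv> max 0 (1 - (d \<bullet> d) / m)" and "\<rho> \<equiv> sqrt (s\<^sup>2 + d \<bullet> d)"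
  shows "(if t \<le> s\<^sup>2 then 1 / 8 else 0) * (v \<bullet> v) - 4 / sqrt m * s * (v \<bullet> v)
    \<le> (s / \<rho> * \<omega>\<^sup>2) * (v \<bullet> v)
       + (s / \<rho> * (- (4 / m) * \<omega> * (d \<bullet> v)) + (2 * (d \<bullet> v)) * (- s / (2 * \<rho> ^ 3)) * \<omega>\<^sup>2) * (d \<bullet> v)"
proof -
  have m: "0 < m" using s zero_less_power[OF s(1), of 2] by linarith
  have t0: "0 \<le> t" by (simp add: t_def)
  have r2: "\<rho>\<^sup>2 = s\<^sup>2 + t" by (simp add: \<rho>_def t_def add_nonneg_nonneg)
  have r0: "0 < \<rho>" using s by (simp add: \<rho>_def add_pos_nonneg)
  have o: "0 \<le> \<omega>" "\<omega> \<le> 1" using m by (auto simp: \<omega>_def)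
  \<comment> \<open>This is the cost of the cutoff: it vanishes beyond squared distance
    \<open>m\<close>, and \<rho> is at least sqrt t.\<close>
  have ot: "\<omega> * (t / \<rho>) \<le> sqrt m"
  proof (cases "t \<le> m")
    case True
    have "t * t \<le> m * t" using True t0 by (rule mult_right_mono)
    also have "\<dots> \<le> m * \<rho>\<^sup>2" unfolding r2 using m by (intro mult_left_mono) auto
    also have "\<dots> = (sqrt m * \<rho>)\<^sup>2" using m by (simp add: power_mult_distrib)
    finally have "t\<^sup>2 \<le> (sqrt m * \<rho>)\<^sup>2" by (simp add: power2_eq_square)
    then have "t \<le> sqrt m * \<rho>"
      by (rule power2_le_imp_le) (use m r0 in auto)
    then have "t / \<rho> \<le> sqrt m" using r0 by (simp add: field_simps)
    then show ?thesis using mult_mono[of \<omega> 1 "t / \<rho>" "sqrt m"] o t0 r0 by simp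
  next
    case False
    then show ?thesis using m by (simp add: \<omega>_def t_def max_def field_simps)
  qed
  \<comment> \<open>The derivative of s d / \<rho> is s / \<rho> across \<open>d\<close> and
    smallest along \<open>d\<close>, where it equals the cube of s / \<rho>.\<close>
  have "s / \<rho> = s * \<rho>\<^sup>2 / \<rho> ^ 3" using r0 by (simp add: power2_eq_square power3_eq_cube)
  then have "s / \<rho> - s * t / \<rho> ^ 3 = (s * \<rho>\<^sup>2 - s * t) / \<rho> ^ 3" by (simp add: diff_divide_distrib)
  also have "\<dots> = (s / \<rho>) ^ 3" unfolding r2
    by (simp add: distrib_left power_divide power2_eq_square power3_eq_cube)
  finally have cube: "s / \<rho> - s * t / \<rho> ^ 3 = (s / \<rho>) ^ 3" .
  \<comment> \<open>Within distance \<open>s\<close> of the well \<omega> is at least 3/4 and s /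
    \<rho> at least 2/3, giving (9/16) * (8/27) = 1/6, which exceeds 1/8.\<close>
  have core: "(if t \<le> s\<^sup>2 then 1 / 8 else 0) \<le> \<omega>\<^sup>2 * (s / \<rho>) ^ 3"
  proof (cases "t \<le> s\<^sup>2")
    case True
    then have "3 / 4 \<le> \<omega>" using s m by (simp add: \<omega>_def t_def field_simps)
    then have a: "(3 / 4)\<^sup>2 \<le> \<omega>\<^sup>2" by (intro power_mono) auto
    have "(2 / 3 * \<rho>)\<^sup>2 = 4 / 9 * \<rho>\<^sup>2" by (simp add: power_mult_distrib power_divide)
    then have "(2 / 3 * \<rho>)\<^sup>2 \<le> s\<^sup>2" using True r2 zero_le_power2[of s] by linarith
    then have "2 / 3 * \<rho> \<le> s" by (rule power2_le_imp_le) (use s in auto)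
    then have "2 / 3 \<le> s / \<rho>" using r0 by (simp add: field_simps)
    then have b: "(2 / 3) ^ 3 \<le> (s / \<rho>) ^ 3" by (intro power_mono) auto
    have "(3 / 4)\<^sup>2 * (2 / 3) ^ 3 \<le> \<omega>\<^sup>2 * (s / \<rho>) ^ 3"
      using s r0 by (intro mult_mono a b) auto
    then show ?thesis using True by (simp add: power2_eq_square power3_eq_cube)
  next
    case False
    then show ?thesis using s r0 by simp
  qed
  have dv: "(d \<bullet> v)\<^sup>2 \<le> t * (v \<bullet> v)" unfolding t_def by (rule Cauchy_Schwarz_ineq)
  \<comment> \<open>The coefficient of the negative rank-one part. Its first summand comes from the
    cutoff and produces the error of order \<open>s\<close>; the second belongs to the convex
    function and is compensated through \<open>cube\<close>.\<close>
  define c where "c = s / \<rho> * (4 / m) * \<omega> + s / \<rho> ^ 3 * \<omega>\<^sup>2"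
  have c0: "0 \<le> c" unfolding c_def using s r0 o m by simp
  have ct: "c * t = 4 / m * s * (\<omega> * (t / \<rho>)) + \<omega>\<^sup>2 * (s * t / \<rho> ^ 3)"
    by (simp add: c_def algebra_simps)
  have "4 / m * s * (\<omega> * (t / \<rho>)) \<le> 4 / m * s * sqrt m"
    using ot s m by (intro mult_left_mono) auto
  also have "\<dots> = 4 / sqrt m * s" using m real_div_sqrt[of m] by (simp add: field_simps)
  finally have ct': "c * t \<le> 4 / sqrt m * s + \<omega>\<^sup>2 * (s * t / \<rho> ^ 3)" unfolding ct by simp
  have "(if t \<le> s\<^sup>2 then 1 / 8 else 0) - 4 / sqrt m * s \<le> s / \<rho> * \<omega>\<^sup>2 - c * t"
    using core ct' unfolding cube[symmetric] by (simp add: algebra_simps)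
  then have "((if t \<le> s\<^sup>2 then 1 / 8 else 0) - 4 / sqrt m * s) * (v \<bullet> v) \<le> (s / \<rho> * \<omega>\<^sup>2 - c * t) * (v \<bullet> v)"
    by (intro mult_right_mono) auto
  moreover have "c * (d \<bullet> v)\<^sup>2 \<le> c * (t * (v \<bullet> v))" using dv c0 by (rule mult_left_mono)
  moreover have "(s / \<rho> * (- (4 / m) * \<omega> * (d \<bullet> v)) + (2 * (d \<bullet> v)) * (- s / (2 * \<rho> ^ 3)) * \<omega>\<^sup>2) * (d \<bullet> v)
     = - (c * (d \<bullet> v)\<^sup>2)"
    using r0 by (simp add: c_def power2_eq_square algebra_simps)
  ultimately show ?thesis by (simp only: left_diff_distrib mult.assoc)
qed

context multiwell
begin

definition "edens \<epsilon> u p q z = \<epsilon> * ((p z \<bullet> p z + q z \<bullet> q z) / 2) + V (u z) / \<epsilon>"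

lemma edens_nonneg: "0 < \<epsilon> \<Longrightarrow> 0 \<le> edens \<epsilon> u p q z"
  unfolding edens_def by (simp add: V_nonneg add_nonneg_nonneg)

lemma continuous_on_edens:
  assumes "continuous_on A u" "continuous_on A p" "continuous_on A q"
  shows "continuous_on A (edens \<epsilon> u p q)"
  unfolding edens_def[abs_def] divide_inverse by (intro continuous_intros assms V_comp_cont)

lemma edens_bounds:
  assumes "0 < \<epsilon>"
  shows "V (u z) / \<epsilon> \<le> edens \<epsilon> u p q z" "\<epsilon> * (p z \<bullet> p z) \<le> 2 * edens \<epsilon> u p q z"
    "\<epsilon> * (q z \<bullet> q z) \<le> 2 * edens \<epsilon> u p q z" "\<epsilon> * (p z \<bullet> p z + q z \<bullet> q z) \<le> 2 * edens \<epsilon> u p q z"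
proof -
  have "0 \<le> \<epsilon> * (p z \<bullet> p z)" "0 \<le> \<epsilon> * (q z \<bullet> q z)" "0 \<le> V (u z) / \<epsilon>"
    using assms V_nonneg by auto
  then show "V (u z) / \<epsilon> \<le> edens \<epsilon> u p q z" "\<epsilon> * (p z \<bullet> p z) \<le> 2 * edens \<epsilon> u p q z"
    "\<epsilon> * (q z \<bullet> q z) \<le> 2 * edens \<epsilon> u p q z" "\<epsilon> * (p z \<bullet> p z + q z \<bullet> q z) \<le> 2 * edens \<epsilon> u p q z"
    unfolding edens_def distrib_left add_divide_distrib by simp_all
qed

text \<open>No boundary condition enters: the test field is bounded by the square root of \<open>V\<close>, so the
  terms created by the spatial cutoff cost only a factor \<open>\<epsilon>\<close>.\<close>

lemma energy_near_well:
  "\<exists>C>0. \<forall>\<sigma>\<in>S. \<forall>\<epsilon> s u p q p1 p2 q2. 0 < \<epsilon> \<longrightarrow> 0 < s \<longrightarrow> s\<^sup>2 \<le> m / 4 \<longrightarrow> solves g \<epsilon> (7 / 10) u p q p1 p2 q2 \<longrightarrow>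
     (\<exists>N. continuous_on (sq (13 / 20)) N \<and>
        (\<forall>z\<in>sq (13 / 20). 0 \<le> N z \<and> ((u z - \<sigma>) \<bullet> (u z - \<sigma>) \<le> s\<^sup>2 \<longrightarrow> edens \<epsilon> u p q z \<le> N z)) \<and>
        integral (sq (13 / 20)) N \<le> C * (s + \<epsilon>) * integral (sq (7 / 10)) (edens \<epsilon> u p q))"
proof -
  define C1 where "C1 = 4 / sqrt m"
  define C2 where "C2 = 40 / 7 * (1 / lam + 2)"
  \<comment> \<open>1/4 compares the coefficient 1/8 of the gradient with the 1/2 in the density;
    \<open>3 * lam / (8 * Lam)\<close> combines \<open>3 / 8 \<le> B z * A z\<close> near the well
    with the ratio of radial derivative to potential.\<close>
  define c3 where "c3 = min (1 / 4) (3 * lam / (8 * Lam))"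
  define \<kappa> :: real where "\<kappa> = (1 - ((13 / 20) / (7 / 10))\<^sup>2) ^ 4"
  define C where "C = (C2 + 2 * C1) / (c3 * \<kappa>)"
  have \<kappa>: "0 < \<kappa>" by (simp add: \<kappa>_def power2_eq_square)
  have c3: "0 < c3" using pos by (simp add: c3_def)
  have C12: "0 < C1" "0 < C2" using pos by (auto simp: C1_def C2_def add_pos_pos)
  have C: "0 < C" using C12 c3 \<kappa> by (simp add: C_def)
  have main: "\<exists>N. continuous_on (sq (13 / 20)) N \<and>
        (\<forall>z\<in>sq (13 / 20). 0 \<le> N z \<and> ((u z - \<sigma>) \<bullet> (u z - \<sigma>) \<le> s\<^sup>2 \<longrightarrow> edens \<epsilon> u p q z \<le> N z)) \<and>
        integral (sq (13 / 20)) N \<le> C * (s + \<epsilon>) * integral (sq (7 / 10)) (edens \<epsilon> u p q)"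
    if \<sigma>: "\<sigma> \<in> S" and \<epsilon>: "0 < \<epsilon>" and s: "0 < s" "s\<^sup>2 \<le> m / 4" and sol: "solves g \<epsilon> (7 / 10) u p q p1 p2 q2"
    for \<sigma> \<epsilon> s u p q p1 p2 q2
  proof -
    let ?Q = "sq (7 / 10)"
    let ?e = "edens \<epsilon> u p q"
    have u: "has_partials ?Q u p q" and p: "has_partials ?Q p p1 p2" and q: "has_partials ?Q q p2 q2"
      using sol by (auto simp: solves_def)
    have eq: "\<epsilon> *\<^sub>R (p1 z + q2 z) = (1 / \<epsilon>) *\<^sub>R g (u z)" if "z \<in> ?Q" for z
    proof -
      have "g (u z) = \<epsilon>\<^sup>2 *\<^sub>R (p1 z + q2 z)" using sol that by (auto simp: solves_def)
      then show ?thesis using \<epsilon> by (simp add: power2_eq_square)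
    qed
    define d where "d z = u z - \<sigma>" for z
    define \<omega> where "\<omega> z = max 0 (1 - d z \<bullet> d z / m)" for z
    define \<rho> where "\<rho> z = sqrt (s\<^sup>2 + d z \<bullet> d z)" for z
    define B where "B z = s / \<rho> z" for z
    define A where "A z = (\<omega> z)\<^sup>2" for z
    define Z where "Z z = (B z * A z) *\<^sub>R d z" for z
    define D where "D z v = B z * (- (4 / m) * \<omega> z * (d z \<bullet> v)) + (2 * (d z \<bullet> v)) * (- s / (2 * \<rho> z ^ 3)) * A z" for z v
    have \<rho>0: "0 < \<rho> z" for z using s by (simp add: \<rho>_def add_pos_nonneg)
    have hd: "has_partials ?Q d p q"
      using has_partials_diff[OF u has_partials_const[of ?Q \<sigma>]] by (simp add: d_def[abs_def])
    have hdd: "has_partials ?Q (\<lambda>z. d z \<bullet> d z) (\<lambda>z. 2 * (d z \<bullet> p z)) (\<lambda>z. 2 * (d z \<bullet> q z))"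
      using has_partials_inner[OF hd hd] by (simp add: inner_commute)
    have hA: "has_partials ?Q A (\<lambda>z. - (4 / m) * \<omega> z * (d z \<bullet> p z)) (\<lambda>z. - (4 / m) * \<omega> z * (d z \<bullet> q z))"
      using has_partials_psq_dist[OF u, of \<sigma> m] by (simp add: A_def[abs_def] \<omega>_def d_def psq_def)
    have "has_partials ?Q (\<lambda>z. s / sqrt (s\<^sup>2 + d z \<bullet> d z))
      (\<lambda>z. (2 * (d z \<bullet> p z)) *\<^sub>R (- s / (2 * sqrt (s\<^sup>2 + d z \<bullet> d z) ^ 3)))
      (\<lambda>z. (2 * (d z \<bullet> q z)) *\<^sub>R (- s / (2 * sqrt (s\<^sup>2 + d z \<bullet> d z) ^ 3)))"
    proof (rule has_partials_compose_real[OF hdd])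
      fix t assume "t \<in> (\<lambda>z. d z \<bullet> d z) ` ?Q"
      then have "0 < s\<^sup>2 + t" using s by (auto simp: add_pos_nonneg)
      then have "((\<lambda>t. s / sqrt (s\<^sup>2 + t)) has_real_derivative - s / (2 * sqrt (s\<^sup>2 + t) ^ 3)) (at t)"
        by (auto intro!: derivative_eq_intros simp: field_simps power3_eq_cube)
      then show "((\<lambda>t. s / sqrt (s\<^sup>2 + t)) has_vector_derivative - s / (2 * sqrt (s\<^sup>2 + t) ^ 3)) (at t)"
        by (simp add: has_real_derivative_iff_has_vector_derivative)
    next
      have "s\<^sup>2 + d z \<bullet> d z \<noteq> 0" for z
        using \<rho>0[of z] by (auto simp: \<rho>_def)
      then show "continuous_on ((\<lambda>z. d z \<bullet> d z) ` ?Q) (\<lambda>t. - s / (2 * sqrt (s\<^sup>2 + t) ^ 3))"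
        by (intro continuous_intros) auto
    qed
    then have hB: "has_partials ?Q B (\<lambda>z. (2 * (d z \<bullet> p z)) * (- s / (2 * \<rho> z ^ 3))) (\<lambda>z. (2 * (d z \<bullet> q z)) * (- s / (2 * \<rho> z ^ 3)))"
      by (simp add: B_def[abs_def] \<rho>_def)
    have hZ: "has_partials ?Q Z (\<lambda>z. (B z * A z) *\<^sub>R p z + D z (p z) *\<^sub>R d z) (\<lambda>z. (B z * A z) *\<^sub>R q z + D z (q z) *\<^sub>R d z)"
      unfolding Z_def[abs_def] D_def by (rule has_partials_scaleR[OF has_partials_mult[OF hB hA] hd])
    define Z1 where "Z1 z = (B z * A z) *\<^sub>R p z + D z (p z) *\<^sub>R d z" for z
    define Z2 where "Z2 z = (B z * A z) *\<^sub>R q z + D z (q z) *\<^sub>R d z" for z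
    have hZ: "has_partials ?Q Z Z1 Z2" using hZ by (simp add: Z1_def[abs_def] Z2_def[abs_def])
    note [continuous_intros] = has_partialsD(1-3)[OF u] has_partialsD(1-3)[OF hZ] has_partialsD(2)[OF p] has_partialsD(3)[OF q]
       has_partialsD(1)[OF has_partials_cutoff] has_partialsD(2,3)[OF has_partials_cutoff]
       continuous_on_edens[OF has_partialsD(1-3)[OF u]]
    define J where "J z = cutoff (7 / 10) z * (Z1 z \<bullet> p z + Z2 z \<bullet> q z + Z z \<bullet> (p1 z + q2 z))
      + cutoff_x (7 / 10) z * (Z z \<bullet> p z) + cutoff_y (7 / 10) z * (Z z \<bullet> q z)" for z
    have J0: "integral ?Q J = 0" unfolding J_def by (rule integration_by_parts_cutoff[OF hZ p q]) simp
    have cJ: "continuous_on ?Q J" unfolding J_def by (intro continuous_intros)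
    \<comment> \<open>The integrand of the tested equation plus the monotonicity defect, normalised
      by \<open>c3\<close>. It dominates the density near the well and is nonnegative everywhere,
      yet its weighted integral is known from integration by parts up to terms of order s +
      \<epsilon>.\<close>
    define N where "N z = (\<epsilon> * (Z1 z \<bullet> p z + Z2 z \<bullet> q z + Z z \<bullet> (p1 z + q2 z)) + 2 * C1 * s * ?e z) / c3" for z
    have cN: "continuous_on ?Q N" unfolding N_def using c3 by (intro continuous_intros) auto
    have AB: "0 \<le> B z" "B z \<le> 1" "0 \<le> A z" "A z \<le> 1" for z
    proof -
      show "0 \<le> B z" "0 \<le> A z" using s \<rho>0[of z] by (auto simp: B_def A_def)
      have "s \<le> \<rho> z" unfolding \<rho>_def by (intro real_le_rsqrt) simp
      then show "B z \<le> 1" using \<rho>0[of z] by (simp add: B_def)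
      show "A z \<le> 1" using pos by (auto simp: A_def \<omega>_def power_le_one_iff max_def)
    qed
    have A0: "A z = 0" if "m < d z \<bullet> d z" for z
      using that pos by (simp add: A_def \<omega>_def max_def field_simps)
    have grad: "(if d z \<bullet> d z \<le> s\<^sup>2 then 1 / 8 else 0) * (v \<bullet> v) - C1 * s * (v \<bullet> v)
        \<le> ((B z * A z) *\<^sub>R v + D z v *\<^sub>R d z) \<bullet> v" for z v
      using truncated_radial_field_monotone[OF s, of "d z" v]
      by (simp add: inner_add_left C1_def B_def A_def D_def \<omega>_def \<rho>_def)
    have pot: "(if d z \<bullet> d z \<le> s\<^sup>2 then c3 * V (u z) else 0) \<le> Z z \<bullet> g (u z)" for z
    proof (cases "d z \<bullet> d z \<le> m")
      case False
      then show ?thesis using A0[of z] s zero_le_power2[of s] pos by (auto simp: Z_def)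
    next
      case True
      have rad: "lam * (d z \<bullet> d z) \<le> d z \<bullet> g (u z)" using near_radial[OF \<sigma>] True by (simp add: d_def)
      show ?thesis
      proof (cases "d z \<bullet> d z \<le> s\<^sup>2")
        case near: True
        have "3 / 4 \<le> \<omega> z" using s near pos by (simp add: \<omega>_def field_simps)
        then have a: "(3 / 4)\<^sup>2 \<le> A z" unfolding A_def by (intro power_mono) auto
        have "(\<rho> z)\<^sup>2 = s\<^sup>2 + d z \<bullet> d z" by (simp add: \<rho>_def add_nonneg_nonneg)
        moreover have "(2 / 3 * \<rho> z)\<^sup>2 = 4 / 9 * (\<rho> z)\<^sup>2" by (simp add: power_mult_distrib power_divide)
        ultimately have "(2 / 3 * \<rho> z)\<^sup>2 \<le> s\<^sup>2" using near zero_le_power2[of s] by linarith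
        then have "2 / 3 * \<rho> z \<le> s" by (rule power2_le_imp_le) (use s in auto)
        then have b: "2 / 3 \<le> B z" using \<rho>0[of z] by (simp add: B_def field_simps)
        have ab: "3 / 8 \<le> B z * A z"
          using mult_mono[OF b a] AB by (simp add: power2_eq_square)
        have "V (u z) \<le> Lam * (d z \<bullet> d z)" using near_upper[OF \<sigma>] True by (simp add: d_def)
        then have v: "lam / Lam * V (u z) \<le> lam * (d z \<bullet> d z)" using pos by (simp add: field_simps)
        have "c3 * V (u z) \<le> 3 / 8 * (lam / Lam * V (u z))"
          using mult_right_mono[OF min.cobounded2 V_nonneg, of "1 / 4" "3 * lam / (8 * Lam)" "u z"] by (simp add: c3_def)
        also have "\<dots> \<le> (B z * A z) * (d z \<bullet> g (u z))"
          using v rad pos V_nonneg[of "u z"] AB by (intro mult_mono ab) auto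
        finally show ?thesis using near by (simp add: Z_def)
      next
        case far: False
        have "0 \<le> d z \<bullet> g (u z)" using rad pos order_trans[OF _ rad] by simp
        then show ?thesis using far AB by (simp add: Z_def)
      qed
    qed
    have Zsq: "Z z \<bullet> Z z \<le> V (u z) / lam" for z
    proof (cases "d z \<bullet> d z \<le> m")
      case True
      have "B z * A z \<le> 1" using AB by (simp add: mult_le_one)
      then have "(B z * A z)\<^sup>2 \<le> 1" using AB by (simp add: power_le_one)
      then have "Z z \<bullet> Z z \<le> d z \<bullet> d z"
        using mult_right_mono[of "(B z * A z)\<^sup>2" 1 "d z \<bullet> d z"] by (simp add: Z_def power2_eq_square)
      also have "\<dots> \<le> V (u z) / lam" using near_lower[OF \<sigma>, of "u z"] True pos by (simp add: d_def field_simps)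
      finally show ?thesis .
    next
      case False
      then show ?thesis using A0[of z] V_nonneg[of "u z"] pos by (simp add: Z_def)
    qed
    have low: "(if d z \<bullet> d z \<le> s\<^sup>2 then ?e z else 0) \<le> N z" if z: "z \<in> ?Q" for z
    proof -
      let ?I = "if d z \<bullet> d z \<le> s\<^sup>2 then 1 else 0 :: real"
      have e1: "\<epsilon> * (Z z \<bullet> (p1 z + q2 z)) = (1 / \<epsilon>) * (Z z \<bullet> g (u z))"
        using arg_cong[OF eq[OF z], of "\<lambda>v. Z z \<bullet> v"] by simp
      have "?I * c3 * (V (u z) / \<epsilon>) \<le> (1 / \<epsilon>) * (Z z \<bullet> g (u z))"
        using mult_left_mono[OF pot[of z], of "1 / \<epsilon>"] \<epsilon> by (simp split: if_splits)
      moreover have "\<epsilon> * ((?I / 8) * (v \<bullet> v)) - \<epsilon> * (C1 * s * (v \<bullet> v)) \<le> \<epsilon> * (((B z * A z) *\<^sub>R v + D z v *\<^sub>R d z) \<bullet> v)" for v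
        using mult_left_mono[OF grad[of z v], of \<epsilon>] \<epsilon> by (simp add: right_diff_distrib split: if_splits)
      from add_mono[OF this[of "p z"] this[of "q z"]]
      have "\<epsilon> * ((?I / 8) * (p z \<bullet> p z + q z \<bullet> q z)) - C1 * s * (\<epsilon> * (p z \<bullet> p z + q z \<bullet> q z))
          \<le> \<epsilon> * (Z1 z \<bullet> p z + Z2 z \<bullet> q z)"
        unfolding Z1_def Z2_def by (simp add: algebra_simps)
      moreover have "C1 * s * (\<epsilon> * (p z \<bullet> p z + q z \<bullet> q z)) \<le> C1 * s * (2 * ?e z)"
        using edens_bounds(4)[OF \<epsilon>] C12 s by (intro mult_left_mono) auto
      moreover have "?I * c3 * ?e z \<le> \<epsilon> * ((?I / 8) * (p z \<bullet> p z + q z \<bullet> q z)) + ?I * c3 * (V (u z) / \<epsilon>)"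
      proof -
        have "c3 * (\<epsilon> * ((p z \<bullet> p z + q z \<bullet> q z) / 2)) \<le> 1 / 4 * (\<epsilon> * ((p z \<bullet> p z + q z \<bullet> q z) / 2))"
          using \<epsilon> by (intro mult_right_mono) (auto simp: c3_def)
        then show ?thesis by (simp add: edens_def distrib_left)
      qed
      ultimately have "?I * c3 * ?e z \<le> \<epsilon> * (Z1 z \<bullet> p z + Z2 z \<bullet> q z) + \<epsilon> * (Z z \<bullet> (p1 z + q2 z)) + 2 * C1 * s * ?e z"
        unfolding e1 by linarith
      then have "?I * c3 * ?e z / c3 \<le> N z"
        unfolding N_def using c3 by (intro divide_right_mono) (auto simp: distrib_left)
      then show ?thesis using c3 by (simp split: if_splits)
    qed
    have up: "cutoff (7 / 10) z * (c3 * N z) \<le> \<epsilon> * J z + (C2 * \<epsilon> + 2 * C1 * s) * ?e z" if z: "z \<in> ?Q" for z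
    proof -
      have e0: "0 \<le> ?e z" using edens_nonneg[OF \<epsilon>] .
      \<comment> \<open>Young's inequality with weight \<epsilon> and \<open>Zsq\<close> bound
        \<open>Z z \<bullet> v\<close> by the energy density itself, so the factor \<epsilon> in
        front is gained. The constant 40 / 7 is the cutoff bound 4 / (7 / 10).\<close>
      have bd: "\<bar>\<epsilon> * (b * (Z z \<bullet> v))\<bar> \<le> 20 / 7 * ((1 / lam + 2) * (\<epsilon> * ?e z))"
        if b: "\<bar>b\<bar> \<le> 4 / (7 / 10) * sqrt (cutoff (7 / 10) z)" and v: "\<epsilon> * (v \<bullet> v) \<le> 2 * ?e z" for b v
      proof -
        have "sqrt (cutoff (7 / 10) z) \<le> 1" using cutoff_le_1 by simp
        then have "4 / (7 / 10) * sqrt (cutoff (7 / 10) z) \<le> 40 / 7" by simp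
        with b have b': "\<bar>b\<bar> \<le> 40 / 7" by (rule order_trans)
        have "2 * (norm (Z z) / sqrt \<epsilon>) * (sqrt \<epsilon> * norm v) \<le> (norm (Z z) / sqrt \<epsilon>)\<^sup>2 + (sqrt \<epsilon> * norm v)\<^sup>2"
          by (rule sum_squares_bound)
        then have "2 * (norm (Z z) * norm v) \<le> Z z \<bullet> Z z / \<epsilon> + \<epsilon> * (v \<bullet> v)"
          using \<epsilon> by (simp add: power_mult_distrib power_divide dot_square_norm)
        also have "\<dots> \<le> 1 / lam * ?e z + 2 * ?e z"
        proof -
          have "Z z \<bullet> Z z / \<epsilon> \<le> V (u z) / lam / \<epsilon>" using Zsq[of z] \<epsilon> by (intro divide_right_mono) auto
          also have "\<dots> = 1 / lam * (V (u z) / \<epsilon>)" by simp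
          also have "\<dots> \<le> 1 / lam * ?e z" using edens_bounds(1)[OF \<epsilon>] pos by (intro mult_left_mono) auto
          finally show ?thesis using v by simp
        qed
        finally have zv: "\<bar>Z z \<bullet> v\<bar> \<le> (1 / lam + 2) * ?e z / 2"
          using Cauchy_Schwarz_ineq2[of "Z z" v] by (simp add: algebra_simps)
        have "\<bar>\<epsilon> * (b * (Z z \<bullet> v))\<bar> = \<epsilon> * (\<bar>b\<bar> * \<bar>Z z \<bullet> v\<bar>)" using \<epsilon> by (simp add: abs_mult)
        also have "\<dots> \<le> \<epsilon> * (40 / 7 * ((1 / lam + 2) * ?e z / 2))"
          using b' zv \<epsilon> by (intro mult_left_mono mult_mono) auto
        finally show ?thesis by (simp add: algebra_simps)
      qed
      have bdp: "\<bar>\<epsilon> * (cutoff_x (7 / 10) z * (Z z \<bullet> p z))\<bar> \<le> 20 / 7 * ((1 / lam + 2) * (\<epsilon> * ?e z))"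
        by (rule bd[OF cutoff_partials_bound(1) edens_bounds(2)]) (use z \<epsilon> in auto)
      have bdq: "\<bar>\<epsilon> * (cutoff_y (7 / 10) z * (Z z \<bullet> q z))\<bar> \<le> 20 / 7 * ((1 / lam + 2) * (\<epsilon> * ?e z))"
        by (rule bd[OF cutoff_partials_bound(2) edens_bounds(3)]) (use z \<epsilon> in auto)
      have ce: "cutoff (7 / 10) z * (2 * C1 * s * ?e z) \<le> 2 * C1 * s * ?e z"
        using cutoff_le_1[of "7/10" z] cutoff_nonneg[of "7/10" z] e0 C12 s by (simp add: mult_left_le_one_le)
      have "c3 * N z = \<epsilon> * (Z1 z \<bullet> p z + Z2 z \<bullet> q z + Z z \<bullet> (p1 z + q2 z)) + 2 * C1 * s * ?e z"
        using c3 by (simp add: N_def)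
      then have "cutoff (7 / 10) z * (c3 * N z) = \<epsilon> * (cutoff (7 / 10) z * (Z1 z \<bullet> p z + Z2 z \<bullet> q z + Z z \<bullet> (p1 z + q2 z)))
          + cutoff (7 / 10) z * (2 * C1 * s * ?e z)"
        by (simp only: distrib_left mult.left_commute)
      moreover have "\<epsilon> * (cutoff (7 / 10) z * (Z1 z \<bullet> p z + Z2 z \<bullet> q z + Z z \<bullet> (p1 z + q2 z)))
         = \<epsilon> * J z - \<epsilon> * (cutoff_x (7 / 10) z * (Z z \<bullet> p z))
           - \<epsilon> * (cutoff_y (7 / 10) z * (Z z \<bullet> q z))"
        unfolding J_def by (simp only: right_diff_distrib distrib_left)
      moreover have "(C2 * \<epsilon> + 2 * C1 * s) * ?e z = 2 * (20 / 7 * ((1 / lam + 2) * (\<epsilon> * ?e z))) + 2 * C1 * s * ?e z"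
        by (simp add: C2_def distrib_right)
      ultimately show ?thesis using bdp bdq ce by linarith
    qed
    have N0: "0 \<le> N z" if "z \<in> ?Q" for z
      using low[OF that] edens_nonneg[OF \<epsilon>, of u p q z] by (simp split: if_splits)
    have sub: "sq (13 / 20) \<subseteq> ?Q" by (rule sq_mono) simp
    have c2: "continuous_on ?Q (\<lambda>z. cutoff (7 / 10) z * (c3 * N z))" by (intro continuous_intros cN)
    have "\<kappa> * c3 * integral (sq (13 / 20)) N = integral (sq (13 / 20)) (\<lambda>z. \<kappa> * (c3 * N z))" by simp
    also have "\<dots> \<le> integral (sq (13 / 20)) (\<lambda>z. cutoff (7 / 10) z * (c3 * N z))"
    proof (intro integral_sq_mono mult_right_mono)
      fix z :: "real \<times> real" assume z: "z \<in> sq (13 / 20)"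
      show "\<kappa> \<le> cutoff (7 / 10) z" unfolding \<kappa>_def by (rule cutoff_lower) (use z in auto)
      show "0 \<le> c3 * N z" using c3 N0[OF subsetD[OF sub z]] by simp
    qed (intro continuous_intros continuous_on_subset[OF cN sub] continuous_on_subset[OF c2 sub])+
    also have "\<dots> \<le> integral ?Q (\<lambda>z. cutoff (7 / 10) z * (c3 * N z))"
      using c3 N0 by (intro integral_sq_subset c2) (simp_all add: cutoff_nonneg)
    also have "\<dots> \<le> integral ?Q (\<lambda>z. \<epsilon> * J z + (C2 * \<epsilon> + 2 * C1 * s) * ?e z)"
      by (intro integral_sq_mono c2 continuous_intros cJ up)
    also have "\<dots> = integral ?Q (\<lambda>z. \<epsilon> * J z) + integral ?Q (\<lambda>z. (C2 * \<epsilon> + 2 * C1 * s) * ?e z)"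
      by (intro integral_add integrable_sq continuous_intros cJ)
    also have "\<dots> = (C2 * \<epsilon> + 2 * C1 * s) * integral ?Q ?e" using J0 by simp
    also have "\<dots> \<le> ((C2 + 2 * C1) * (s + \<epsilon>)) * integral ?Q ?e"
      using C12 \<epsilon> s edens_nonneg[OF \<epsilon>]
      by (intro mult_right_mono integral_sq_nonneg continuous_intros) (simp add: algebra_simps)+
    finally have "integral (sq (13 / 20)) N \<le> C * (s + \<epsilon>) * integral ?Q ?e"
      using \<kappa> c3 by (simp add: C_def field_simps)
    moreover have "\<forall>z\<in>sq (13 / 20). 0 \<le> N z \<and> ((u z - \<sigma>) \<bullet> (u z - \<sigma>) \<le> s\<^sup>2 \<longrightarrow> ?e z \<le> N z)"
    proof
      fix z :: "real \<times> real" assume "z \<in> sq (13 / 20)"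
      then have z: "z \<in> ?Q" using sub by blast
      show "0 \<le> N z \<and> ((u z - \<sigma>) \<bullet> (u z - \<sigma>) \<le> s\<^sup>2 \<longrightarrow> ?e z \<le> N z)"
        using N0[OF z] low[OF z] by (auto simp: d_def)
    qed
    ultimately show ?thesis using continuous_on_subset[OF cN sub] by blast
  qed
  show ?thesis using C main by (intro exI[of _ C]) blast
qed

text \<open>The majorants of the single wells are added. A continuous function, rather than the
  integral over the set where \<open>u\<close> is close to a well, is kept so that it can be
  restricted to segments and averaged by Fubini.\<close>

lemma energy_near_wells:
  "\<exists>C>0. \<forall>\<epsilon> s u p q p1 p2 q2. 0 < \<epsilon> \<longrightarrow> 0 < s \<longrightarrow> s\<^sup>2 \<le> m / 4 \<longrightarrow> solves g \<epsilon> (7 / 10) u p q p1 p2 q2 \<longrightarrow>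
     (\<exists>N. continuous_on (sq (13 / 20)) N \<and> (\<forall>z\<in>sq (13 / 20). 0 \<le> N z) \<and>
        (\<forall>\<sigma>\<in>S. \<forall>z\<in>sq (13 / 20). (u z - \<sigma>) \<bullet> (u z - \<sigma>) \<le> s\<^sup>2 \<longrightarrow> edens \<epsilon> u p q z \<le> N z) \<and>
        integral (sq (13 / 20)) N \<le> C * (s + \<epsilon>) * integral (sq (7 / 10)) (edens \<epsilon> u p q))"
proof -
  let ?Q = "sq (13 / 20)"
  obtain C where C: "0 < C" and main: "\<forall>\<sigma>\<in>S. \<forall>\<epsilon> s u p q p1 p2 q2. 0 < \<epsilon> \<longrightarrow> 0 < s \<longrightarrow> s\<^sup>2 \<le> m / 4 \<longrightarrow>
     solves g \<epsilon> (7 / 10) u p q p1 p2 q2 \<longrightarrow> (\<exists>N. continuous_on ?Q N \<and>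
        (\<forall>z\<in>?Q. 0 \<le> N z \<and> ((u z - \<sigma>) \<bullet> (u z - \<sigma>) \<le> s\<^sup>2 \<longrightarrow> edens \<epsilon> u p q z \<le> N z)) \<and>
        integral ?Q N \<le> C * (s + \<epsilon>) * integral (sq (7 / 10)) (edens \<epsilon> u p q))"
    using energy_near_well by (elim exE conjE)
  have card: "0 < real (card S)" using finite_S S_nonempty by (simp add: card_gt_0_iff)
  show ?thesis
  proof (intro exI[of _ "real (card S) * C"] conjI allI impI)
    show "0 < real (card S) * C" using C card by simp
    fix \<epsilon> s u p q p1 p2 q2
    assume A: "0 < \<epsilon>" "0 < s" "s\<^sup>2 \<le> m / 4" "solves g \<epsilon> (7 / 10) u p q p1 p2 q2"
    let ?e = "edens \<epsilon> u p q"
    from main A have "\<forall>\<sigma>. \<exists>N. \<sigma> \<in> S \<longrightarrow> continuous_on ?Q N \<and>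
        (\<forall>z\<in>?Q. 0 \<le> N z \<and> ((u z - \<sigma>) \<bullet> (u z - \<sigma>) \<le> s\<^sup>2 \<longrightarrow> ?e z \<le> N z)) \<and>
        integral ?Q N \<le> C * (s + \<epsilon>) * integral (sq (7 / 10)) ?e" by blast
    from choice[OF this] obtain N where N: "\<And>\<sigma>. \<sigma> \<in> S \<Longrightarrow> continuous_on ?Q (N \<sigma>)"
      "\<And>\<sigma> z. \<sigma> \<in> S \<Longrightarrow> z \<in> ?Q \<Longrightarrow> 0 \<le> N \<sigma> z"
      "\<And>\<sigma> z. \<sigma> \<in> S \<Longrightarrow> z \<in> ?Q \<Longrightarrow> (u z - \<sigma>) \<bullet> (u z - \<sigma>) \<le> s\<^sup>2 \<Longrightarrow> ?e z \<le> N \<sigma> z"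
      "\<And>\<sigma>. \<sigma> \<in> S \<Longrightarrow> integral ?Q (N \<sigma>) \<le> C * (s + \<epsilon>) * integral (sq (7 / 10)) ?e"
      by blast
    let ?N = "\<lambda>z. \<Sum>\<sigma>\<in>S. N \<sigma> z"
    have "?e z \<le> ?N z" if "\<sigma> \<in> S" "z \<in> ?Q" "(u z - \<sigma>) \<bullet> (u z - \<sigma>) \<le> s\<^sup>2" for \<sigma> z
    proof -
      have "N \<sigma> z \<le> ?N z" using that N(2) finite_S by (intro member_le_sum) auto
      then show ?thesis using N(3)[OF that] by linarith
    qed
    moreover have "integral ?Q ?N \<le> real (card S) * C * (s + \<epsilon>) * integral (sq (7 / 10)) ?e"
    proof -
      have "integral ?Q ?N = (\<Sum>\<sigma>\<in>S. integral ?Q (N \<sigma>))"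
        using finite_S N(1) by (intro integral_sum integrable_sq) auto
      also have "\<dots> \<le> real (card S) * (C * (s + \<epsilon>) * integral (sq (7 / 10)) ?e)"
        using N(4) by (rule sum_bounded_above)
      finally show ?thesis by (simp add: mult.assoc)
    qed
    ultimately show "\<exists>N. continuous_on ?Q N \<and> (\<forall>z\<in>?Q. 0 \<le> N z) \<and>
        (\<forall>\<sigma>\<in>S. \<forall>z\<in>?Q. (u z - \<sigma>) \<bullet> (u z - \<sigma>) \<le> s\<^sup>2 \<longrightarrow> ?e z \<le> N z) \<and>
        integral ?Q N \<le> real (card S) * C * (s + \<epsilon>) * integral (sq (7 / 10)) ?e"
      using N(1,2) by (intro exI[of _ ?N] conjI ballI impI continuous_on_sum sum_nonneg) auto
  qed
qed

end

section \<open>Good squares and the Pohozaev identity\<close>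

lemma ex_less_on_interval:
  fixes f :: "real \<Rightarrow> real"
  assumes "continuous_on {a..b} f" "integral {a..b} f < (b - a) * c" "a \<le> b"
  shows "\<exists>x\<in>{a..b}. f x < c"
proof (rule ccontr)
  assume "\<not> ?thesis"
  then have "integral {a..b} (\<lambda>_. c) \<le> integral {a..b} f"
    by (intro integral_le integrable_continuous_interval assms) (auto simp: not_less)
  then show False using assms by simp
qed

text \<open>The four segments run across the whole square of half-side \<open>l\<close> and contain
  the boundary of \<open>sq a\<close>. Their length being independent of \<open>a\<close> makes the
  average over \<open>a\<close> a plain application of Fubini, and puts all curves on one parameter
  interval.\<close>

definition lines :: "real \<Rightarrow> (real \<times> real \<Rightarrow> real) \<Rightarrow> real \<Rightarrow> real" where
  "lines l f a = integral {-l..l} (\<lambda>t. f (a, t)) + integral {-l..l} (\<lambda>t. f (-a, t))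
     + integral {-l..l} (\<lambda>t. f (t, a)) + integral {-l..l} (\<lambda>t. f (t, -a))"

lemma continuous_on_lines:
  assumes f: "continuous_on (sq l) f" and b: "0 \<le> b"
  shows "continuous_on {b..l} (lines l f)"
proof -
  have 1: "continuous_on {-l..l} (\<lambda>a. integral {-l..l} (\<lambda>t. f (a, t)))"
    by (rule continuous_on_integral_column[OF f])
  have 2: "continuous_on {-l..l} (\<lambda>a. integral {-l..l} (\<lambda>t. f (t, a)))"
    by (rule continuous_on_integral_row[OF f])
  have "continuous_on {b..l} (\<lambda>a. integral {-l..l} (\<lambda>t. f (-a, t)))"
    "continuous_on {b..l} (\<lambda>a. integral {-l..l} (\<lambda>t. f (t, -a)))"
    by (rule continuous_on_compose2[OF 1 continuous_on_minus[OF continuous_on_id]], use b in auto)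
      (rule continuous_on_compose2[OF 2 continuous_on_minus[OF continuous_on_id]], use b in auto)
  moreover have "continuous_on {b..l} (\<lambda>a. integral {-l..l} (\<lambda>t. f (a, t)))"
    "continuous_on {b..l} (\<lambda>a. integral {-l..l} (\<lambda>t. f (t, a)))"
    using b by (auto intro: continuous_on_subset[OF 1] continuous_on_subset[OF 2])
  ultimately show ?thesis unfolding lines_def[abs_def] by (intro continuous_on_add)
qed

text \<open>Each of the four families of parallel segments sweeps out a part of
  \<open>sq l\<close>.\<close>

lemma integral_lines_le:
  assumes f: "continuous_on (sq l) f" and f0: "\<And>z. z \<in> sq l \<Longrightarrow> 0 \<le> f z" and b: "0 \<le> b" "b \<le> l"
  shows "integral {b..l} (lines l f) \<le> 4 * integral (sq l) f"
proof -
  define c where "c a = integral {-l..l} (\<lambda>t. f (a, t))" for a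
  define r where "r a = integral {-l..l} (\<lambda>t. f (t, a))" for a
  have cc: "continuous_on {-l..l} c" unfolding c_def by (rule continuous_on_integral_column[OF f])
  have cr: "continuous_on {-l..l} r" unfolding r_def by (rule continuous_on_integral_row[OF f])
  have c0: "0 \<le> c a" "0 \<le> r a" if "a \<in> {-l..l}" for a
    unfolding c_def r_def using that f0
    by (intro Henstock_Kurzweil_Integration.integral_nonneg integrable_continuous_interval
        continuous_on_column[OF f] continuous_on_row[OF f]; simp add: mem_sq)+
  have pos: "integral {b..l} k \<le> integral {-l..l} k" "integral {b..l} (\<lambda>a. k (-a)) \<le> integral {-l..l} k"
    "k integrable_on {b..l}" "(\<lambda>a. k (-a)) integrable_on {b..l}"
    if k: "continuous_on {-l..l} k" "\<And>a. a \<in> {-l..l} \<Longrightarrow> 0 \<le> k a" for k :: "real \<Rightarrow> real"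
  proof -
    have sub: "{b..l} \<subseteq> {-l..l}" "{-l..-b} \<subseteq> {-l..l}" using b by auto
    have i: "k integrable_on {-l..l}" "k integrable_on {b..l}" "k integrable_on {-l..-b}"
      using k sub by (auto intro!: integrable_continuous_interval intro: continuous_on_subset)
    show "integral {b..l} k \<le> integral {-l..l} k" "k integrable_on {b..l}"
      using sub k(2) i by (auto intro!: integral_subset_le)
    have "integral {b..l} (\<lambda>a. k (-a)) = integral {-l..-b} k"
      using Henstock_Kurzweil_Integration.integral_reflect_real[of "-b" "-l" k] by simp
    also have "\<dots> \<le> integral {-l..l} k"
      using sub k(2) i by (auto intro!: integral_subset_le)
    finally show "integral {b..l} (\<lambda>a. k (-a)) \<le> integral {-l..l} k" .
    show "(\<lambda>a. k (-a)) integrable_on {b..l}"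
      using i(3) Henstock_Kurzweil_Integration.integrable_reflect_real[of k "-b" "-l"] by simp
  qed
  have "lines l f = (\<lambda>a. c a + c (-a) + r a + r (-a))" by (simp add: lines_def[abs_def] c_def r_def)
  then have "integral {b..l} (lines l f) = integral {b..l} c + integral {b..l} (\<lambda>a. c (-a))
     + integral {b..l} r + integral {b..l} (\<lambda>a. r (-a))"
    using pos(3,4)[OF cc c0(1)] pos(3,4)[OF cr c0(2)] by (simp add: integral_add integrable_add)
  also have "\<dots> \<le> integral {-l..l} c + integral {-l..l} c + integral {-l..l} r + integral {-l..l} r"
    by (intro add_mono pos cc cr c0)
  also have "integral {-l..l} c = integral (sq l) f" unfolding c_def by (rule integral_sq_columns[OF f, symmetric])
  also have "integral {-l..l} r = integral (sq l) f" unfolding r_def by (rule integral_sq_rows[OF f, symmetric])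
  finally show ?thesis by simp
qed

lemma lines_mono:
  assumes "continuous_on (sq l) f" "continuous_on (sq l) h" "a \<in> {0..l}"
    and "\<And>t. t \<in> {-l..l} \<Longrightarrow> f (a, t) \<le> h (a, t) \<and> f (-a, t) \<le> h (-a, t) \<and> f (t, a) \<le> h (t, a) \<and> f (t, -a) \<le> h (t, -a)"
  shows "lines l f a \<le> lines l h a"
  unfolding lines_def using assms(3,4)
  by (intro add_mono integral_le integrable_continuous_interval
      continuous_on_column[OF assms(1)] continuous_on_row[OF assms(1)]
      continuous_on_column[OF assms(2)] continuous_on_row[OF assms(2)]) auto

lemma lines_component_le:
  assumes f: "continuous_on (sq l) f" and f0: "\<And>z. z \<in> sq l \<Longrightarrow> 0 \<le> f z" and a: "a \<in> {0..l}"
  shows "integral {-l..l} (\<lambda>t. f (a, t)) \<le> lines l f a" "integral {-l..l} (\<lambda>t. f (-a, t)) \<le> lines l f a"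
    "integral {-l..l} (\<lambda>t. f (t, a)) \<le> lines l f a" "integral {-l..l} (\<lambda>t. f (t, -a)) \<le> lines l f a"
proof -
  have "0 \<le> integral {-l..l} (\<lambda>t. f (b, t))" "0 \<le> integral {-l..l} (\<lambda>t. f (t, b))" if "b \<in> {-l..l}" for b
    using that f0
    by (intro Henstock_Kurzweil_Integration.integral_nonneg integrable_continuous_interval
        continuous_on_column[OF f] continuous_on_row[OF f]; simp add: mem_sq)+
  from this[of a] this[of "-a"] a
  show "integral {-l..l} (\<lambda>t. f (a, t)) \<le> lines l f a" "integral {-l..l} (\<lambda>t. f (-a, t)) \<le> lines l f a"
    "integral {-l..l} (\<lambda>t. f (t, a)) \<le> lines l f a" "integral {-l..l} (\<lambda>t. f (t, -a)) \<le> lines l f a"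
    unfolding lines_def by auto
qed

context multiwell
begin

text \<open>An average gives one time at which the potential is below \<open>c0\<close>, hence a
  well nearby. With \<theta> = \<epsilon> the variation of \<open>well_bump\<close> along the curve
  is at most a multiple of the energy \<open>M\<close>, uniformly in \<epsilon>. As
  \<open>1 - well_bump\<close> is comparable to the squared distance near the well, the squared
  distance stays linear in \<open>M\<close>.\<close>

lemma curve_near_well:
  "\<exists>K>0. \<exists>\<eta>>0. \<forall>\<epsilon> \<gamma> \<gamma>' M. 0 < \<epsilon> \<longrightarrow> \<epsilon> \<le> 1 \<longrightarrow> 0 < M \<longrightarrow> M \<le> \<eta> \<longrightarrow>
     (\<forall>t\<in>{-(13/20)..13/20}. (\<gamma> has_vector_derivative \<gamma>' t) (at t)) \<longrightarrow>
     continuous_on {-(13/20)..13/20} \<gamma>' \<longrightarrow>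
     integral {-(13/20)..13/20} (\<lambda>t. \<epsilon> * (\<gamma>' t \<bullet> \<gamma>' t) / 2 + V (\<gamma> t) / \<epsilon>) \<le> M \<longrightarrow>
     (\<exists>\<sigma>\<in>S. \<forall>t\<in>{-(13/20)..13/20}. (\<gamma> t - \<sigma>) \<bullet> (\<gamma> t - \<sigma>) \<le> K * M)"
proof -
  let ?I = "{-(13/20)..13/20::real}"
  define K1 where "K1 = 4 / (lam * m) + 4 / (m * sqrt lam)"
  have K1: "0 < K1" using pos by (simp add: K1_def add_pos_pos)
  show ?thesis
  proof (rule exI[of _ "m * K1"], rule conjI[rotated], rule exI[of _ "min (c0 / 4) (1 / (2 * K1))"], intro conjI allI impI)
    show "0 < m * K1" "0 < min (c0 / 4) (1 / (2 * K1))" using K1 pos by auto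
    fix \<epsilon> M :: real and \<gamma> \<gamma>' :: "real \<Rightarrow> 'a"
    assume \<epsilon>: "0 < \<epsilon>" "\<epsilon> \<le> 1" and M: "0 < M" "M \<le> min (c0 / 4) (1 / (2 * K1))"
      and d: "\<forall>t\<in>?I. (\<gamma> has_vector_derivative \<gamma>' t) (at t)" and c': "continuous_on ?I \<gamma>'"
      and int: "integral ?I (\<lambda>t. \<epsilon> * (\<gamma>' t \<bullet> \<gamma>' t) / 2 + V (\<gamma> t) / \<epsilon>) \<le> M"
    let ?e = "\<lambda>t. \<epsilon> * (\<gamma>' t \<bullet> \<gamma>' t) / 2 + V (\<gamma> t) / \<epsilon>"
    have c: "continuous_on ?I \<gamma>"
      by (rule continuous_at_imp_continuous_on) (use d has_vector_derivative_continuous in blast)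
    have cV: "continuous_on ?I (\<lambda>t. V (\<gamma> t) / \<epsilon>)" using \<epsilon> by (intro continuous_intros V_comp_cont c) auto
    have ce: "continuous_on ?I ?e" by (intro continuous_intros cV c') simp
    obtain t0 where t0: "t0 \<in> ?I" "?e t0 < M / (13 / 20)"
      using ex_less_of_integral_less[OF ce, of "M / (13 / 20)"] int M by auto
    have "V (\<gamma> t0) / \<epsilon> \<le> ?e t0" using \<epsilon> by simp
    then have "V (\<gamma> t0) / \<epsilon> \<le> 2 * M" using t0 M by simp
    then have "V (\<gamma> t0) \<le> 2 * M * \<epsilon>" using \<epsilon> by (simp add: field_simps)
    also have "\<dots> \<le> 2 * M" using \<epsilon> M by simp
    finally have V0: "V (\<gamma> t0) \<le> 2 * M" .
    have "V (\<gamma> t0) < c0" using V0 M pos by simp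
    then obtain \<sigma> where \<sigma>: "\<sigma> \<in> S" "(\<gamma> t0 - \<sigma>) \<bullet> (\<gamma> t0 - \<sigma>) \<le> m / 16"
      using away[of "\<gamma> t0"] by (meson not_le)
    have near0: "(\<gamma> t0 - \<sigma>) \<bullet> (\<gamma> t0 - \<sigma>) \<le> m" using \<sigma>(2) pos by linarith
    have "lam * ((\<gamma> t0 - \<sigma>) \<bullet> (\<gamma> t0 - \<sigma>)) \<le> 2 * M"
      using near_lower[OF \<sigma>(1) near0] V0 by linarith
    then have x0: "(\<gamma> t0 - \<sigma>) \<bullet> (\<gamma> t0 - \<sigma>) / m \<le> 2 * M / (lam * m)" using pos by (simp add: field_simps)
    define b where "b t = well_bump \<sigma> (\<gamma> t)" for t
    define b' where "b' t = - (4 / m) * max 0 (1 - (\<gamma> t - \<sigma>) \<bullet> (\<gamma> t - \<sigma>) / m) * ((\<gamma> t - \<sigma>) \<bullet> \<gamma>' t)" for t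
    \<comment> \<open>The curve is viewed as a function of two variables, constant in the second, so
      that the chain rule for the bump can be reused.\<close>
    have "has_partials (?I \<times> UNIV) (\<lambda>z. \<gamma> (fst z)) (\<lambda>z. \<gamma>' (fst z)) (\<lambda>z. 0)"
      unfolding has_partials_def using d
      by (auto intro!: continuous_on_compose2[OF c] continuous_on_compose2[OF c'] continuous_intros derivative_eq_intros)
    from has_partialsD(4)[OF has_partials_psq_dist[OF this, of \<sigma> m], of _ 0]
    have db: "(b has_vector_derivative b' t) (at t)" if "t \<in> ?I" for t
      using that by (simp add: b_def[abs_def] b'_def well_bump_def)
    have cb': "continuous_on ?I b'" unfolding b'_def using pos by (intro continuous_intros c c') auto
    have bb: "\<bar>b' t\<bar> \<le> 4 / (m * sqrt lam) * ?e t" for t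
    proof -
      have "\<bar>b' t\<bar> \<le> 2 / (m * sqrt lam) * (V (\<gamma> t) / \<epsilon> + \<epsilon> * (\<gamma>' t \<bullet> \<gamma>' t))"
        unfolding b'_def by (rule well_bump_partial_bound[OF \<sigma>(1) \<epsilon>(1)])
      also have "\<dots> \<le> 2 / (m * sqrt lam) * (2 * ?e t)"
      proof (intro mult_left_mono)
        have "0 \<le> V (\<gamma> t) / \<epsilon>" using \<epsilon> V_nonneg by simp
        then show "V (\<gamma> t) / \<epsilon> + \<epsilon> * (\<gamma>' t \<bullet> \<gamma>' t) \<le> 2 * ?e t"
          unfolding distrib_left by linarith
      qed (use pos in simp)
      finally show ?thesis by simp
    qed
    \<comment> \<open>Keeps the bump positive along the curve, so the curve cannot leave the
      well.\<close>
    have K1M: "K1 * M < 1" using M K1 by (simp add: field_simps)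
    have "(\<gamma> t - \<sigma>) \<bullet> (\<gamma> t - \<sigma>) \<le> m * K1 * M" if t: "t \<in> ?I" for t
    proof -
      have "\<bar>b t - b t0\<bar> \<le> integral ?I (\<lambda>t. \<bar>b' t\<bar>)"
        by (rule oscillation_le[OF db cb' t0(1) t])
      also have "\<dots> \<le> integral ?I (\<lambda>t. 4 / (m * sqrt lam) * ?e t)"
        using bb by (intro integral_le integrable_continuous_interval continuous_intros cb' cV c') auto
      also have "\<dots> \<le> 4 / (m * sqrt lam) * M"
        unfolding integral_mult_right using int pos by (intro mult_left_mono) auto
      finally have 1: "\<bar>b t - b t0\<bar> \<le> 4 / (m * sqrt lam) * M" .
      have "1 - b t0 \<le> 2 * ((\<gamma> t0 - \<sigma>) \<bullet> (\<gamma> t0 - \<sigma>) / m)"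
        unfolding b_def well_bump_def by (rule one_minus_psq_le)
      then have "1 - b t0 \<le> 4 / (lam * m) * M" using x0 by simp
      then have 2: "1 - b t \<le> K1 * M" using 1 by (simp add: K1_def distrib_right)
      define x where "x = (\<gamma> t - \<sigma>) \<bullet> (\<gamma> t - \<sigma>) / m"
      have x: "0 \<le> x" "b t = psq (1 - x)" using pos by (auto simp: x_def b_def well_bump_def)
      have "x < 1"
      proof (rule ccontr)
        assume "\<not> x < 1"
        then have "max 0 (1 - x) = 0" by simp
        then show False using 2 K1M x by (simp add: psq_def)
      qed
      then have "x * x \<le> x" using x by (simp add: mult_left_le)
      \<comment> \<open>1 - (1 - x)^2 = 2x - x^2 is at least x on [0, 1].\<close>
      then have "x \<le> 1 - b t" using x \<open>x < 1\<close> by (simp add: psq_def power2_eq_square algebra_simps)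
      then have "x \<le> K1 * M" using 2 by simp
      then show ?thesis using pos by (simp add: x_def field_simps)
    qed
    then show "\<exists>\<sigma>\<in>S. \<forall>t\<in>?I. (\<gamma> t - \<sigma>) \<bullet> (\<gamma> t - \<sigma>) \<le> m * K1 * M"
      using \<sigma>(1) by blast
  qed
qed

text \<open>The equation is tested with the dilation field \<open>Y\<close>, position contracted
  with the gradient of \<open>u\<close>. In two dimensions the gradient terms in the divergence of
  the stress field (\<open>F\<close>, \<open>G\<close>) cancel and twice the potential remains; its
  boundary flux is at most \<open>4 * a\<close> times the energy density.\<close>

lemma pohozaev_sq:
  assumes sol: "solves g \<epsilon> l u p q p1 p2 q2" and \<epsilon>: "0 < \<epsilon>" and a: "0 \<le> a" "a \<le> l"
  shows "integral (sq a) (\<lambda>z. V (u z) / \<epsilon>) \<le> 2 * a * lines l (edens \<epsilon> u p q) a"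
proof -
  let ?e = "edens \<epsilon> u p q"
  have sub: "sq a \<subseteq> sq l" using a by (intro sq_mono) simp
  have ul: "has_partials (sq l) u p q" and u: "has_partials (sq a) u p q"
    and p: "has_partials (sq a) p p1 p2" and q: "has_partials (sq a) q p2 q2"
    using sol has_partials_subset[OF _ sub] by (auto simp: solves_def)
  have eq: "\<epsilon> * ((p1 z + q2 z) \<bullet> v) = 1 / \<epsilon> * (g (u z) \<bullet> v)" if "z \<in> sq a" for z v
  proof -
    have "g (u z) = \<epsilon>\<^sup>2 *\<^sub>R (p1 z + q2 z)" using sol that sub by (auto simp: solves_def)
    then show ?thesis using \<epsilon> by (simp add: power2_eq_square)
  qed
  have cel: "continuous_on (sq l) ?e" by (rule continuous_on_edens) (rule has_partialsD[OF ul])+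
  have ce: "continuous_on (sq a) ?e" using continuous_on_subset[OF cel sub] .
  have cV: "continuous_on (sq a) (\<lambda>z. V (u z) / \<epsilon>)"
    using \<epsilon> by (intro continuous_intros V_comp_cont has_partialsD(1)[OF u]) auto
  define ex where "ex z = \<epsilon> * (p z \<bullet> p1 z + q z \<bullet> p2 z) + (1 / \<epsilon>) * (g (u z) \<bullet> p z)" for z
  define ey where "ey z = \<epsilon> * (p z \<bullet> p2 z + q z \<bullet> q2 z) + (1 / \<epsilon>) * (g (u z) \<bullet> q z)" for z
  have he: "has_partials (sq a) ?e ex ey"
  proof -
    have e_eq: "?e = (\<lambda>z. \<epsilon> / 2 * (p z \<bullet> p z + q z \<bullet> q z) + 1 / \<epsilon> * V (u z))"
      by (simp add: edens_def[abs_def] fun_eq_iff)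
    \<comment> \<open>The zero summands are what the product rule yields for constant factors;
      spelling them out lets the derivative rules match.\<close>
    have ex_eq: "ex = (\<lambda>z. (\<epsilon> / 2 * ((p z \<bullet> p1 z + p1 z \<bullet> p z) + (q z \<bullet> p2 z + p2 z \<bullet> q z)) + 0 * (p z \<bullet> p z + q z \<bullet> q z))
       + ((1 / \<epsilon>) * (g (u z) \<bullet> p z) + 0 * V (u z)))"
      by (simp add: ex_def[abs_def] fun_eq_iff inner_commute algebra_simps)
    have ey_eq: "ey = (\<lambda>z. (\<epsilon> / 2 * ((p z \<bullet> p2 z + p2 z \<bullet> p z) + (q z \<bullet> q2 z + q2 z \<bullet> q z)) + 0 * (p z \<bullet> p z + q z \<bullet> q z))
       + ((1 / \<epsilon>) * (g (u z) \<bullet> q z) + 0 * V (u z)))"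
      by (simp add: ey_def[abs_def] fun_eq_iff inner_commute algebra_simps)
    show ?thesis unfolding e_eq ex_eq ey_eq
      by (intro has_partials_add has_partials_mult has_partials_const has_partials_inner p q
          has_partials_compose_gderiv[OF u V_deriv g_cont])
  qed
  define Y where "Y z = fst z *\<^sub>R p z + snd z *\<^sub>R q z" for z
  define Yx where "Yx z = (fst z *\<^sub>R p1 z + 1 *\<^sub>R p z) + (snd z *\<^sub>R p2 z + 0 *\<^sub>R q z)" for z
  define Yy where "Yy z = (fst z *\<^sub>R p2 z + 0 *\<^sub>R p z) + (snd z *\<^sub>R q2 z + 1 *\<^sub>R q z)" for z
  have hY: "has_partials (sq a) Y Yx Yy"
    unfolding Y_def Yx_def Yy_def
    by (intro has_partials_add has_partials_scaleR has_partials_fst has_partials_snd p q)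
  define F where "F z = fst z * ?e z - \<epsilon> * (p z \<bullet> Y z)" for z
  define G where "G z = snd z * ?e z - \<epsilon> * (q z \<bullet> Y z)" for z
  define Fx where "Fx z = (fst z * ex z + 1 * ?e z) - (\<epsilon> * (p z \<bullet> Yx z + p1 z \<bullet> Y z) + 0 * (p z \<bullet> Y z))" for z
  define Fy where "Fy z = (fst z * ey z + 0 * ?e z) - (\<epsilon> * (p z \<bullet> Yy z + p2 z \<bullet> Y z) + 0 * (p z \<bullet> Y z))" for z
  define Gx where "Gx z = (snd z * ex z + 0 * ?e z) - (\<epsilon> * (q z \<bullet> Yx z + p2 z \<bullet> Y z) + 0 * (q z \<bullet> Y z))" for z
  define Gy where "Gy z = (snd z * ey z + 1 * ?e z) - (\<epsilon> * (q z \<bullet> Yy z + q2 z \<bullet> Y z) + 0 * (q z \<bullet> Y z))" for z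
  have hF: "has_partials (sq a) F Fx Fy"
    unfolding F_def[abs_def] Fx_def[abs_def] Fy_def[abs_def]
    by (intro has_partials_diff has_partials_mult has_partials_const has_partials_inner has_partials_fst p hY he)
  have hG: "has_partials (sq a) G Gx Gy"
    unfolding G_def[abs_def] Gx_def[abs_def] Gy_def[abs_def]
    by (intro has_partials_diff has_partials_mult has_partials_const has_partials_inner has_partials_snd q hY he)
  have div: "Fx z + Gy z = 2 * (V (u z) / \<epsilon>)" if z: "z \<in> sq a" for z
  proof -
    have 1: "1 / \<epsilon> * (g (u z) \<bullet> p z) = \<epsilon> * (p1 z \<bullet> p z) + \<epsilon> * (q2 z \<bullet> p z)"
      "1 / \<epsilon> * (g (u z) \<bullet> q z) = \<epsilon> * (p1 z \<bullet> q z) + \<epsilon> * (q2 z \<bullet> q z)"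
      using eq[OF z, of "p z"] eq[OF z, of "q z"] by (simp_all add: inner_add_left distrib_left)
    show ?thesis
      unfolding Fx_def Gy_def ex_def ey_def 1 Yx_def Yy_def Y_def edens_def
      by (simp add: inner_add_right inner_commute algebra_simps diff_divide_distrib)
  qed
  \<comment> \<open>The stress term contributes at most \<open>3 * a\<close> and the density itself
    \<open>a\<close> times the energy density.\<close>
  have pt: "\<bar>a * ?e z - \<epsilon> * (v \<bullet> Y z)\<bar> \<le> 4 * a * ?e z" "\<bar>- a * ?e z - \<epsilon> * (v \<bullet> Y z)\<bar> \<le> 4 * a * ?e z"
    if z: "z \<in> sq a" and v: "v = p z \<or> v = q z" for z v
  proof -
    have "norm (Y z) \<le> a * norm (p z) + a * norm (q z)"
      unfolding Y_def using z a
      by (intro norm_triangle_le add_mono) (auto simp: mem_sq_abs mult_right_mono)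
    then have "norm v * norm (Y z) \<le> norm v * (a * norm (p z) + a * norm (q z))"
      by (intro mult_left_mono) auto
    also have "\<dots> = a * (norm v * (norm (p z) + norm (q z)))" by (simp add: algebra_simps)
    also have "\<dots> \<le> a * (3 / 2 * (p z \<bullet> p z + q z \<bullet> q z))"
    proof (intro mult_left_mono a)
      have n: "x * (x + y) \<le> 3 / 2 * (x\<^sup>2 + y\<^sup>2)" for x y :: real
        using sum_squares_bound[of x y] zero_le_power2[of x] zero_le_power2[of y]
        unfolding power2_eq_square distrib_left mult.assoc by linarith
      show "norm v * (norm (p z) + norm (q z)) \<le> 3 / 2 * (p z \<bullet> p z + q z \<bullet> q z)"
        using v n[of "norm (p z)" "norm (q z)"] n[of "norm (q z)" "norm (p z)"]
        by (auto simp: dot_square_norm add.commute)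
    qed
    finally have vY: "\<bar>v \<bullet> Y z\<bar> \<le> a * (3 / 2 * (p z \<bullet> p z + q z \<bullet> q z))"
      using Cauchy_Schwarz_ineq2[of v "Y z"] by linarith
    have "\<bar>\<epsilon> * (v \<bullet> Y z)\<bar> \<le> \<epsilon> * (a * (3 / 2 * (p z \<bullet> p z + q z \<bullet> q z)))"
      using vY \<epsilon> by (simp add: abs_mult)
    also have "\<dots> = 3 / 2 * a * (\<epsilon> * (p z \<bullet> p z + q z \<bullet> q z))" by simp
    also have "\<dots> \<le> 3 / 2 * a * (2 * ?e z)"
      using a by (intro mult_left_mono edens_bounds \<epsilon>) auto
    finally have "\<bar>\<epsilon> * (v \<bullet> Y z)\<bar> \<le> 3 * a * ?e z" by simp
    moreover have "0 \<le> a * ?e z" using a edens_nonneg[OF \<epsilon>] by (intro mult_nonneg_nonneg)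
    ultimately show "\<bar>a * ?e z - \<epsilon> * (v \<bullet> Y z)\<bar> \<le> 4 * a * ?e z" "\<bar>- a * ?e z - \<epsilon> * (v \<bullet> Y z)\<bar> \<le> 4 * a * ?e z"
      by auto
  qed
  have sides: "F (a, t) - F (-a, t) \<le> 4 * a * (?e (a, t) + ?e (-a, t))"
    "G (t, a) - G (t, -a) \<le> 4 * a * (?e (t, a) + ?e (t, -a))" if "t \<in> {-a..a}" for t
  proof -
    have m: "(a, t) \<in> sq a" "(-a, t) \<in> sq a" "(t, a) \<in> sq a" "(t, -a) \<in> sq a"
      using that a by (auto simp: mem_sq)
    show "F (a, t) - F (-a, t) \<le> 4 * a * (?e (a, t) + ?e (-a, t))"
      using pt(1)[OF m(1) disjI1[OF refl]] pt(2)[OF m(2) disjI1[OF refl]]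
      unfolding F_def fst_conv distrib_left by linarith
    show "G (t, a) - G (t, -a) \<le> 4 * a * (?e (t, a) + ?e (t, -a))"
      using pt(1)[OF m(3) disjI2[OF refl]] pt(2)[OF m(4) disjI2[OF refl]]
      unfolding G_def snd_conv distrib_left by linarith
  qed
  have al: "a \<in> {-a..a}" "-a \<in> {-a..a}" "a \<in> {-l..l}" "-a \<in> {-l..l}" "{-a..a} \<subseteq> {-l..l}" using a by auto
  note rows = continuous_on_row[OF has_partialsD(1)[OF hF]] continuous_on_row[OF has_partialsD(1)[OF hG]]
    continuous_on_column[OF has_partialsD(1)[OF hF]] continuous_on_column[OF has_partialsD(1)[OF hG]]
    continuous_on_row[OF ce] continuous_on_column[OF ce]
  have sub_int: "integral {-a..a} (\<lambda>t. ?e (b, t)) \<le> integral {-l..l} (\<lambda>t. ?e (b, t))"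
    "integral {-a..a} (\<lambda>t. ?e (t, b)) \<le> integral {-l..l} (\<lambda>t. ?e (t, b))" if "b \<in> {a, -a}" for b
    using that al by (intro integral_subset_le integrable_continuous_interval rows continuous_on_row[OF cel]
        continuous_on_column[OF cel]; auto simp: edens_nonneg[OF \<epsilon>])+
  have "2 * integral (sq a) (\<lambda>z. V (u z) / \<epsilon>) = integral (sq a) (\<lambda>z. Fx z + Gy z)"
    unfolding integral_mult_right[symmetric] by (intro integral_cong div[symmetric])
  also have "\<dots> = integral {-a..a} (\<lambda>y. F (a, y) - F (-a, y)) + integral {-a..a} (\<lambda>x. G (x, a) - G (x, -a))"
    by (rule divergence_sq[OF hF hG a(1)])
  also have "\<dots> \<le> integral {-a..a} (\<lambda>t. 4 * a * (?e (a, t) + ?e (-a, t))) + integral {-a..a} (\<lambda>t. 4 * a * (?e (t, a) + ?e (t, -a)))"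
    using sides by (intro add_mono integral_le integrable_continuous_interval continuous_intros rows al)
  also have "\<dots> = 4 * a * (integral {-a..a} (\<lambda>t. ?e (a, t)) + integral {-a..a} (\<lambda>t. ?e (-a, t))
     + integral {-a..a} (\<lambda>t. ?e (t, a)) + integral {-a..a} (\<lambda>t. ?e (t, -a)))"
  proof -
    have "integral {-a..a} (\<lambda>t. ?e (a, t) + ?e (-a, t)) = integral {-a..a} (\<lambda>t. ?e (a, t)) + integral {-a..a} (\<lambda>t. ?e (-a, t))"
      "integral {-a..a} (\<lambda>t. ?e (t, a) + ?e (t, -a)) = integral {-a..a} (\<lambda>t. ?e (t, a)) + integral {-a..a} (\<lambda>t. ?e (t, -a))"
      by (intro integral_add integrable_continuous_interval rows al)+
    then show ?thesis unfolding integral_mult_right by (simp only: distrib_left add.assoc)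
  qed
  also have "\<dots> \<le> 4 * a * lines l ?e a"
    unfolding lines_def using a by (intro mult_left_mono add_mono sub_int) auto
  finally show ?thesis by simp
qed

text \<open>The segments are chosen once, with energy of order E and with a small integral of
  \<open>N\<close>. The first property puts \<open>u\<close> s-close to wells on them, where
  \<open>N\<close> dominates the density; the second then improves the energy on the same segments
  by the factor s + \<epsilon>, and Pohozaev carries this into the interior.\<close>

lemma potential_decay:
  "\<exists>C>0. \<exists>\<eta>>0. \<forall>\<epsilon> u p q p1 p2 q2. 0 < \<epsilon> \<longrightarrow> \<epsilon> \<le> 1 \<longrightarrow> solves g \<epsilon> (7 / 10) u p q p1 p2 q2 \<longrightarrow>
     0 < integral (sq (7 / 10)) (edens \<epsilon> u p q) \<longrightarrow> integral (sq (7 / 10)) (edens \<epsilon> u p q) \<le> \<eta> \<longrightarrow>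
     integral (sq (3 / 5)) (\<lambda>z. V (u z) / \<epsilon>)
       \<le> C * (sqrt (integral (sq (7 / 10)) (edens \<epsilon> u p q)) + \<epsilon>) * integral (sq (7 / 10)) (edens \<epsilon> u p q)"
proof -
  let ?l = "13 / 20 :: real"
  obtain Cn where Cn: "0 < Cn" and near: "\<forall>\<epsilon> s u p q p1 p2 q2. 0 < \<epsilon> \<longrightarrow> 0 < s \<longrightarrow> s\<^sup>2 \<le> m / 4 \<longrightarrow> solves g \<epsilon> (7 / 10) u p q p1 p2 q2 \<longrightarrow>
     (\<exists>N. continuous_on (sq ?l) N \<and> (\<forall>z\<in>sq ?l. 0 \<le> N z) \<and>
        (\<forall>\<sigma>\<in>S. \<forall>z\<in>sq ?l. (u z - \<sigma>) \<bullet> (u z - \<sigma>) \<le> s\<^sup>2 \<longrightarrow> edens \<epsilon> u p q z \<le> N z) \<and>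
        integral (sq ?l) N \<le> Cn * (s + \<epsilon>) * integral (sq (7 / 10)) (edens \<epsilon> u p q))"
    using energy_near_wells by (elim exE conjE)
  obtain K \<eta> where K: "0 < K" and \<eta>: "0 < \<eta>" and curve: "\<forall>\<epsilon> \<gamma> \<gamma>' M. 0 < \<epsilon> \<longrightarrow> \<epsilon> \<le> 1 \<longrightarrow> 0 < M \<longrightarrow> M \<le> \<eta> \<longrightarrow>
     (\<forall>t\<in>{-(13/20)..13/20}. (\<gamma> has_vector_derivative \<gamma>' t) (at t)) \<longrightarrow>
     continuous_on {-(13/20)..13/20} \<gamma>' \<longrightarrow>
     integral {-(13/20)..13/20} (\<lambda>t. \<epsilon> * (\<gamma>' t \<bullet> \<gamma>' t) / 2 + V (\<gamma> t) / \<epsilon>) \<le> M \<longrightarrow>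
     (\<exists>\<sigma>\<in>S. \<forall>t\<in>{-(13/20)..13/20}. (\<gamma> t - \<sigma>) \<bullet> (\<gamma> t - \<sigma>) \<le> K * M)"
    using curve_near_well by (elim exE conjE)
  \<comment> \<open>Makes 161 E admissible for \<open>curve_near_well\<close> and the resulting
    \<open>s\<^sup>2\<close> at most \<open>m / 4\<close>.\<close>
  define \<eta>' where "\<eta>' = min (\<eta> / 161) (m / (4 * (K * 161)))"
  define C where "C = 2 * 161 * Cn * (sqrt (K * 161) + 1)"
  show ?thesis
  proof (rule exI[of _ C], rule conjI[rotated], rule exI[of _ \<eta>'], intro conjI allI impI)
    show "0 < C" "0 < \<eta>'" using Cn K \<eta> pos by (auto simp: C_def \<eta>'_def add_pos_pos)
    fix \<epsilon> :: real and u p q p1 p2 q2 :: "real \<times> real \<Rightarrow> 'a"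
    let ?e = "edens \<epsilon> u p q"
    define E where "E = integral (sq (7 / 10)) ?e"
    assume \<epsilon>: "0 < \<epsilon>" "\<epsilon> \<le> 1" and sol: "solves g \<epsilon> (7 / 10) u p q p1 p2 q2"
      and "0 < integral (sq (7 / 10)) ?e" "integral (sq (7 / 10)) ?e \<le> \<eta>'"
    then have E: "0 < E" "E \<le> \<eta>'" by (auto simp: E_def)
    have M: "0 < 161 * E" "161 * E \<le> \<eta>" "K * (161 * E) \<le> m / 4"
    proof -
      have "E \<le> \<eta> / 161" "E \<le> m / (4 * (K * 161))" using E(2) by (auto simp: \<eta>'_def)
      then show "161 * E \<le> \<eta>" "K * (161 * E) \<le> m / 4" using K by (auto simp: field_simps)
    qed (use E in simp)
    define s where "s = sqrt (K * (161 * E))"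
    have s: "0 < s" "s\<^sup>2 = K * (161 * E)" "s\<^sup>2 \<le> m / 4" using M K by (auto simp: s_def)
    define \<mu> where "\<mu> = Cn * (s + \<epsilon>)"
    have \<mu>: "0 < \<mu>" using Cn s \<epsilon> by (simp add: \<mu>_def)
    obtain N where cN: "continuous_on (sq ?l) N" and N0: "\<forall>z\<in>sq ?l. 0 \<le> N z"
      and Ne: "\<forall>\<sigma>\<in>S. \<forall>z\<in>sq ?l. (u z - \<sigma>) \<bullet> (u z - \<sigma>) \<le> s\<^sup>2 \<longrightarrow> ?e z \<le> N z"
      and iN: "integral (sq ?l) N \<le> \<mu> * E"
      using near \<epsilon>(1) s(1,3) sol unfolding \<mu>_def E_def by blast
    have u7: "has_partials (sq (7 / 10)) u p q" using sol by (auto simp: solves_def)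
    have sol_l: "solves g \<epsilon> ?l u p q p1 p2 q2" by (rule solves_mono[OF sol]) simp
    then have u: "has_partials (sq ?l) u p q" by (auto simp: solves_def)
    have ce7: "continuous_on (sq (7 / 10)) ?e" by (rule continuous_on_edens) (rule has_partialsD[OF u7])+
    have ce: "continuous_on (sq ?l) ?e" by (rule continuous_on_edens) (rule has_partialsD[OF u])+
    have ie: "integral (sq ?l) ?e \<le> E" unfolding E_def
      by (rule integral_sq_subset[OF _ ce7]) (auto simp: edens_nonneg[OF \<epsilon>(1)])
    \<comment> \<open>Weighting the energy by \<mu> puts both terms on the scale \<mu> E, so a
      single average bounds both. The mean over an interval of length 1/20 is at most 8 * 20 = 160
      times \<mu> E; 161 makes the inequality strict.\<close>
    define Q where "Q a = \<mu> * lines ?l ?e a + lines ?l N a" for a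
    have cL: "continuous_on {3/5..?l} (lines ?l ?e)" "continuous_on {3/5..?l} (lines ?l N)"
      by (intro continuous_on_lines ce cN; simp)+
    have cQ: "continuous_on {3/5..?l} Q" unfolding Q_def by (intro continuous_intros cL)
    have "integral {3/5..?l} Q = \<mu> * integral {3/5..?l} (lines ?l ?e) + integral {3/5..?l} (lines ?l N)"
      unfolding Q_def by (subst integral_add) (auto intro!: integrable_continuous_interval continuous_intros cL)
    also have "\<dots> \<le> \<mu> * (4 * integral (sq ?l) ?e) + 4 * integral (sq ?l) N"
      using \<mu> N0 by (intro add_mono mult_left_mono integral_lines_le ce cN) (auto simp: edens_nonneg[OF \<epsilon>(1)])
    also have "\<dots> \<le> \<mu> * (4 * E) + 4 * (\<mu> * E)" using ie iN \<mu> by (intro add_mono mult_left_mono) auto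
    also have "\<dots> < (?l - 3 / 5) * (161 * \<mu> * E)" using \<mu> E by simp
    finally have "\<exists>a\<in>{3/5..?l}. Q a < 161 * \<mu> * E"
      by (rule ex_less_on_interval[OF cQ]) simp
    then obtain a where a: "a \<in> {3/5..?l}" "Q a < 161 * \<mu> * E" by blast
    have a0: "a \<in> {0..?l}" "a \<in> {-?l..?l}" "-a \<in> {-?l..?l}" using a by auto
    have pe: "0 \<le> integral {-?l..?l} (\<lambda>t. f (b, t))" "0 \<le> integral {-?l..?l} (\<lambda>t. f (t, b))"
      if "continuous_on (sq ?l) f" "\<And>z. z \<in> sq ?l \<Longrightarrow> 0 \<le> f z" "b \<in> {-?l..?l}" for f :: "real \<times> real \<Rightarrow> real" and b
      using that by (intro Henstock_Kurzweil_Integration.integral_nonneg integrable_continuous_interval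
          continuous_on_column[OF that(1)] continuous_on_row[OF that(1)]; simp add: mem_sq)+
    have L0: "0 \<le> lines ?l ?e a" "0 \<le> lines ?l N a"
      unfolding lines_def using N0 by (intro add_nonneg_nonneg pe ce cN a0; simp add: edens_nonneg[OF \<epsilon>(1)])+
    have "\<mu> * lines ?l ?e a \<le> \<mu> * (161 * E)" using a(2) L0 unfolding Q_def by (simp add: algebra_simps)
    then have Le: "lines ?l ?e a \<le> 161 * E" using \<mu> by simp
    have "0 \<le> \<mu> * lines ?l ?e a" using \<mu> L0 by simp
    then have LN: "lines ?l N a \<le> 161 * \<mu> * E" using a(2) unfolding Q_def by linarith
    \<comment> \<open>Each segment may be close to a different well; \<open>N\<close> covers them
      all, so the wells need not be matched at the corners.\<close>
    have side: "\<forall>t\<in>{-?l..?l}. ?e (\<alpha> t) \<le> N (\<alpha> t)"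
      if \<alpha>: "\<And>t. t \<in> {-?l..?l} \<Longrightarrow> \<alpha> t \<in> sq ?l" and v: "\<And>z. v z = p z \<or> v z = q z"
        and d: "\<And>t. t \<in> {-?l..?l} \<Longrightarrow> ((\<lambda>t. u (\<alpha> t)) has_vector_derivative v (\<alpha> t)) (at t)"
        and c: "continuous_on {-?l..?l} (\<lambda>t. u (\<alpha> t))" "continuous_on {-?l..?l} (\<lambda>t. v (\<alpha> t))"
           "continuous_on {-?l..?l} (\<lambda>t. ?e (\<alpha> t))"
        and i: "integral {-?l..?l} (\<lambda>t. ?e (\<alpha> t)) \<le> lines ?l ?e a" for \<alpha> v
    proof -
      have "integral {-?l..?l} (\<lambda>t. \<epsilon> * (v (\<alpha> t) \<bullet> v (\<alpha> t)) / 2 + V (u (\<alpha> t)) / \<epsilon>) \<le> integral {-?l..?l} (\<lambda>t. ?e (\<alpha> t))"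
      proof (intro integral_le integrable_continuous_interval continuous_intros c V_comp_cont)
        fix t assume "t \<in> {-?l..?l}"
        have "\<epsilon> * (v (\<alpha> t) \<bullet> v (\<alpha> t)) \<le> \<epsilon> * (p (\<alpha> t) \<bullet> p (\<alpha> t) + q (\<alpha> t) \<bullet> q (\<alpha> t))"
          using v[of "\<alpha> t"] \<epsilon> by (intro mult_left_mono) auto
        then show "\<epsilon> * (v (\<alpha> t) \<bullet> v (\<alpha> t)) / 2 + V (u (\<alpha> t)) / \<epsilon> \<le> ?e (\<alpha> t)" by (simp add: edens_def)
      qed (use \<epsilon> in auto)
      also have "\<dots> \<le> 161 * E" using i Le by linarith
      finally have "\<exists>\<sigma>\<in>S. \<forall>t\<in>{-?l..?l}. (u (\<alpha> t) - \<sigma>) \<bullet> (u (\<alpha> t) - \<sigma>) \<le> K * (161 * E)"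
        using curve[rule_format, OF \<epsilon> M(1,2), of "\<lambda>t. u (\<alpha> t)" "\<lambda>t. v (\<alpha> t)"] d c(2) by auto
      then show ?thesis using Ne \<alpha> unfolding s(2) by blast
    qed
    note cols = continuous_on_column[OF has_partialsD(1)[OF u]] continuous_on_column[OF has_partialsD(3)[OF u]]
      continuous_on_column[OF ce] continuous_on_row[OF has_partialsD(1)[OF u]] continuous_on_row[OF has_partialsD(2)[OF u]]
      continuous_on_row[OF ce]
    note comp = lines_component_le[OF ce _ a0(1)]
    have "\<forall>t\<in>{-?l..?l}. ?e (a, t) \<le> N (a, t)"
      using a0 by (intro side[of _ q] cols comp has_partialsD(5)[OF u]) (auto simp: mem_sq edens_nonneg[OF \<epsilon>(1)])
    moreover have "\<forall>t\<in>{-?l..?l}. ?e (-a, t) \<le> N (-a, t)"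
      using a0 by (intro side[of _ q] cols comp has_partialsD(5)[OF u]) (auto simp: mem_sq edens_nonneg[OF \<epsilon>(1)])
    moreover have "\<forall>t\<in>{-?l..?l}. ?e (t, a) \<le> N (t, a)"
      using a0 by (intro side[of _ p] cols comp has_partialsD(4)[OF u]) (auto simp: mem_sq edens_nonneg[OF \<epsilon>(1)])
    moreover have "\<forall>t\<in>{-?l..?l}. ?e (t, -a) \<le> N (t, -a)"
      using a0 by (intro side[of _ p] cols comp has_partialsD(4)[OF u]) (auto simp: mem_sq edens_nonneg[OF \<epsilon>(1)])
    ultimately have "lines ?l ?e a \<le> lines ?l N a"
      by (intro lines_mono ce cN a0) auto
    then have LE: "lines ?l ?e a \<le> 161 * \<mu> * E" using LN by linarith
    have sub: "sq a \<subseteq> sq ?l" using a by (intro sq_mono) auto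
    have cV: "continuous_on (sq a) (\<lambda>z. V (u z) / \<epsilon>)"
      using \<epsilon> by (intro continuous_intros V_comp_cont continuous_on_subset[OF has_partialsD(1)[OF u] sub]) auto
    have "integral (sq (3 / 5)) (\<lambda>z. V (u z) / \<epsilon>) \<le> integral (sq a) (\<lambda>z. V (u z) / \<epsilon>)"
      using a \<epsilon> V_nonneg by (intro integral_sq_subset cV) auto
    also have "\<dots> \<le> 2 * a * lines ?l ?e a"
      using a by (intro pohozaev_sq[OF sol_l \<epsilon>(1)]) auto
    also have "\<dots> \<le> 2 * 1 * (161 * \<mu> * E)" using a LE L0 by (intro mult_mono) auto
    also have "\<mu> \<le> Cn * ((sqrt (K * 161) + 1) * (sqrt E + \<epsilon>))"
    proof -
      have "s = sqrt (K * 161) * sqrt E" by (simp add: s_def real_sqrt_mult)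
      then have "s + \<epsilon> \<le> (sqrt (K * 161) + 1) * (sqrt E + \<epsilon>)"
        using K E \<epsilon> by (simp add: algebra_simps)
      then show ?thesis unfolding \<mu>_def using Cn by (intro mult_left_mono) auto
    qed
    finally show "integral (sq (3 / 5)) (\<lambda>z. V (u z) / \<epsilon>) \<le> C * (sqrt (integral (sq (7 / 10)) ?e) + \<epsilon>) * integral (sq (7 / 10)) ?e"
      using E unfolding C_def E_def[symmetric] by (simp add: algebra_simps)
  qed
qed

end

section \<open>Averaging over small squares\<close>

lemma has_partials_affine:
  assumes f: "has_partials S f f1 f2" and T: "\<And>z. z \<in> T \<Longrightarrow> c + \<epsilon> *\<^sub>R z \<in> S"
  shows "has_partials T (\<lambda>z. f (c + \<epsilon> *\<^sub>R z)) (\<lambda>z. \<epsilon> *\<^sub>R f1 (c + \<epsilon> *\<^sub>R z)) (\<lambda>z. \<epsilon> *\<^sub>R f2 (c + \<epsilon> *\<^sub>R z))"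
proof -
  note d = has_partialsD[OF f]
  obtain a b where c: "c = (a, b)" by (cases c)
  have ch: "continuous_on T (\<lambda>z. h (c + \<epsilon> *\<^sub>R z))" if "continuous_on S h" for h :: "real \<times> real \<Rightarrow> 'a"
    by (rule continuous_on_compose2[OF that]) (use T in \<open>auto intro!: continuous_intros\<close>)
  have aff: "((\<lambda>t. a + \<epsilon> * t) has_vector_derivative \<epsilon>) (at x)" for a x
    by (auto intro!: derivative_eq_intros simp: has_real_derivative_iff_has_vector_derivative[symmetric])
  have "((\<lambda>t. f (c + \<epsilon> *\<^sub>R (t, y))) has_vector_derivative \<epsilon> *\<^sub>R f1 (c + \<epsilon> *\<^sub>R (x, y))) (at x)"
     "((\<lambda>t. f (c + \<epsilon> *\<^sub>R (x, t))) has_vector_derivative \<epsilon> *\<^sub>R f2 (c + \<epsilon> *\<^sub>R (x, y))) (at y)"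
    if "(x, y) \<in> T" for x y
    using d(4,5) T[OF that] vector_diff_chain_at[OF aff[of a x], of "\<lambda>s. f (s, b + \<epsilon> * y)"]
      vector_diff_chain_at[OF aff[of b y], of "\<lambda>s. f (a + \<epsilon> * x, s)"]
    by (auto simp: c o_def)
  then show ?thesis
    unfolding has_partials_def using d(1-3) by (auto intro!: continuous_intros ch)
qed

text \<open>The translated square moves by at most \<open>h\<close> in each coordinate: it stays
  inside \<open>sq r\<close> and still covers \<open>sq b\<close>.\<close>

lemma
  fixes f :: "real \<times> real \<Rightarrow> real"
  assumes f: "continuous_on (sq r) f" and f0: "\<And>z. z \<in> sq r \<Longrightarrow> 0 \<le> f z"
    and v: "v \<in> sq h" and a: "a + h \<le> r"
  shows integral_sq_shift_le: "integral (sq a) (\<lambda>c. f (c + v)) \<le> integral (sq r) f"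
    and integral_sq_shift_ge: "b + h \<le> a \<Longrightarrow> integral (sq b) f \<le> integral (sq a) (\<lambda>c. f (c + v))"
proof -
  obtain v1 v2 where v12: "v = (v1, v2)" by (cases v)
  have vh: "\<bar>v1\<bar> \<le> h" "\<bar>v2\<bar> \<le> h" using v by (auto simp: v12 mem_sq)
  let ?B = "cbox ((-a, -a) + v) ((a, a) + v)"
  have eq: "integral (sq a) (\<lambda>c. f (c + v)) = integral ?B f"
    using integral_shift_cbox_plus[of "(-a, -a)" "(a, a)" f v] by (simp add: sq_def o_def add.commute)
  have sub: "?B \<subseteq> sq r" using vh a by (auto simp: v12 mem_sq)
  have iB: "f integrable_on ?B" by (intro integrable_continuous continuous_on_subset[OF f sub])
  show "integral (sq a) (\<lambda>c. f (c + v)) \<le> integral (sq r) f"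
    unfolding eq using sub f0 by (intro integral_subset_le iB integrable_sq f) auto
  assume b: "b + h \<le> a"
  have sub': "sq b \<subseteq> ?B" using vh b by (auto simp: v12 mem_sq_abs)
  show "integral (sq b) f \<le> integral (sq a) (\<lambda>c. f (c + v))"
    unfolding eq using sub sub' f0
    by (intro integral_subset_le iB integrable_sq continuous_on_subset[OF f]) auto
qed

lemma integral_sq_swap:
  fixes F :: "real \<times> real \<Rightarrow> real \<times> real \<Rightarrow> real"
  assumes "continuous_on (sq a \<times> sq b) (\<lambda>(c, z). F c z)"
  shows "integral (sq a) (\<lambda>c. integral (sq b) (F c)) = integral (sq b) (\<lambda>z. integral (sq a) (\<lambda>c. F c z))"
    "continuous_on (sq a) (\<lambda>c. integral (sq b) (F c))" "continuous_on (sq b) (\<lambda>z. integral (sq a) (\<lambda>c. F c z))"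
proof -
  show "integral (sq a) (\<lambda>c. integral (sq b) (F c)) = integral (sq b) (\<lambda>z. integral (sq a) (\<lambda>c. F c z))"
    unfolding sq_def using assms
    by (intro integral_swap_continuous) (simp add: sq_def cbox_Pair_eq)
  show "continuous_on (sq a) (\<lambda>c. integral (sq b) (F c))"
    using integral_continuous_on_param[of "sq a" "(-b, -b)" "(b, b)" F] assms by (simp add: sq_def)
  have "continuous_on (sq b \<times> sq a) (\<lambda>(z, c). F c z)"
    using continuous_on_compose2[OF assms, of "sq b \<times> sq a" "\<lambda>x. (snd x, fst x)"]
    by (simp add: case_prod_unfold continuous_on_Pair continuous_on_fst continuous_on_snd image_subset_iff)
  then show "continuous_on (sq b) (\<lambda>z. integral (sq a) (\<lambda>c. F c z))"
    using integral_continuous_on_param[of "sq b" "(-a, -a)" "(a, a)" "\<lambda>z c. F c z"] by (simp add: sq_def)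
qed

context multiwell
begin

text \<open>The scale invariant local bound is integrated over the centres of the squares of size \<open>\<epsilon>\<close>.\<close>

lemma gradient_le_potential:
  "\<exists>C>0. \<forall>\<epsilon> u p q p1 p2 q2. 0 < \<epsilon> \<longrightarrow> \<epsilon> \<le> 1 / 100 \<longrightarrow> solves g \<epsilon> (3 / 5) u p q p1 p2 q2 \<longrightarrow>
     \<epsilon>\<^sup>2 * integral (sq (9 / 16)) (\<lambda>z. p z \<bullet> p z + q z \<bullet> q z) \<le> C * integral (sq (3 / 5)) (\<lambda>z. V (u z))"
proof -
  obtain C where C: "0 < C" and loc: "\<forall>w p q p1 p2 q2. solves g 1 2 w p q p1 p2 q2 \<longrightarrow>
     integral (sq 1) (\<lambda>z. p z \<bullet> p z + q z \<bullet> q z) \<le> C * integral (sq 2) (\<lambda>z. V (w z))"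
    using local_gradient_bound by (elim exE conjE)
  show ?thesis
  proof (intro exI[of _ "4 * C"] conjI allI impI)
    show "0 < 4 * C" using C by simp
    fix \<epsilon> :: real and u p q p1 p2 q2 :: "real \<times> real \<Rightarrow> 'a"
    assume \<epsilon>: "0 < \<epsilon>" "\<epsilon> \<le> 1 / 100" and sol: "solves g \<epsilon> (3 / 5) u p q p1 p2 q2"
    \<comment> \<open>The set of centres: 29/50 + 1/50 = 3/5 keeps the squares of half-side
      2\<epsilon> inside the domain, and 9/16 + 1/100 is below 29/50, so shifts by the inner squares
      still cover \<open>sq (9 / 16)\<close>.\<close>
    let ?A = "sq (29 / 50)"
    have u: "has_partials (sq (3 / 5)) u p q" and p: "has_partials (sq (3 / 5)) p p1 p2"
      and q: "has_partials (sq (3 / 5)) q p2 q2" and eq: "\<forall>z\<in>sq (3 / 5). \<epsilon>\<^sup>2 *\<^sub>R (p1 z + q2 z) = g (u z)"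
      using sol by (auto simp: solves_def)
    define P where "P z = p z \<bullet> p z + q z \<bullet> q z" for z
    define W where "W z = V (u z)" for z
    have cP: "continuous_on (sq (3 / 5)) P" unfolding P_def by (intro continuous_intros has_partialsD[OF u])
    have cW: "continuous_on (sq (3 / 5)) W" unfolding W_def by (intro V_comp_cont has_partialsD[OF u])
    have P0: "0 \<le> P z" and W0: "0 \<le> W z" for z by (auto simp: P_def W_def V_nonneg add_nonneg_nonneg)
    have scaled: "\<epsilon> *\<^sub>R z \<in> sq (1 / 50)" if "z \<in> sq 2" for z
    proof -
      have "\<epsilon> * \<bar>x\<bar> \<le> 1 / 100 * 2" if "\<bar>x\<bar> \<le> 2" for x
        using that \<epsilon> by (intro mult_mono) auto
      then show ?thesis using that \<epsilon> by (auto simp: mem_sq_abs abs_mult)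
    qed
    have scaled1: "\<epsilon> *\<^sub>R z \<in> sq (1 / 100)" if "z \<in> sq 1" for z
    proof -
      have "\<epsilon> * \<bar>x\<bar> \<le> 1 / 100 * 1" if "\<bar>x\<bar> \<le> 1" for x
        using that \<epsilon> by (intro mult_mono) auto
      then show ?thesis using that \<epsilon> by (auto simp: mem_sq_abs abs_mult)
    qed
    have inside: "c + \<epsilon> *\<^sub>R z \<in> sq (3 / 5)" if "c \<in> ?A" "z \<in> sq 2" for c z
      using that(1) scaled[OF that(2)] abs_triangle_ineq[of "fst c" "fst (\<epsilon> *\<^sub>R z)"]
        abs_triangle_ineq[of "snd c" "snd (\<epsilon> *\<^sub>R z)"]
      unfolding mem_sq_abs fst_add snd_add by linarith
    have each: "integral (sq 1) (\<lambda>z. \<epsilon>\<^sup>2 * P (c + \<epsilon> *\<^sub>R z)) \<le> C * integral (sq 2) (\<lambda>z. W (c + \<epsilon> *\<^sub>R z))"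
      if c: "c \<in> ?A" for c
    proof -
      note h = has_partials_affine[OF _ inside[OF c]]
      have hp: "has_partials (sq 2) (\<lambda>z. \<epsilon> *\<^sub>R p (c + \<epsilon> *\<^sub>R z)) (\<lambda>z. \<epsilon> *\<^sub>R \<epsilon> *\<^sub>R p1 (c + \<epsilon> *\<^sub>R z)) (\<lambda>z. \<epsilon> *\<^sub>R \<epsilon> *\<^sub>R p2 (c + \<epsilon> *\<^sub>R z))"
        using has_partials_scaleR[OF has_partials_const[of _ \<epsilon>] h[OF p]] by simp
      have hq: "has_partials (sq 2) (\<lambda>z. \<epsilon> *\<^sub>R q (c + \<epsilon> *\<^sub>R z)) (\<lambda>z. \<epsilon> *\<^sub>R \<epsilon> *\<^sub>R p2 (c + \<epsilon> *\<^sub>R z)) (\<lambda>z. \<epsilon> *\<^sub>R \<epsilon> *\<^sub>R q2 (c + \<epsilon> *\<^sub>R z))"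
        using has_partials_scaleR[OF has_partials_const[of _ \<epsilon>] h[OF q]] by simp
      have "\<epsilon> *\<^sub>R \<epsilon> *\<^sub>R p1 (c + \<epsilon> *\<^sub>R z) + \<epsilon> *\<^sub>R \<epsilon> *\<^sub>R q2 (c + \<epsilon> *\<^sub>R z) = g (u (c + \<epsilon> *\<^sub>R z))" if "z \<in> sq 2" for z
        using eq inside[OF c that] by (simp add: power2_eq_square scaleR_add_right)
      then have "solves g 1 2 (\<lambda>z. u (c + \<epsilon> *\<^sub>R z)) (\<lambda>z. \<epsilon> *\<^sub>R p (c + \<epsilon> *\<^sub>R z)) (\<lambda>z. \<epsilon> *\<^sub>R q (c + \<epsilon> *\<^sub>R z))
         (\<lambda>z. \<epsilon> *\<^sub>R \<epsilon> *\<^sub>R p1 (c + \<epsilon> *\<^sub>R z)) (\<lambda>z. \<epsilon> *\<^sub>R \<epsilon> *\<^sub>R p2 (c + \<epsilon> *\<^sub>R z)) (\<lambda>z. \<epsilon> *\<^sub>R \<epsilon> *\<^sub>R q2 (c + \<epsilon> *\<^sub>R z))"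
        unfolding solves_def using h[OF u] hp hq by simp
      from loc[rule_format, OF this] show ?thesis
        by (simp add: P_def W_def power2_eq_square distrib_left mult.assoc)
    qed
    have cF: "continuous_on (?A \<times> sq b) (\<lambda>(c, z). f (c + \<epsilon> *\<^sub>R z))"
      if "continuous_on (sq (3 / 5)) f" "b \<le> 2" for f :: "real \<times> real \<Rightarrow> real" and b
      unfolding case_prod_unfold using inside sq_mono[OF that(2)]
      by (intro continuous_on_compose2[OF that(1)] continuous_intros) fastforce
    have cPF: "continuous_on (?A \<times> sq 1) (\<lambda>(c, z). \<epsilon>\<^sup>2 * P (c + \<epsilon> *\<^sub>R z))"
      by (rule cF) (auto intro!: continuous_intros cP)
    have cWF: "continuous_on (?A \<times> sq 2) (\<lambda>(c, z). W (c + \<epsilon> *\<^sub>R z))"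
      by (rule cF) (auto intro!: cW)
    \<comment> \<open>The order of integration is exchanged: for a fixed offset \<open>z\<close> the
      integral over the centres is a translated integral. The constant \<open>4 * C\<close> is
      \<open>C\<close> times the ratio 16/4 of the areas of \<open>sq 2\<close> and
      \<open>sq 1\<close>.\<close>
    have "4 * (\<epsilon>\<^sup>2 * integral (sq (9 / 16)) P) = integral (sq 1) (\<lambda>z. integral (sq (9 / 16)) (\<lambda>z. \<epsilon>\<^sup>2 * P z))"
      by (simp add: integral_sq_const)
    also have "\<dots> \<le> integral (sq 1) (\<lambda>z. integral ?A (\<lambda>c. \<epsilon>\<^sup>2 * P (c + \<epsilon> *\<^sub>R z)))"
    proof (intro integral_sq_mono continuous_intros integral_sq_swap(3) cPF)
      fix z :: "real \<times> real" assume "z \<in> sq 1"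
      from scaled1[OF this] show "integral (sq (9 / 16)) (\<lambda>z. \<epsilon>\<^sup>2 * P z) \<le> integral ?A (\<lambda>c. \<epsilon>\<^sup>2 * P (c + \<epsilon> *\<^sub>R z))"
        by (intro integral_sq_shift_ge[of "3 / 5" "\<lambda>z. \<epsilon>\<^sup>2 * P z" "\<epsilon> *\<^sub>R z" "1 / 100"])
          (auto intro!: continuous_intros cP simp: P0)
    qed
    also have "\<dots> = integral ?A (\<lambda>c. integral (sq 1) (\<lambda>z. \<epsilon>\<^sup>2 * P (c + \<epsilon> *\<^sub>R z)))"
      by (rule integral_sq_swap(1)[OF cPF, symmetric])
    also have "\<dots> \<le> integral ?A (\<lambda>c. C * integral (sq 2) (\<lambda>z. W (c + \<epsilon> *\<^sub>R z)))"
      by (intro integral_sq_mono each continuous_intros integral_sq_swap(2) cPF cWF)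
    also have "\<dots> = C * integral (sq 2) (\<lambda>z. integral ?A (\<lambda>c. W (c + \<epsilon> *\<^sub>R z)))"
      using integral_sq_swap(1)[OF cWF] by simp
    also have "\<dots> \<le> C * integral (sq 2) (\<lambda>z. integral (sq (3 / 5)) W)"
    proof (intro mult_left_mono integral_sq_mono continuous_intros integral_sq_swap(3) cWF)
      fix z :: "real \<times> real" assume "z \<in> sq 2"
      from scaled[OF this] show "integral ?A (\<lambda>c. W (c + \<epsilon> *\<^sub>R z)) \<le> integral (sq (3 / 5)) W"
        by (intro integral_sq_shift_le[of "3 / 5" W "\<epsilon> *\<^sub>R z" "1 / 50"] cW) (auto simp: W0)
    qed (use C in simp)
    also have "\<dots> = 16 * (C * integral (sq (3 / 5)) W)" by (simp add: integral_sq_const)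
    finally show "\<epsilon>\<^sup>2 * integral (sq (9 / 16)) (\<lambda>z. p z \<bullet> p z + q z \<bullet> q z) \<le> 4 * C * integral (sq (3 / 5)) (\<lambda>z. V (u z))"
      by (simp add: P_def[abs_def] W_def[abs_def])
  qed
qed

text \<open>For small \<open>E\<close> and \<epsilon> the gradient is bounded by the potential on
  \<open>sq (3 / 5)\<close>, and the potential by \<open>potential_decay\<close>. Otherwise the
  factor \<open>C * (sqrt E + \<epsilon>)\<close> is at least 1, which is the purpose of the
  summands 100 and \<open>1 / sqrt \<eta>\<close> of \<open>C\<close>.\<close>

lemma interior_energy_decay:
  "\<exists>C>0. \<forall>\<epsilon> u p q p1 p2 q2. 0 < \<epsilon> \<longrightarrow> \<epsilon> \<le> 1 \<longrightarrow> solves g \<epsilon> (7 / 10) u p q p1 p2 q2 \<longrightarrow>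
     integral (sq (9 / 16)) (edens \<epsilon> u p q)
       \<le> C * (sqrt (integral (sq (7 / 10)) (edens \<epsilon> u p q)) + \<epsilon>) * integral (sq (7 / 10)) (edens \<epsilon> u p q)"
proof -
  obtain C1 where C1: "0 < C1" and grad: "\<forall>\<epsilon> u p q p1 p2 q2. 0 < \<epsilon> \<longrightarrow> \<epsilon> \<le> 1 / 100 \<longrightarrow> solves g \<epsilon> (3 / 5) u p q p1 p2 q2 \<longrightarrow>
     \<epsilon>\<^sup>2 * integral (sq (9 / 16)) (\<lambda>z. p z \<bullet> p z + q z \<bullet> q z) \<le> C1 * integral (sq (3 / 5)) (\<lambda>z. V (u z))"
    using gradient_le_potential by (elim exE conjE)
  obtain C2 \<eta> where C2: "0 < C2" and \<eta>: "0 < \<eta>" and pot: "\<forall>\<epsilon> u p q p1 p2 q2. 0 < \<epsilon> \<longrightarrow> \<epsilon> \<le> 1 \<longrightarrow> solves g \<epsilon> (7 / 10) u p q p1 p2 q2 \<longrightarrow>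
     0 < integral (sq (7 / 10)) (edens \<epsilon> u p q) \<longrightarrow> integral (sq (7 / 10)) (edens \<epsilon> u p q) \<le> \<eta> \<longrightarrow>
     integral (sq (3 / 5)) (\<lambda>z. V (u z) / \<epsilon>)
       \<le> C2 * (sqrt (integral (sq (7 / 10)) (edens \<epsilon> u p q)) + \<epsilon>) * integral (sq (7 / 10)) (edens \<epsilon> u p q)"
    using potential_decay by (elim exE conjE)
  define C where "C = (C1 + 1) * C2 + 100 + 1 / sqrt \<eta>"
  have Cb: "(C1 + 1) * C2 \<le> C" "100 \<le> C" "1 / sqrt \<eta> \<le> C" "0 < C"
    using C1 C2 \<eta> by (auto simp: C_def add_pos_pos)
  show ?thesis
  proof (intro exI[of _ C] conjI allI impI)
    show "0 < C" by fact
    fix \<epsilon> :: real and u p q p1 p2 q2 :: "real \<times> real \<Rightarrow> 'a"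
    let ?e = "edens \<epsilon> u p q"
    define E where "E = integral (sq (7 / 10)) ?e"
    assume \<epsilon>: "0 < \<epsilon>" "\<epsilon> \<le> 1" and sol: "solves g \<epsilon> (7 / 10) u p q p1 p2 q2"
    have u: "has_partials (sq (7 / 10)) u p q" using sol by (auto simp: solves_def)
    have ce: "continuous_on (sq (7 / 10)) ?e" by (rule continuous_on_edens) (rule has_partialsD[OF u])+
    have E0: "0 \<le> E" unfolding E_def by (intro integral_sq_nonneg ce edens_nonneg \<epsilon>)
    have triv: "integral (sq (9 / 16)) ?e \<le> E"
      unfolding E_def by (intro integral_sq_subset ce edens_nonneg \<epsilon>) simp
    have weak: "integral (sq (9 / 16)) ?e \<le> C * (sqrt E + \<epsilon>) * E" if "1 \<le> C * (sqrt E + \<epsilon>)"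
      using triv mult_right_mono[OF that E0] by simp
    consider "E = 0" | "1 / 100 < \<epsilon>" | "\<eta> < E" | "0 < E" "E \<le> \<eta>" "\<epsilon> \<le> 1 / 100" using E0 by linarith
    then have "integral (sq (9 / 16)) ?e \<le> C * (sqrt E + \<epsilon>) * E"
    proof cases
      case 1
      then show ?thesis using triv by simp
    next
      case 2
      have "1 / 100 \<le> sqrt E + \<epsilon>" using 2 real_sqrt_ge_zero[OF E0] by linarith
      then have "100 * (1 / 100) \<le> C * (sqrt E + \<epsilon>)"
        by (rule mult_mono[OF Cb(2)]) (use Cb in auto)
      then show ?thesis by (intro weak) simp
    next
      case 3
      have "sqrt \<eta> \<le> sqrt E + \<epsilon>" using real_sqrt_less_mono[OF 3] \<epsilon> by linarith
      then have "1 / sqrt \<eta> * sqrt \<eta> \<le> C * (sqrt E + \<epsilon>)"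
        by (rule mult_mono[OF Cb(3)]) (use Cb \<eta> in auto)
      then show ?thesis using \<eta> by (intro weak) simp
    next
      case 4
      have sol': "solves g \<epsilon> (3 / 5) u p q p1 p2 q2" by (rule solves_mono[OF sol]) simp
      have u': "has_partials (sq (3 / 5)) u p q" using sol' by (auto simp: solves_def)
      have sub: "sq (9 / 16) \<subseteq> sq (3 / 5)" by (rule sq_mono) simp
      have cP: "continuous_on (sq (9 / 16)) (\<lambda>z. p z \<bullet> p z + q z \<bullet> q z)"
        by (intro continuous_intros continuous_on_subset[OF has_partialsD(2)[OF u'] sub] continuous_on_subset[OF has_partialsD(3)[OF u'] sub])
      have cV: "continuous_on (sq (3 / 5)) (\<lambda>z. V (u z) / \<epsilon>)"
        using \<epsilon> by (intro continuous_intros V_comp_cont has_partialsD(1)[OF u']) auto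
      have "integral (sq (9 / 16)) ?e = integral (sq (9 / 16)) (\<lambda>z. \<epsilon> / 2 * (p z \<bullet> p z + q z \<bullet> q z)) + integral (sq (9 / 16)) (\<lambda>z. V (u z) / \<epsilon>)"
        unfolding edens_def[abs_def] times_divide_eq_right times_divide_eq_left
        by (intro integral_add integrable_sq continuous_intros cP continuous_on_subset[OF cV sub]) simp
      also have "integral (sq (9 / 16)) (\<lambda>z. \<epsilon> / 2 * (p z \<bullet> p z + q z \<bullet> q z)) = \<epsilon> / 2 * integral (sq (9 / 16)) (\<lambda>z. p z \<bullet> p z + q z \<bullet> q z)"
        by (rule integral_mult_right)
      also have "\<epsilon> / 2 * integral (sq (9 / 16)) (\<lambda>z. p z \<bullet> p z + q z \<bullet> q z) \<le> C1 * integral (sq (3 / 5)) (\<lambda>z. V (u z) / \<epsilon>)"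
      proof -
        let ?P = "integral (sq (9 / 16)) (\<lambda>z. p z \<bullet> p z + q z \<bullet> q z)"
        have "0 \<le> ?P" by (intro integral_sq_nonneg cP) simp
        then have "\<epsilon> / 2 * ?P \<le> \<epsilon> * ?P" using \<epsilon> by (intro mult_right_mono) auto
        also have "\<dots> = (\<epsilon>\<^sup>2 * ?P) / \<epsilon>" using \<epsilon> by (simp add: power2_eq_square)
        also have "\<dots> \<le> (C1 * integral (sq (3 / 5)) (\<lambda>z. V (u z))) / \<epsilon>"
          using grad[rule_format, OF \<epsilon>(1) 4(3) sol'] by (rule divide_right_mono) (use \<epsilon> in simp)
        also have "\<dots> = C1 * integral (sq (3 / 5)) (\<lambda>z. V (u z) / \<epsilon>)" by simp
        finally show ?thesis .
      qed
      also have "integral (sq (9 / 16)) (\<lambda>z. V (u z) / \<epsilon>) \<le> integral (sq (3 / 5)) (\<lambda>z. V (u z) / \<epsilon>)"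
        using \<epsilon> V_nonneg by (intro integral_sq_subset cV) auto
      finally have "integral (sq (9 / 16)) ?e
          \<le> C1 * integral (sq (3 / 5)) (\<lambda>z. V (u z) / \<epsilon>) + integral (sq (3 / 5)) (\<lambda>z. V (u z) / \<epsilon>)"
        by simp
      then have "integral (sq (9 / 16)) ?e \<le> (C1 + 1) * integral (sq (3 / 5)) (\<lambda>z. V (u z) / \<epsilon>)"
        unfolding distrib_right mult_1 .
      also have "\<dots> \<le> (C1 + 1) * (C2 * (sqrt E + \<epsilon>) * E)"
        unfolding E_def
        by (rule mult_left_mono[OF pot[rule_format, OF \<epsilon> sol 4(1,2)[unfolded E_def]]]) (use C1 in simp)
      also have "\<dots> = ((C1 + 1) * C2) * ((sqrt E + \<epsilon>) * E)" by simp
      also have "\<dots> \<le> C * ((sqrt E + \<epsilon>) * E)"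
        using Cb E0 \<epsilon> by (intro mult_right_mono) auto
      finally show ?thesis by (simp add: mult.assoc)
    qed
    then show "integral (sq (9 / 16)) ?e \<le> C * (sqrt (integral (sq (7 / 10)) ?e) + \<epsilon>) * integral (sq (7 / 10)) ?e"
      unfolding E_def .
  qed
qed

end

section \<open>Nondegenerate wells\<close>

text \<open>\<open>gradient\<close> is a definite description, so existence and uniqueness of the
  representing vector must be shown; expansion in the basis gives it explicitly.\<close>

lemma gradient_works:
  fixes f :: "'a::euclidean_space \<Rightarrow> real"
  assumes "f differentiable (at x)"
  shows "(f has_derivative (\<lambda>h. gradient f x \<bullet> h)) (at x)"
    and "gradient f x = (\<Sum>b\<in>Basis. frechet_derivative f (at x) b *\<^sub>R b)"
proof -
  define D where "D = (\<Sum>b\<in>Basis. frechet_derivative f (at x) b *\<^sub>R b)"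
  have d: "(f has_derivative frechet_derivative f (at x)) (at x)"
    using assms by (simp add: frechet_derivative_works)
  then have lin: "linear (frechet_derivative f (at x))" by (rule has_derivative_linear)
  have eq: "frechet_derivative f (at x) = (\<lambda>h. h \<bullet> D)"
  proof
    fix h
    have "frechet_derivative f (at x) h = frechet_derivative f (at x) (\<Sum>b\<in>Basis. (h \<bullet> b) *\<^sub>R b)"
      by (simp add: euclidean_representation)
    also have "\<dots> = h \<bullet> D"
      by (simp add: D_def linear_sum[OF lin] linear_cmul[OF lin] inner_sum_right mult.commute)
    finally show "frechet_derivative f (at x) h = h \<bullet> D" .
  qed
  have G: "GDERIV f x :> D" using d unfolding eq gderiv_def .
  have gD: "gradient f x = D"
    unfolding gradient_def
  proof (rule the_equality)
    show "GDERIV f x :> D" by (rule G)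
    fix D' assume "GDERIV f x :> D'"
    then have "(\<lambda>h. h \<bullet> D') = (\<lambda>h. h \<bullet> D)"
      using G unfolding gderiv_def by (rule has_derivative_unique)
    then have "h \<bullet> D' = h \<bullet> D" for h by (rule fun_cong)
    then show "D' = D" by (simp only: vector_eq_ldot[symmetric, of D' D]) simp
  qed
  then show "gradient f x = (\<Sum>b\<in>Basis. frechet_derivative f (at x) b *\<^sub>R b)" by (simp add: D_def)
  show "(f has_derivative (\<lambda>h. gradient f x \<bullet> h)) (at x)"
    using G unfolding gD gderiv_def by (simp add: inner_commute)
qed

lemma Ck_on_Suc_continuous:
  assumes "Ck_on (Suc n) S f" shows "continuous_on S f"
  by (intro continuous_at_imp_continuous_on ballI differentiable_imp_continuous_within) (use assms in simp)

lemma Ck_on_SucD: "Ck_on (Suc n) S f \<Longrightarrow> Ck_on n S f"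
proof (induction n arbitrary: f)
  case 0
  from Ck_on_Suc_continuous[OF this] show ?case by simp
next
  case (Suc n)
  from Suc.prems have "\<forall>x\<in>S. f differentiable (at x)"
    and "\<And>v. Ck_on (Suc n) S (\<lambda>x. frechet_derivative f (at x) v)"
    by simp_all
  with Suc.IH show ?case by auto
qed

lemma Ck_on_partial: "Ck_on (Suc n) S f \<Longrightarrow> Ck_on n S (partial_deriv i f)"
  by (simp add: partial_deriv_def[abs_def])

lemma gradient_differentiable:
  fixes f :: "'a::euclidean_space \<Rightarrow> real"
  assumes "smooth_on UNIV f"
  shows "f differentiable (at x)" "gradient f differentiable (at x)" "continuous_on UNIV (gradient f)"
proof -
  have C: "Ck_on (Suc (Suc 0)) UNIV f" using assms unfolding smooth_on_def by blast
  then show d: "f differentiable (at x)" for x by simp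
  have eq: "gradient f = (\<lambda>x. \<Sum>b\<in>Basis. frechet_derivative f (at x) b *\<^sub>R b)"
    using gradient_works(2)[OF d] by blast
  show g: "gradient f differentiable (at x)" for x
    unfolding eq using C by (intro differentiable_sum differentiable_scaleR) auto
  then show "continuous_on UNIV (gradient f)"
    by (auto intro!: continuous_at_imp_continuous_on differentiable_imp_continuous_within)
qed

section \<open>Quadratic behaviour at the wells and at infinity\<close>

lemma line_derivative:
  assumes "\<And>y. (V has_derivative (\<lambda>h. g y \<bullet> h)) (at y)"
  shows "((\<lambda>t. V (x + t *\<^sub>R d)) has_real_derivative g (x + t *\<^sub>R d) \<bullet> d) (at t)"
proof -
  have "((\<lambda>t. x + t *\<^sub>R d) has_derivative (\<lambda>h. h *\<^sub>R d)) (at t)"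
    by (auto intro!: derivative_eq_intros)
  from has_derivative_compose[OF this assms] show ?thesis
    by (simp add: has_field_derivative_def mult_commute_abs)
qed

text \<open>A well is a minimum, so \<open>g\<close> vanishes there. Compactness of the unit sphere
  makes \<open>A\<close> uniformly coercive with a constant \<open>c\<close>, and differentiability
  of \<open>g\<close> leaves a remainder of at most half of it. The mean value theorem along
  segments from the well transfers the bounds from \<open>g\<close> to \<open>V\<close>.\<close>

lemma quadratic_well:
  fixes V :: "'a::euclidean_space \<Rightarrow> real"
  assumes V: "\<And>y. (V has_derivative (\<lambda>h. g y \<bullet> h)) (at y)" "\<And>y. 0 \<le> V y" "V \<sigma> = 0"
    and g: "(g has_derivative A) (at \<sigma>)" and A: "\<And>v. v \<noteq> 0 \<Longrightarrow> 0 < v \<bullet> A v"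
  shows "\<exists>\<delta>>0. \<exists>c>0. \<exists>L>0. \<forall>y. norm (y - \<sigma>) < \<delta> \<longrightarrow>
    c * ((y - \<sigma>) \<bullet> (y - \<sigma>)) \<le> V y \<and> V y \<le> L * ((y - \<sigma>) \<bullet> (y - \<sigma>)) \<and>
    c * ((y - \<sigma>) \<bullet> (y - \<sigma>)) \<le> (y - \<sigma>) \<bullet> g y \<and> norm (g y) \<le> L * norm (y - \<sigma>)"
proof -
  have "(\<lambda>h. g \<sigma> \<bullet> h) = (\<lambda>h. 0)"
    using V by (intro differential_zero_maxmin[of \<sigma> UNIV V]) auto
  then have g0: "g \<sigma> = 0" by (metis inner_eq_zero_iff)
  have bl: "bounded_linear A" using g by (rule has_derivative_bounded_linear)
  then obtain L0 where L0: "0 < L0" "\<And>v. norm (A v) \<le> norm v * L0"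
    using bounded_linear.pos_bounded by blast
  obtain c where c: "0 < c" "\<And>v. c * (v \<bullet> v) \<le> v \<bullet> A v"
  proof -
    have "continuous_on (sphere 0 1) (\<lambda>v. v \<bullet> A v)"
      by (intro continuous_intros linear_continuous_on bl)
    then obtain v0 where v0: "v0 \<in> sphere 0 (1::real)" "\<And>v. v \<in> sphere 0 1 \<Longrightarrow> v0 \<bullet> A v0 \<le> v \<bullet> A v"
      using continuous_attains_inf[of "sphere (0::'a) 1" "\<lambda>v. v \<bullet> A v"] by auto
    have "v0 \<noteq> 0" using v0(1) by auto
    then have c0: "0 < v0 \<bullet> A v0" by (rule A)
    have "v0 \<bullet> A v0 * (v \<bullet> v) \<le> v \<bullet> A v" for v
    proof (cases "v = 0")
      case False
      define w where "w = (1 / norm v) *\<^sub>R v"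
      have w: "w \<in> sphere 0 1" "v = norm v *\<^sub>R w" using False by (auto simp: w_def)
      have "v \<bullet> A v = (norm v)\<^sup>2 * (w \<bullet> A w)"
        by (subst (1 2) w(2)) (simp add: linear_cmul[OF bounded_linear.linear[OF bl]] power2_eq_square)
      then show ?thesis using mult_left_mono[OF v0(2)[OF w(1)] zero_le_power2[of "norm v"]]
        by (simp add: dot_square_norm mult.commute)
    qed (simp add: bounded_linear.linear[OF bl] linear_0)
    then show ?thesis using that c0 by blast
  qed
  obtain \<delta> where \<delta>: "0 < \<delta>" "\<And>y. norm (y - \<sigma>) < \<delta> \<Longrightarrow> norm (g y - g \<sigma> - A (y - \<sigma>)) \<le> (c / 2) * norm (y - \<sigma>)"
    using g c(1) unfolding has_derivative_at_alt by (meson half_gt_zero)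
  have rad: "c / 2 * ((y - \<sigma>) \<bullet> (y - \<sigma>)) \<le> (y - \<sigma>) \<bullet> g y"
    and gn: "norm (g y) \<le> (L0 + c / 2) * norm (y - \<sigma>)" if "norm (y - \<sigma>) < \<delta>" for y
  proof -
    let ?r = "g y - A (y - \<sigma>)"
    have r: "norm ?r \<le> c / 2 * norm (y - \<sigma>)" using \<delta>(2)[OF that] g0 by simp
    have "\<bar>(y - \<sigma>) \<bullet> ?r\<bar> \<le> norm (y - \<sigma>) * (c / 2 * norm (y - \<sigma>))"
      using Cauchy_Schwarz_ineq2[of "y - \<sigma>" ?r] mult_left_mono[OF r norm_ge_zero[of "y - \<sigma>"]] by linarith
    also have "\<dots> = c / 2 * ((y - \<sigma>) \<bullet> (y - \<sigma>))" by (simp add: dot_square_norm power2_eq_square)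
    finally have "\<bar>(y - \<sigma>) \<bullet> g y - (y - \<sigma>) \<bullet> A (y - \<sigma>)\<bar> \<le> c / 2 * ((y - \<sigma>) \<bullet> (y - \<sigma>))"
      by (simp only: inner_diff_right[of _ "g y"])
    then show "c / 2 * ((y - \<sigma>) \<bullet> (y - \<sigma>)) \<le> (y - \<sigma>) \<bullet> g y" using c(2)[of "y - \<sigma>"] by linarith
    have "norm (g y) \<le> norm (A (y - \<sigma>)) + norm ?r" using norm_triangle_sub by blast
    then show "norm (g y) \<le> (L0 + c / 2) * norm (y - \<sigma>)"
      using r L0(2)[of "y - \<sigma>"] by (simp add: algebra_simps)
  qed
  have Vb: "c / 4 * ((y - \<sigma>) \<bullet> (y - \<sigma>)) \<le> V y" "V y \<le> (L0 + c / 2) * ((y - \<sigma>) \<bullet> (y - \<sigma>))"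
    if y: "norm (y - \<sigma>) < \<delta>" for y
  proof -
    define d where "d = y - \<sigma>"
    have inb: "norm ((\<sigma> + t *\<^sub>R d) - \<sigma>) < \<delta>" if "0 < t" "t < 1" for t
      using that y mult_left_le_one_le[of "norm d" t] by (simp add: d_def)
    \<comment> \<open>After subtracting the quadratic the derivative is nonnegative, so a single use
      of the mean value theorem gives the quadratic lower bound.\<close>
    have "((\<lambda>t. V (\<sigma> + t *\<^sub>R d) - c / 4 * (d \<bullet> d) * t\<^sup>2) has_real_derivative g (\<sigma> + t *\<^sub>R d) \<bullet> d - c / 2 * (d \<bullet> d) * t) (at t)" for t
      by (rule derivative_eq_intros line_derivative[OF V(1)] refl | simp)+
    from MVT2[OF zero_less_one, OF this] obtain t where t: "0 < t" "t < 1" and e: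
      "V (\<sigma> + 1 *\<^sub>R d) - c / 4 * (d \<bullet> d) * 1\<^sup>2 - (V (\<sigma> + 0 *\<^sub>R d) - c / 4 * (d \<bullet> d) * 0\<^sup>2)
        = (1 - 0) * (g (\<sigma> + t *\<^sub>R d) \<bullet> d - c / 2 * (d \<bullet> d) * t)"
      by blast
    have "t * (c / 2 * (d \<bullet> d) * t) \<le> t * (g (\<sigma> + t *\<^sub>R d) \<bullet> d)"
      using rad[OF inb[OF t]] by (simp add: inner_commute algebra_simps)
    then have "c / 2 * (d \<bullet> d) * t \<le> g (\<sigma> + t *\<^sub>R d) \<bullet> d" using t by simp
    then show "c / 4 * ((y - \<sigma>) \<bullet> (y - \<sigma>)) \<le> V y" using e V(3) by (simp add: d_def)
    from MVT2[OF zero_less_one, OF line_derivative[OF V(1), of \<sigma> d]]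
    obtain t where t: "0 < t" "t < 1" and e: "V (\<sigma> + 1 *\<^sub>R d) - V (\<sigma> + 0 *\<^sub>R d) = (1 - 0) * (g (\<sigma> + t *\<^sub>R d) \<bullet> d)"
      by blast
    have "g (\<sigma> + t *\<^sub>R d) \<bullet> d \<le> norm (g (\<sigma> + t *\<^sub>R d)) * norm d" by (rule norm_cauchy_schwarz)
    also have "\<dots> \<le> ((L0 + c / 2) * norm d) * norm d"
    proof (rule mult_right_mono)
      have "norm (g (\<sigma> + t *\<^sub>R d)) \<le> (L0 + c / 2) * (t * norm d)" using gn[OF inb[OF t]] t by simp
      also have "\<dots> \<le> (L0 + c / 2) * norm d" using t L0 c by (intro mult_left_mono) (auto simp: mult_left_le_one_le)
      finally show "norm (g (\<sigma> + t *\<^sub>R d)) \<le> (L0 + c / 2) * norm d" .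
    qed simp
    finally show "V y \<le> (L0 + c / 2) * ((y - \<sigma>) \<bullet> (y - \<sigma>))"
      using e V(3) by (simp add: d_def dot_square_norm power2_eq_square)
  qed
  show ?thesis
  proof (rule exI[of _ \<delta>], rule conjI[OF \<delta>(1)], rule exI[of _ "c / 4"], rule conjI[rotated],
      rule exI[of _ "L0 + c / 2"], intro conjI allI impI)
    fix y assume y: "norm (y - \<sigma>) < \<delta>"
    have "c / 4 * ((y - \<sigma>) \<bullet> (y - \<sigma>)) \<le> c / 2 * ((y - \<sigma>) \<bullet> (y - \<sigma>))" using c by (intro mult_right_mono) auto
    then show "c / 4 * ((y - \<sigma>) \<bullet> (y - \<sigma>)) \<le> (y - \<sigma>) \<bullet> g y" using rad[OF y] by linarith
  qed (use Vb gn c L0 in \<open>auto simp: add_pos_pos\<close>)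
qed

text \<open>The radial condition is integrated along the ray from radius \<open>R\<close> to
  \<open>y\<close>, which gives at least \<alpha>/2 times |y|^2 - R^2.\<close>

lemma quadratic_growth:
  fixes V :: "'a::euclidean_space \<Rightarrow> real"
  assumes V: "\<And>y. (V has_derivative (\<lambda>h. g y \<bullet> h)) (at y)" "\<And>y. 0 \<le> V y"
    and rad: "\<And>y. R < norm y \<Longrightarrow> \<alpha> * (norm y)\<^sup>2 \<le> y \<bullet> g y" and pos: "0 < \<alpha>" "0 < R"
  shows "y \<bullet> y \<le> (R\<^sup>2 + 2 / \<alpha>) * (1 + V y)"
proof -
  have "y \<bullet> y \<le> R\<^sup>2 + 2 / \<alpha> * V y"
  proof (cases "norm y \<le> R")
    case True
    then have "y \<bullet> y \<le> R\<^sup>2" by (simp add: dot_square_norm power_mono)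
    moreover have "0 \<le> 2 / \<alpha> * V y" using V pos by simp
    ultimately show ?thesis by linarith
  next
    case False
    define a where "a = R / norm y"
    have n: "0 < norm y" using False pos by linarith
    have a: "0 < a" "a < 1" "a * norm y = R" using False pos n by (auto simp: a_def)
    have "((\<lambda>t. V (0 + t *\<^sub>R y) - \<alpha> / 2 * (y \<bullet> y) * t\<^sup>2) has_real_derivative g (0 + t *\<^sub>R y) \<bullet> y - \<alpha> * (y \<bullet> y) * t) (at t)" for t
      by (rule derivative_eq_intros line_derivative[OF V(1)] refl | simp)+
    from MVT2[OF a(2), OF this] obtain t where t: "a < t" "t < 1" and e:
      "V (0 + 1 *\<^sub>R y) - \<alpha> / 2 * (y \<bullet> y) * 1\<^sup>2 - (V (0 + a *\<^sub>R y) - \<alpha> / 2 * (y \<bullet> y) * a\<^sup>2)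
        = (1 - a) * (g (0 + t *\<^sub>R y) \<bullet> y - \<alpha> * (y \<bullet> y) * t)"
      by blast
    have "a * norm y < t * norm y" using t n by simp
    then have "R < norm (t *\<^sub>R y)" using a t by simp
    from rad[OF this] have "t * (\<alpha> * (y \<bullet> y) * t) \<le> t * (g (t *\<^sub>R y) \<bullet> y)"
      by (simp add: inner_commute dot_square_norm power_mult_distrib power2_eq_square algebra_simps)
    then have "\<alpha> * (y \<bullet> y) * t \<le> g (t *\<^sub>R y) \<bullet> y" using t a by simp
    then have "0 \<le> (1 - a) * (g (0 + t *\<^sub>R y) \<bullet> y - \<alpha> * (y \<bullet> y) * t)" using a by simp
    then have "\<alpha> / 2 * (y \<bullet> y) \<le> V y - V (a *\<^sub>R y) + \<alpha> / 2 * ((y \<bullet> y) * a\<^sup>2)" using e by (simp add: algebra_simps)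
    moreover have "(y \<bullet> y) * a\<^sup>2 = R\<^sup>2" unfolding a(3)[symmetric] by (simp add: dot_square_norm power_mult_distrib)
    ultimately have "\<alpha> / 2 * (y \<bullet> y) \<le> V y + \<alpha> / 2 * R\<^sup>2" using V(2)[of "a *\<^sub>R y"] by simp
    then show ?thesis using pos by (simp add: field_simps)
  qed
  also have "\<dots> \<le> (R\<^sup>2 + 2 / \<alpha>) * (1 + V y)"
    using mult_nonneg_nonneg[OF zero_le_power2[of R] V(2)[of y]] pos by (simp add: distrib_left distrib_right)
  finally show ?thesis .
qed

text \<open>Outside a large ball \<open>V\<close> is at least 1; inside, it attains its minimum on a
  compact set without zeros.\<close>

lemma positive_away_from_zeros:
  fixes V :: "'a::euclidean_space \<Rightarrow> real"
  assumes cont: "continuous_on UNIV V" and V0: "\<And>y. 0 \<le> V y" and inf: "filterlim V at_top at_infinity"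
    and F: "closed F" "\<And>y. y \<in> F \<Longrightarrow> V y \<noteq> 0"
  shows "\<exists>c>0. \<forall>y\<in>F. c \<le> V y"
proof -
  obtain B where B: "\<And>y. B \<le> norm y \<Longrightarrow> 1 \<le> V y"
    using inf unfolding filterlim_at_top eventually_at_infinity by metis
  let ?K = "F \<inter> cball 0 B"
  have K: "compact ?K" using F(1) by (intro closed_Int_compact) auto
  show ?thesis
  proof (cases "?K = {}")
    case True
    then have "\<forall>y\<in>F. 1 \<le> V y" using B by (force simp: not_le)
    then show ?thesis by (intro exI[of _ 1]) auto
  next
    case False
    obtain y0 where y0: "y0 \<in> ?K" "\<And>y. y \<in> ?K \<Longrightarrow> V y0 \<le> V y"
      using continuous_attains_inf[OF K False continuous_on_subset[OF cont]] by blast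
    have "0 < V y0" using V0[of y0] F(2)[of y0] y0(1) by auto
    moreover have "min 1 (V y0) \<le> V y" if "y \<in> F" for y
      using y0(2)[of y] B[of y] that by (cases "norm y \<le> B") auto
    ultimately show ?thesis by (intro exI[of _ "min 1 (V y0)"]) auto
  qed
qed

lemma multiwell_of_hypotheses:
  fixes V :: "real ^ 'k \<Rightarrow> real"
  assumes sm: "smooth_on UNIV V"
    and bdd: "bdd_below (range V)" and inf0: "(INF y. V y) = 0"
    and fin: "finite {y. V y = 0}" and card: "card {y. V y = 0} \<ge> 2"
    and hess: "\<forall>\<sigma>\<in>{y. V y = 0}. pos_def_matrix (hessian V \<sigma>)"
    and rad: "\<exists>\<alpha>>0. \<exists>R>0. \<forall>y. norm y > R \<longrightarrow> y \<bullet> gradient V y \<ge> \<alpha> * (norm y)\<^sup>2"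
    and lim: "filterlim V at_top at_infinity"
  shows "\<exists>m lam Lam c0 K R. multiwell V (gradient V) {y. V y = 0} m lam Lam c0 K R"
proof -
  let ?g = "gradient V"
  define S where "S = {y. V y = 0}"
  have Vd: "(V has_derivative (\<lambda>h. ?g y \<bullet> h)) (at y)" for y
    by (rule gradient_works(1)[OF gradient_differentiable(1)[OF sm]])
  have V0: "0 \<le> V y" for y using cINF_lower[OF bdd, of y] inf0 by simp
  have Vc: "continuous_on UNIV V" using Vd by (meson has_derivative_continuous_on has_derivative_at_withinI)
  have S: "finite S" "S \<noteq> {}" using fin card unfolding S_def by (fastforce simp del: Collect_empty_eq)+
  obtain \<alpha> R where \<alpha>: "0 < \<alpha>" and R: "0 < R" and rad: "\<And>y. R < norm y \<Longrightarrow> \<alpha> * (norm y)\<^sup>2 \<le> y \<bullet> ?g y"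
    using rad by blast
  have "\<forall>\<sigma>\<in>S. \<exists>\<delta>>0. \<exists>c>0. \<exists>L>0. \<forall>y. norm (y - \<sigma>) < \<delta> \<longrightarrow>
    c * ((y - \<sigma>) \<bullet> (y - \<sigma>)) \<le> V y \<and> V y \<le> L * ((y - \<sigma>) \<bullet> (y - \<sigma>)) \<and>
    c * ((y - \<sigma>) \<bullet> (y - \<sigma>)) \<le> (y - \<sigma>) \<bullet> ?g y \<and> norm (?g y) \<le> L * norm (y - \<sigma>)"
  proof
    fix \<sigma> assume \<sigma>: "\<sigma> \<in> S"
    have "(?g has_derivative (\<lambda>h. hessian V \<sigma> *v h)) (at \<sigma>)"
      using gradient_differentiable(2)[OF sm, of \<sigma>] unfolding hessian_def jacobian_works .
    moreover have "0 < v \<bullet> (hessian V \<sigma> *v v)" if "v \<noteq> 0" for v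
      using hess \<sigma> that by (auto simp: S_def pos_def_matrix_def)
    ultimately show "\<exists>\<delta>>0. \<exists>c>0. \<exists>L>0. \<forall>y. norm (y - \<sigma>) < \<delta> \<longrightarrow>
      c * ((y - \<sigma>) \<bullet> (y - \<sigma>)) \<le> V y \<and> V y \<le> L * ((y - \<sigma>) \<bullet> (y - \<sigma>)) \<and>
      c * ((y - \<sigma>) \<bullet> (y - \<sigma>)) \<le> (y - \<sigma>) \<bullet> ?g y \<and> norm (?g y) \<le> L * norm (y - \<sigma>)"
      using \<sigma> by (intro quadratic_well[OF Vd V0]) (auto simp: S_def)
  qed
  then obtain \<delta> c L where \<delta>: "\<And>\<sigma>. \<sigma> \<in> S \<Longrightarrow> 0 < \<delta> \<sigma>" and c: "\<And>\<sigma>. \<sigma> \<in> S \<Longrightarrow> 0 < c \<sigma>" and L: "\<And>\<sigma>. \<sigma> \<in> S \<Longrightarrow> 0 < L \<sigma>"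
    and well: "\<And>\<sigma> y. \<sigma> \<in> S \<Longrightarrow> norm (y - \<sigma>) < \<delta> \<sigma> \<Longrightarrow>
       c \<sigma> * ((y - \<sigma>) \<bullet> (y - \<sigma>)) \<le> V y \<and> V y \<le> L \<sigma> * ((y - \<sigma>) \<bullet> (y - \<sigma>)) \<and>
       c \<sigma> * ((y - \<sigma>) \<bullet> (y - \<sigma>)) \<le> (y - \<sigma>) \<bullet> ?g y \<and> norm (?g y) \<le> L \<sigma> * norm (y - \<sigma>)"
    by metis
  have "\<forall>\<sigma>\<in>S. \<exists>r>0. \<forall>\<tau>\<in>S. \<tau> \<noteq> \<sigma> \<longrightarrow> r \<le> dist \<sigma> \<tau>" using finite_set_avoid[OF S(1)] by blast
  from bchoice[OF this]
  obtain r where r: "\<And>\<sigma>. \<sigma> \<in> S \<Longrightarrow> 0 < r \<sigma>" "\<And>\<sigma> \<tau>. \<sigma> \<in> S \<Longrightarrow> \<tau> \<in> S \<Longrightarrow> \<tau> \<noteq> \<sigma> \<Longrightarrow> r \<sigma> \<le> dist \<sigma> \<tau>"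
    by blast
  \<comment> \<open>A radius below the quadratic range of every well and below the distance of any
    two wells. With \<open>m\<close> the square of half of it, a point close to two wells would
    contradict the triangle inequality.\<close>
  define \<rho> where "\<rho> = Min ((\<lambda>\<sigma>. min (\<delta> \<sigma>) (r \<sigma>)) ` S)"
  have \<rho>: "0 < \<rho>" unfolding \<rho>_def using S \<delta> r(1) by (subst Min_gr_iff) auto
  have \<rho>_le: "\<rho> \<le> \<delta> \<sigma>" "\<rho> \<le> r \<sigma>" if "\<sigma> \<in> S" for \<sigma>
  proof -
    have "\<rho> \<le> min (\<delta> \<sigma>) (r \<sigma>)" unfolding \<rho>_def using S that by (intro Min_le) auto
    then show "\<rho> \<le> \<delta> \<sigma>" "\<rho> \<le> r \<sigma>" by auto
  qed
  define m where "m = (\<rho> / 2)\<^sup>2"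
  have m: "0 < m" using \<rho> by (simp add: m_def)
  have m_norm: "norm v \<le> \<rho> / 2" if "v \<bullet> v \<le> m" for v :: "real ^ 'k"
    by (rule power2_le_imp_le) (use that \<rho> in \<open>auto simp: m_def dot_square_norm\<close>)
  define lam where "lam = Min (c ` S)"
  define Lam where "Lam = Max (L ` S)"
  have lam: "0 < lam" "\<And>\<sigma>. \<sigma> \<in> S \<Longrightarrow> lam \<le> c \<sigma>"
    unfolding lam_def using S c by (auto simp: Min_gr_iff)
  have Lam_le: "\<And>\<sigma>. \<sigma> \<in> S \<Longrightarrow> L \<sigma> \<le> Lam" unfolding Lam_def using S by auto
  have Lam: "0 < Lam" using Lam_le L S(2) by (meson all_not_in_conv less_le_trans)
  have near: "lam * ((y - \<sigma>) \<bullet> (y - \<sigma>)) \<le> V y \<and> V y \<le> Lam * ((y - \<sigma>) \<bullet> (y - \<sigma>)) \<and>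
       lam * ((y - \<sigma>) \<bullet> (y - \<sigma>)) \<le> (y - \<sigma>) \<bullet> ?g y \<and> norm (?g y) \<le> Lam * norm (y - \<sigma>)"
    if \<sigma>: "\<sigma> \<in> S" and y: "(y - \<sigma>) \<bullet> (y - \<sigma>) \<le> m" for \<sigma> y
  proof -
    have "norm (y - \<sigma>) < \<delta> \<sigma>" using m_norm[OF y] \<rho> \<rho>_le(1)[OF \<sigma>] by linarith
    moreover have "lam * ((y - \<sigma>) \<bullet> (y - \<sigma>)) \<le> c \<sigma> * ((y - \<sigma>) \<bullet> (y - \<sigma>))"
      "L \<sigma> * ((y - \<sigma>) \<bullet> (y - \<sigma>)) \<le> Lam * ((y - \<sigma>) \<bullet> (y - \<sigma>))" "L \<sigma> * norm (y - \<sigma>) \<le> Lam * norm (y - \<sigma>)"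
      using lam(2)[OF \<sigma>] Lam_le[OF \<sigma>] by (intro mult_right_mono; simp)+
    ultimately show ?thesis using well[OF \<sigma>, of y] by linarith
  qed
  have disj: "m \<le> (y - \<tau>) \<bullet> (y - \<tau>)" if "\<sigma> \<in> S" "\<tau> \<in> S" "\<sigma> \<noteq> \<tau>" "(y - \<sigma>) \<bullet> (y - \<sigma>) < m" for \<sigma> \<tau> y
  proof (rule ccontr)
    have lt: "norm v < \<rho> / 2" if "v \<bullet> v < m" for v :: "real ^ 'k"
      by (rule power2_less_imp_less) (use that \<rho> in \<open>auto simp: m_def dot_square_norm\<close>)
    assume "\<not> ?thesis"
    then have "norm (y - \<tau>) < \<rho> / 2" "norm (y - \<sigma>) < \<rho> / 2" using lt that(4) by auto
    then have "dist \<sigma> \<tau> < \<rho>"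
      using dist_triangle[of \<sigma> \<tau> y] by (simp add: dist_norm norm_minus_commute)
    moreover have "\<rho> \<le> dist \<sigma> \<tau>" using \<rho>_le(2)[OF that(1)] r(2)[OF that(1,2)] that(3) by force
    ultimately show False by simp
  qed
  \<comment> \<open>The weak inequality makes the set closed; it contains the set described by the
    strict one in \<open>away\<close>.\<close>
  let ?F = "{y. \<forall>\<sigma>\<in>S. m / 16 \<le> (y - \<sigma>) \<bullet> (y - \<sigma>)}"
  have "closed (\<Inter>\<sigma>\<in>S. {y. m / 16 \<le> (y - \<sigma>) \<bullet> (y - \<sigma>)})"
    by (intro closed_INT ballI closed_Collect_le continuous_intros)
  then have "closed ?F" by (simp add: Collect_ball_eq)
  moreover have "V y \<noteq> 0" if "y \<in> ?F" for y
  proof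
    assume "V y = 0"
    then have "m / 16 \<le> (y - y) \<bullet> (y - y)" using that by (auto simp: S_def)
    then show False using m by simp
  qed
  ultimately have "\<exists>c>0. \<forall>y\<in>?F. c \<le> V y"
    by (rule positive_away_from_zeros[OF Vc V0 lim])
  then obtain c0 where c0: "0 < c0" "\<And>y. y \<in> ?F \<Longrightarrow> c0 \<le> V y" by blast
  have "multiwell V ?g S m lam Lam c0 (R\<^sup>2 + 2 / \<alpha>) R"
  proof
    show "finite S" "S \<noteq> {}" by fact+
    show "0 \<le> V y" "(V has_derivative (\<lambda>h. ?g y \<bullet> h)) (at y)" for y by (rule V0 Vd)+
    show "continuous_on UNIV ?g" by (rule gradient_differentiable(3)[OF sm])
    show "0 < m" "0 < lam" "0 < Lam" "0 < c0" "0 < R" by fact+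
    show "0 < R\<^sup>2 + 2 / \<alpha>" using R \<alpha> by (simp add: add_pos_pos)
    show "c0 \<le> V y" if "\<And>\<sigma>. \<sigma> \<in> S \<Longrightarrow> m / 16 < (y - \<sigma>) \<bullet> (y - \<sigma>)" for y
      using that by (intro c0(2)) (auto intro: less_imp_le)
    show "y \<bullet> y \<le> (R\<^sup>2 + 2 / \<alpha>) * (1 + V y)" for y
      by (rule quadratic_growth[OF Vd V0 rad \<alpha> R])
    show "0 \<le> y \<bullet> ?g y" if "R < norm y" for y
      using rad[OF that] \<alpha> by (meson mult_nonneg_nonneg less_imp_le order_trans zero_le_power2)
  qed (use near disj in auto)
  then show ?thesis unfolding S_def by blast
qed

section \<open>From the disc to squares\<close>

text \<open>Identifies the product type, on which iterated integrals are available, with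
  \<open>real ^ 2\<close>, on which the solution is defined.\<close>

definition emb :: "real \<times> real \<Rightarrow> real ^ 2" where
  "emb z = fst z *\<^sub>R axis 1 1 + snd z *\<^sub>R axis 2 1"

lemma emb_nth: "emb z $ 1 = fst z" "emb z $ 2 = snd z"
  by (simp_all add: emb_def axis_def)

lemma continuous_on_emb: "continuous_on A emb"
  unfolding emb_def[abs_def] by (intro continuous_intros)

lemma norm_emb: "(norm (emb z))\<^sup>2 = (fst z)\<^sup>2 + (snd z)\<^sup>2"
proof -
  have "(norm (emb z))\<^sup>2 = (\<Sum>i\<in>UNIV. (emb z $ i)\<^sup>2)"
    by (simp add: norm_vec_def L2_set_def sum_nonneg)
  then show ?thesis by (simp add: sum_2 emb_nth)
qed

text \<open>The corners decide: 2 * (7/10)^2 = 98/100 < 1.\<close>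

lemma emb_in_ball:
  assumes "z \<in> sq (7 / 10)" shows "emb z \<in> ball 0 1"
proof -
  have "(fst z)\<^sup>2 \<le> (7 / 10)\<^sup>2" "(snd z)\<^sup>2 \<le> (7 / 10)\<^sup>2"
    using assms by (auto simp: mem_sq_abs abs_le_square_iff[symmetric])
  then have "(norm (emb z))\<^sup>2 < 1\<^sup>2" unfolding norm_emb by (simp add: power_divide)
  then have "norm (emb z) < 1" by (rule power2_less_imp_less) simp
  then show ?thesis by simp
qed

lemma ball_in_sq:
  assumes "emb z \<in> ball 0 r" shows "z \<in> sq r"
proof -
  have "\<bar>fst z\<bar> \<le> norm (emb z)" "\<bar>snd z\<bar> \<le> norm (emb z)"
    using component_le_norm_cart[of "emb z" 1] component_le_norm_cart[of "emb z" 2] by (auto simp: emb_nth)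
  then show ?thesis using assms by (auto simp: mem_sq_abs)
qed

lemma Basis_real2: "(Basis :: (real ^ 2) set) = {axis 1 1, axis 2 1}"
  by (auto simp: Basis_vec_def UNIV_2)

lemma Basis_real_prod: "(Basis :: (real \<times> real) set) = {(1, 0), (0, 1)}"
  by (auto simp: Basis_prod_def)

text \<open>Lebesgue measure is determined by its values on boxes, and \<open>emb\<close> pulls
  boxes back to boxes of the same area.\<close>

lemma lborel_emb: "(lborel :: (real ^ 2) measure) = distr lborel borel emb"
proof (rule lborel_eqI)
  fix l u :: "real ^ 2"
  assume lu: "\<And>b. b \<in> Basis \<Longrightarrow> l \<bullet> b \<le> u \<bullet> b"
  have meas: "emb \<in> borel_measurable borel"
    by (intro borel_measurable_continuous_onI continuous_on_emb)
  have pre: "emb -` box l u = box (l $ 1, l $ 2) (u $ 1, u $ 2)"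
    by (auto simp: mem_box Basis_real2 Basis_real_prod inner_axis emb_nth)
  have le: "l $ 1 \<le> u $ 1" "l $ 2 \<le> u $ 2"
    using lu[of "axis 1 1"] lu[of "axis 2 1"] by (auto simp: Basis_real2 inner_axis)
  have ne: "axis 1 1 \<noteq> (axis 2 1 :: real ^ 2)" by (simp add: axis_eq_axis)
  have "emeasure (distr lborel borel emb) (box l u) = emeasure lborel (box (l $ 1, l $ 2) (u $ 1, u $ 2))"
    using meas by (simp add: emeasure_distr pre)
  also have "\<dots> = ennreal ((u $ 1 - l $ 1) * (u $ 2 - l $ 2))"
    using le by (subst emeasure_lborel_box) (auto simp: Basis_real_prod)
  also have "(u $ 1 - l $ 1) * (u $ 2 - l $ 2) = (\<Prod>b\<in>Basis. (u - l) \<bullet> b)"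
    using ne by (simp add: Basis_real2 inner_axis)
  finally show "emeasure (distr lborel borel emb) (box l u) = ennreal (\<Prod>b\<in>Basis. (u - l) \<bullet> b)" .
qed simp

lemma has_partials_emb:
  fixes f :: "real ^ 2 \<Rightarrow> 'b::real_normed_vector"
  assumes f: "Ck_on (Suc 0) U f" and S: "\<And>z. z \<in> S \<Longrightarrow> emb z \<in> U"
  shows "has_partials S (\<lambda>z. f (emb z)) (\<lambda>z. partial_deriv 1 f (emb z)) (\<lambda>z. partial_deriv 2 f (emb z))"
proof -
  have d: "(f has_derivative frechet_derivative f (at x)) (at x)" if "x \<in> U" for x
    using f that by (simp add: frechet_derivative_works)
  have c: "continuous_on S (\<lambda>z. h (emb z))" if "continuous_on U h" for h :: "real ^ 2 \<Rightarrow> 'b"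
    by (rule continuous_on_compose2[OF that continuous_on_emb]) (use S in auto)
  have e: "((\<lambda>t. emb (t, y)) has_derivative (\<lambda>h. h *\<^sub>R axis 1 1)) (at x)"
    "((\<lambda>t. emb (x, t)) has_derivative (\<lambda>h. h *\<^sub>R axis 2 1)) (at y)" for x y
    unfolding emb_def by (auto intro!: derivative_eq_intros)
  have p: "continuous_on U (partial_deriv i f)" for i
    using f by (simp add: partial_deriv_def[abs_def])
  have "((\<lambda>t. f (emb (t, y))) has_vector_derivative partial_deriv 1 f (emb (x, y))) (at x)"
    "((\<lambda>t. f (emb (x, t))) has_vector_derivative partial_deriv 2 f (emb (x, y))) (at y)"
    if "(x, y) \<in> S" for x y
  proof -
    note D = d[OF S[OF that]]
    note lin = linear_cmul[OF has_derivative_linear[OF D]]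
    show "((\<lambda>t. f (emb (t, y))) has_vector_derivative partial_deriv 1 f (emb (x, y))) (at x)"
      using has_derivative_compose[OF e(1) D] by (simp add: has_vector_derivative_def partial_deriv_def lin)
    show "((\<lambda>t. f (emb (x, t))) has_vector_derivative partial_deriv 2 f (emb (x, y))) (at y)"
      using has_derivative_compose[OF e(2) D] by (simp add: has_vector_derivative_def partial_deriv_def lin)
  qed
  then show ?thesis
    unfolding has_partials_def using c[OF Ck_on_Suc_continuous[OF f]] c[OF p] by blast
qed

text \<open>The increment of \<open>f\<close> in the first variable is the integral of
  \<open>p\<close>. Differentiating under the integral sign in the second variable expresses the
  increment of \<open>q\<close> as the integral of \<open>p2\<close>; differentiating this in the
  first variable gives the claim. It justifies the shared \<open>p2\<close> in
  \<open>solves\<close>.\<close>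

lemma mixed_partials_eq:
  fixes f :: "real \<times> real \<Rightarrow> 'a::banach"
  assumes f: "has_partials S f p q" and p: "has_partials S p p1 p2" and q: "has_partials S q q1 q2"
    and S: "open S" and z: "z \<in> S"
  shows "p2 z = q1 z"
proof -
  obtain x0 y0 where z0: "z = (x0, y0)" by (cases z)
  obtain e where e: "0 < e" "cball z e \<subseteq> S" using S z open_contains_cball by blast
  define d where "d = e / 2"
  have d: "0 < d" using e by (simp add: d_def)
  have inS: "(x, y) \<in> S" if "\<bar>x - x0\<bar> \<le> d" "\<bar>y - y0\<bar> \<le> d" for x y
  proof -
    have "dist z (x, y) \<le> \<bar>x - x0\<bar> + \<bar>y - y0\<bar>"
      using norm_Pair_le[of "x - x0" "y - y0"] by (simp add: z0 dist_norm norm_minus_commute abs_minus_commute norm_Pair power2_commute)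
    then show ?thesis using that e(2) by (auto simp: d_def)
  qed
  let ?a = "x0 - d" and ?I = "{y0 - d..y0 + d}"
  note df = has_partialsD[OF f] and dp = has_partialsD[OF p] and dq = has_partialsD[OF q]
  have row: "continuous_on {?a..x0 + d} (\<lambda>x. h (x, y0))" if "continuous_on S h" for h :: "real \<times> real \<Rightarrow> 'a"
    by (rule continuous_on_compose2[OF that]) (use inS d in \<open>auto intro!: continuous_intros\<close>)
  have key: "q (s, y0) - q (?a, y0) = integral {?a..s} (\<lambda>x. p2 (x, y0))" if s: "s \<in> {?a..x0 + d}" for s
  proof -
    have rect: "(x, y) \<in> S" if "x \<in> {?a..s}" "y \<in> ?I" for x y
      using that s by (intro inS) auto
    have eq: "f (s, y) - f (?a, y) = integral {?a..s} (\<lambda>x. p (x, y))" if "y \<in> ?I" for y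
      using s rect[OF _ that] df(4)
      by (intro integral_unique[symmetric] fundamental_theorem_of_calculus has_vector_derivative_at_within[OF df(4)]) auto
    have "((\<lambda>y. integral (cbox ?a s) (\<lambda>x. p (x, y))) has_vector_derivative integral (cbox ?a s) (\<lambda>x. p2 (x, y0))) (at y0 within ?I)"
    proof (rule leibniz_rule_vector_derivative)
      show "((\<lambda>y. p (x, y)) has_vector_derivative p2 (x, y)) (at y within ?I)"
        if "y \<in> ?I" "x \<in> cbox ?a s" for y x
        using rect[of x y] that by (intro has_vector_derivative_at_within[OF dp(5)]) auto
      show "(\<lambda>x. p (x, y)) integrable_on cbox ?a s" if "y \<in> ?I" for y
        by (intro integrable_continuous continuous_on_compose2[OF dp(1)])
          (use rect that in \<open>auto intro!: continuous_intros\<close>)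
      show "continuous_on (?I \<times> cbox ?a s) (\<lambda>(y, x). p2 (x, y))"
        unfolding case_prod_unfold
        by (rule continuous_on_compose2[OF dp(3)]) (use rect in \<open>auto intro!: continuous_intros\<close>)
    qed (use d in auto)
    then have "((\<lambda>y. integral {?a..s} (\<lambda>x. p (x, y))) has_vector_derivative integral {?a..s} (\<lambda>x. p2 (x, y0))) (at y0 within ?I)"
      by simp
    then have "((\<lambda>y. f (s, y) - f (?a, y)) has_vector_derivative integral {?a..s} (\<lambda>x. p2 (x, y0))) (at y0 within ?I)"
      by (rule has_vector_derivative_transform[rotated 2]) (use eq d in auto)
    then have "((\<lambda>y. f (s, y) - f (?a, y)) has_vector_derivative integral {?a..s} (\<lambda>x. p2 (x, y0))) (at y0)"
      using d at_within_Icc_at[of "y0 - d" y0 "y0 + d"] by simp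
    moreover have "((\<lambda>y. f (s, y) - f (?a, y)) has_vector_derivative q (s, y0) - q (?a, y0)) (at y0)"
      using s d by (intro has_vector_derivative_diff df(5) inS) auto
    ultimately show ?thesis by (rule vector_derivative_unique_at[symmetric])
  qed
  have "((\<lambda>s. integral {?a..s} (\<lambda>x. p2 (x, y0))) has_vector_derivative p2 (x0, y0)) (at x0 within {?a..x0 + d})"
    using d by (intro integral_has_vector_derivative row dp) auto
  then have "((\<lambda>s. q (s, y0) - q (?a, y0)) has_vector_derivative p2 (x0, y0)) (at x0 within {?a..x0 + d})"
    by (rule has_vector_derivative_transform[rotated 2]) (use key d in auto)
  then have "((\<lambda>s. q (s, y0) - q (?a, y0)) has_vector_derivative p2 (x0, y0)) (at x0)"
    using d at_within_Icc_at[of ?a x0 "x0 + d"] by simp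
  moreover have "((\<lambda>s. q (s, y0) - q (?a, y0)) has_vector_derivative q1 (x0, y0) - 0) (at x0)"
    using z z0 by (intro has_vector_derivative_diff dq(4)) auto
  ultimately show ?thesis using vector_derivative_unique_at z0 by fastforce
qed

lemma solves_emb:
  fixes u :: "real ^ 2 \<Rightarrow> real ^ 'k"
  assumes sol: "allen_cahn_solution V \<epsilon> u (ball 0 1)" and \<epsilon>: "0 < \<epsilon>"
  shows "solves (gradient V) \<epsilon> (7 / 10) (\<lambda>z. u (emb z)) (\<lambda>z. partial_deriv 1 u (emb z)) (\<lambda>z. partial_deriv 2 u (emb z))
     (\<lambda>z. partial_deriv 1 (partial_deriv 1 u) (emb z)) (\<lambda>z. partial_deriv 2 (partial_deriv 1 u) (emb z))
     (\<lambda>z. partial_deriv 2 (partial_deriv 2 u) (emb z))"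
proof -
  let ?O = "emb -` ball 0 1"
  have sm: "Ck_on (Suc (Suc 0)) (ball 0 1) u"
    and eq: "\<And>x. x \<in> ball 0 1 \<Longrightarrow> - laplacian u x = - ((1 / \<epsilon>\<^sup>2) *\<^sub>R gradient V (u x))"
    using sol unfolding allen_cahn_solution_def smooth_on_def by blast+
  have sm1: "Ck_on (Suc 0) (ball 0 1) u" by (rule Ck_on_SucD[OF sm])
  have p: "Ck_on (Suc 0) (ball 0 1) (partial_deriv i u)" for i by (rule Ck_on_partial[OF sm])
  have hu: "has_partials ?O (\<lambda>z. u (emb z)) (\<lambda>z. partial_deriv 1 u (emb z)) (\<lambda>z. partial_deriv 2 u (emb z))"
    by (rule has_partials_emb[OF sm1]) simp
  have hp: "has_partials ?O (\<lambda>z. partial_deriv i u (emb z)) (\<lambda>z. partial_deriv 1 (partial_deriv i u) (emb z)) (\<lambda>z. partial_deriv 2 (partial_deriv i u) (emb z))" for i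
    by (rule has_partials_emb[OF p]) simp
  have "open ?O" using continuous_on_emb by (intro open_vimage) auto
  then have mixed: "partial_deriv 2 (partial_deriv 1 u) (emb z) = partial_deriv 1 (partial_deriv 2 u) (emb z)" if "z \<in> ?O" for z
    using mixed_partials_eq[OF hu hp hp _ that] by simp
  have sub: "sq (7 / 10) \<subseteq> ?O" using emb_in_ball by auto
  have hq: "has_partials (sq (7 / 10)) (\<lambda>z. partial_deriv 2 u (emb z)) (\<lambda>z. partial_deriv 2 (partial_deriv 1 u) (emb z)) (\<lambda>z. partial_deriv 2 (partial_deriv 2 u) (emb z))"
  proof -
    have "has_partials (sq (7 / 10)) (\<lambda>z. partial_deriv 2 u (emb z)) (\<lambda>z. partial_deriv 1 (partial_deriv 2 u) (emb z)) (\<lambda>z. partial_deriv 2 (partial_deriv 2 u) (emb z))"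
      by (rule has_partials_subset[OF hp sub])
    then show ?thesis by (rule has_partials_cong) (use mixed sub in blast)
  qed
  have "\<epsilon>\<^sup>2 *\<^sub>R (partial_deriv 1 (partial_deriv 1 u) (emb z) + partial_deriv 2 (partial_deriv 2 u) (emb z)) = gradient V (u (emb z))"
    if "z \<in> sq (7 / 10)" for z
  proof -
    have "laplacian u (emb z) = (1 / \<epsilon>\<^sup>2) *\<^sub>R gradient V (u (emb z))"
      using eq[OF emb_in_ball[OF that]] by (simp only: neg_equal_iff_equal)
    then show ?thesis using \<epsilon> by (simp add: laplacian_def sum_2)
  qed
  then show ?thesis
    unfolding solves_def using has_partials_subset[OF hu sub] has_partials_subset[OF hp sub] hq by blast
qed

lemma energy_eq_emb:
  fixes u :: "real ^ 2 \<Rightarrow> real ^ 'k"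
  assumes c: "continuous_on (ball 0 r) (energy_density V \<epsilon> u)"
  shows "energy V \<epsilon> u (ball 0 r) = (\<integral>\<^sup>+z. ennreal (energy_density V \<epsilon> u (emb z)) * indicator (ball 0 r) (emb z) \<partial>lborel)"
proof -
  \<comment> \<open>Continuity is known on the ball only, so measurability is shown for the density
    cut off by the indicator.\<close>
  have "(\<lambda>x. ennreal (indicator (ball 0 r) x *\<^sub>R energy_density V \<epsilon> u x)) \<in> borel_measurable borel"
    using borel_measurable_continuous_on_indicator[OF _ c] by simp
  moreover have "(\<lambda>x. ennreal (indicator (ball 0 r) x *\<^sub>R energy_density V \<epsilon> u x))
     = (\<lambda>x. ennreal (energy_density V \<epsilon> u x) * indicator (ball 0 r) x)"
    by (auto simp: indicator_def)
  ultimately have m: "(\<lambda>x. ennreal (energy_density V \<epsilon> u x) * indicator (ball 0 r) x) \<in> borel_measurable borel"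
    by simp
  have "emb \<in> borel_measurable borel"
    by (intro borel_measurable_continuous_onI continuous_on_emb)
  then show ?thesis
    unfolding energy_def lborel_emb by (subst nn_integral_distr) (use m in auto)
qed

section \<open>The energy estimate on discs\<close>

lemma powr_three_halves:
  assumes "0 \<le> x" shows "sqrt x * x = x powr (3 / 2)"
proof (cases "x = 0")
  case False
  then have x: "0 < x" using assms by simp
  then have "sqrt x * x = x powr (1 / 2) * x powr 1" by (simp add: powr_half_sqrt)
  also have "\<dots> = x powr (3 / 2)" by (simp only: powr_add[symmetric]) simp
  finally show ?thesis .
qed simp

theorem proposition3:
  fixes V :: "real ^ 'k \<Rightarrow> real"
  assumes "smooth_on UNIV V"
    and "bdd_below (range V)" and "(INF y. V y) = 0"
    and "finite {y. V y = 0}" and "card {y. V y = 0} \<ge> 2"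
    and "\<forall>\<sigma>\<in>{y. V y = 0}. pos_def_matrix (hessian V \<sigma>)"
    and "\<exists>\<alpha>>0. \<exists>R>0. \<forall>y. norm y > R \<longrightarrow> y \<bullet> gradient V y \<ge> \<alpha> * (norm y)\<^sup>2"
    and "filterlim V at_top at_infinity"
  shows "\<exists>C::real. C > 0 \<and>
    (\<forall>\<epsilon>::real. 0 < \<epsilon> \<and> \<epsilon> \<le> 1 \<longrightarrow>
      (\<forall>u :: real ^ 2 \<Rightarrow> real ^ 'k. allen_cahn_solution V \<epsilon> u (ball 0 1) \<longrightarrow>
        energy V \<epsilon> u (ball 0 (9 / 16)) \<le>
          ennreal C * (ennreal_powr (energy V \<epsilon> u (ball 0 1)) (3 / 2)
                       + ennreal \<epsilon> * energy V \<epsilon> u (ball 0 1))))"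
proof -
  obtain m lam Lam c0 K R where "multiwell V (gradient V) {y. V y = 0} m lam Lam c0 K R"
    using multiwell_of_hypotheses[OF assms] by blast
  then interpret multiwell V "gradient V" "{y. V y = 0}" m lam Lam c0 K R .
  obtain C where C: "0 < C" and decay: "\<forall>\<epsilon> u p q p1 p2 q2. 0 < \<epsilon> \<longrightarrow> \<epsilon> \<le> 1 \<longrightarrow> solves (gradient V) \<epsilon> (7 / 10) u p q p1 p2 q2 \<longrightarrow>
     integral (sq (9 / 16)) (edens \<epsilon> u p q)
       \<le> C * (sqrt (integral (sq (7 / 10)) (edens \<epsilon> u p q)) + \<epsilon>) * integral (sq (7 / 10)) (edens \<epsilon> u p q)"
    using interior_energy_decay by (elim exE conjE)
  show ?thesis
  proof (intro exI[of _ C] conjI allI impI)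
    show "0 < C" by fact
    fix \<epsilon> :: real and u :: "real ^ 2 \<Rightarrow> real ^ 'k"
    assume "0 < \<epsilon> \<and> \<epsilon> \<le> 1" and sol: "allen_cahn_solution V \<epsilon> u (ball 0 1)"
    then have \<epsilon>: "0 < \<epsilon>" "\<epsilon> \<le> 1" by auto
    let ?e = "edens \<epsilon> (\<lambda>z. u (emb z)) (\<lambda>z. partial_deriv 1 u (emb z)) (\<lambda>z. partial_deriv 2 u (emb z))"
    have ed: "energy_density V \<epsilon> u (emb z) = ?e z" for z
      by (simp add: energy_density_def edens_def sum_2 dot_square_norm)
    have "Ck_on (Suc (Suc 0)) (ball 0 1) u"
      using sol unfolding allen_cahn_solution_def smooth_on_def by blast
    then have cu: "continuous_on (ball 0 1) u" "\<And>i. continuous_on (ball 0 1) (partial_deriv i u)"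
      using Ck_on_Suc_continuous Ck_on_partial by blast+
    have ced: "continuous_on (ball 0 1) (energy_density V \<epsilon> u)"
      unfolding energy_density_def[abs_def] by (intro continuous_intros V_comp_cont cu) simp
    have e0: "0 \<le> ?e z" for z using edens_nonneg[OF \<epsilon>(1)] .
    have cont: "continuous_on (sq (7 / 10)) ?e"
    proof -
      have "continuous_on (sq (7 / 10)) (\<lambda>z. energy_density V \<epsilon> u (emb z))"
        by (rule continuous_on_compose2[OF ced continuous_on_emb]) (use emb_in_ball in auto)
      then show ?thesis by (simp add: ed)
    qed
    \<comment> \<open>Links the Lebesgue integral in the energy with the gauge integral used on
      squares; both are finite there by continuity on the closed square.\<close>
    have nn: "(\<integral>\<^sup>+z. ennreal (?e z) * indicator (sq r) z \<partial>lborel) = ennreal (integral (sq r) ?e)" if "r \<le> 7 / 10" for r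
      by (intro nn_integral_has_integral_lebesgue' integrable_integral integrable_sq
          continuous_on_subset[OF cont sq_mono[OF that]] e0)
    define E where "E = integral (sq (7 / 10)) ?e"
    have E0: "0 \<le> E" unfolding E_def by (intro integral_sq_nonneg cont e0)
    have upper: "energy V \<epsilon> u (ball 0 (9 / 16)) \<le> ennreal (integral (sq (9 / 16)) ?e)"
    proof -
      have "energy V \<epsilon> u (ball 0 (9 / 16)) = (\<integral>\<^sup>+z. ennreal (?e z) * indicator (ball 0 (9 / 16)) (emb z) \<partial>lborel)"
        unfolding ed[symmetric] by (intro energy_eq_emb continuous_on_subset[OF ced]) auto
      also have "\<dots> \<le> (\<integral>\<^sup>+z. ennreal (?e z) * indicator (sq (9 / 16)) z \<partial>lborel)"
        using ball_in_sq by (intro nn_integral_mono mult_left_mono) (auto simp: indicator_def simp del: mem_ball)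
      finally show ?thesis using nn[of "9 / 16"] by simp
    qed
    \<comment> \<open>The right-hand side is increasing in the energy, so a lower bound by the
      finite \<open>E\<close> suffices even if the energy on the disc is infinite.\<close>
    have lower: "ennreal E \<le> energy V \<epsilon> u (ball 0 1)"
    proof -
      have "ennreal E = (\<integral>\<^sup>+z. ennreal (?e z) * indicator (sq (7 / 10)) z \<partial>lborel)"
        unfolding E_def using nn[of "7 / 10"] by simp
      also have "\<dots> \<le> (\<integral>\<^sup>+z. ennreal (?e z) * indicator (ball 0 1) (emb z) \<partial>lborel)"
        using emb_in_ball by (intro nn_integral_mono mult_left_mono) (auto simp: indicator_def simp del: mem_ball)
      also have "\<dots> = energy V \<epsilon> u (ball 0 1)"
        unfolding ed[symmetric] by (intro energy_eq_emb[symmetric] ced)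
      finally show ?thesis .
    qed
    have "energy V \<epsilon> u (ball 0 (9 / 16)) \<le> ennreal (C * (sqrt E + \<epsilon>) * E)"
      using upper decay[rule_format, OF \<epsilon> solves_emb[OF sol \<epsilon>(1)]] unfolding E_def
      by (meson ennreal_leI order_trans)
    also have "C * (sqrt E + \<epsilon>) * E = C * (E powr (3 / 2) + \<epsilon> * E)"
      using powr_three_halves[OF E0] by (simp add: algebra_simps)
    also have "ennreal \<dots> = ennreal C * (ennreal (E powr (3 / 2)) + ennreal \<epsilon> * ennreal E)"
      using C \<epsilon> E0 by (simp add: ennreal_mult ennreal_plus)
    also have "\<dots> \<le> ennreal C * (ennreal_powr (energy V \<epsilon> u (ball 0 1)) (3 / 2) + ennreal \<epsilon> * energy V \<epsilon> u (ball 0 1))"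
    proof (intro mult_left_mono add_mono lower)
      show "ennreal (E powr (3 / 2)) \<le> ennreal_powr (energy V \<epsilon> u (ball 0 1)) (3 / 2)"
      proof (cases "energy V \<epsilon> u (ball 0 1) = \<infinity>")
        case False
        then have "E \<le> enn2real (energy V \<epsilon> u (ball 0 1))"
          using lower E0 by (cases "energy V \<epsilon> u (ball 0 1)") auto
        then show ?thesis
          using False E0 unfolding ennreal_powr_def by (auto intro!: ennreal_leI powr_mono2)
      qed (simp add: ennreal_powr_def)
    qed auto
    finally show "energy V \<epsilon> u (ball 0 (9 / 16)) \<le>
          ennreal C * (ennreal_powr (energy V \<epsilon> u (ball 0 1)) (3 / 2)
                       + ennreal \<epsilon> * energy V \<epsilon> u (ball 0 1))" .
  qed
qed

end
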